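(* Let $n=2p$, $J_n=\begin{pmatrix} 0 & -I_p \\ I_p & 0 \end{pmatrix}$, and let $Q\in L^1_{\mathrm{loc}}(\mathbb{R}_+,\mathbb{C}^{n\times n})$ have bounded imaginary part $Q_2=\mathrm{Im}\,Q$. Let $\Phi=\Phi^*\in\mathbb{C}^{p\times p}$, and let $\varphi(\cdot,\lambda)$ and $\psi(\cdot,\lambda)$ be the $n\times p$ matrix solutions of $J_ny'+Q(x)y=\lambda y$ on $\mathbb{R}_+$ with initial values $$\varphi(0,\lambda)=\begin{pmatrix} -\sin\Phi \\ \cos\Phi \end{pmatrix},\qquad\psi(0,\lambda)=\begin{pmatrix} \cos\Phi \\ \sin\Phi \end{pmatrix}.$$ Then: (i) The Weyl function $M_\Phi(\cdot)$ is the unique operator-function $M(\cdot):\rho(\widetilde A_\Phi)\to\mathbb{C}^{p\times p}$ such that $$\varphi(\cdot,\lambda)M(\lambda)+\psi(\cdot,\lambda)\in L^2(\mathbb{R}_+,\mathbb{C}^{n\times p}),\qquad\lambda\in\rho(\widetilde A_\Phi).$$ (ii) $M_\Phi(\cdot)$ is holomorphic in $\rho(\widetilde A_\Phi)$ and satisfies $$M_\Phi(\lambda)-M_\Phi^*(\mu)=\int_{\mathbb{R}_+}v_\Phi^*(x,\mu)\bigl((\lambda-\overline\mu)I_n-2iQ_2(x)\bigr)v_\Phi(x,\lambda)\,dx,\qquad\lambda,\mu\in\rho(\widetilde A_\Phi),$$ $$\mathrm{Im}\,M_\Phi(\lambda)=\int_{\mathbb{R}_+}v_\Phi^*(x,\lambda)\bigl(\mathrm{Im}\,\lambda\cdot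 I_n-Q_2(x)\bigr)v_\Phi(x,\lambda)\,dx,\qquad\lambda\in\rho(\widetilde A_\Phi).$$ Moreover, $$\mathrm{Im}\,M_\Phi(\lambda)\ge\delta_\lambda I,\ \ \lambda\in\mathbb{C}_{\beta_Q,+};\qquad \mathrm{Im}\,M_\Phi(\lambda)\le\delta'_\lambda I,\ \ \lambda\in\mathbb{C}_{\alpha_Q,-},$$ with some $\delta_\lambda>0$ and $\delta'_\lambda<0$ (depending on $\lambda$).
   Context: $\mathbb{R}_+=[0,\infty)$ and $D(Q)y=J_ny'+Q(x)y$. The maximal operator $D^+_{\max}(Q)$ in $L^2(\mathbb{R}_+,\mathbb{C}^n)$ has domain $\{y\in L^2: y\in AC_{\mathrm{loc}}(\mathbb{R}_+,\mathbb{C}^n),\ D(Q)y\in L^2\}$ and acts as $y\mapsto D(Q)y$. Write $y=\{y_1,y_2\}$ with $y_1,y_2$ being $\mathbb{C}^p$-valued. For $\Phi=\Phi^*\in\mathbb{C}^{p\times p}$, $\widetilde A_\Phi$ is the restriction of $D^+_{\max}(Q)$ to $\{y\in\mathrm{dom}\,D^+_{\max}(Q):\cos\Phi\cdot y_1(0)+\sin\Phi\cdot y_2(0)=0\}$, and $\rho(\widetilde A_\Phi)$ is its resolvent set (it contains $\mathbb{C}_{\alpha_Q,-}\cup\mathbb{C}_{\beta_Q,+}$). For each $\lambda\in\rho(\widetilde A_\Phi)$ there is a unique $n\times p$ matrix solution $v_\Phi(\cdot,\lambda)=(v_{1,\Phi},v_{2,\Phi})^\top\in L^2(\mathbb{R}_+,\mathbb{C}^{n\times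 p})$ of $D(Q)y=\lambda y$ with $\cos\Phi\cdot v_{1,\Phi}(0,\lambda)+\sin\Phi\cdot v_{2,\Phi}(0,\lambda)=I_p$ (the Weyl solution). The Weyl function is $M_\Phi(\lambda)=-\sin\Phi\cdot v_{1,\Phi}(0,\lambda)+\cos\Phi\cdot v_{2,\Phi}(0,\lambda)$, $\lambda\in\rho(\widetilde A_\Phi)$. Here $\mathrm{Im}\,T=\frac1{2i}(T-T^* )$ for a matrix $T$; $Q_2(x)=\mathrm{Im}\,Q(x)$ is bounded means $\|Q_2(x)\|\le C$ on $\mathbb{R}_+$ for some $C$; $\alpha_Q$ and $\beta_Q$ are the essential infimum over $x\in\mathbb{R}_+$ of the smallest eigenvalue of $Q_2(x)$ and the essential supremum of the largest eigenvalue of $Q_2(x)$, respectively; $\mathbb{C}_{\alpha,+}=\{z:\mathrm{Im}\,z>\alpha\}$, $\mathbb{C}_{\alpha,-}=\{z:\mathrm{Im}\,z<\alpha\}$. *)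

theory Defs
  imports "HOL-Analysis.Analysis"
begin

text \<open>
  The even dimension \<open>n = 2p\<close> is the index type \<^typ>\<open>'p + 'p\<close> with \<open>p = CARD('p)\<close>;
  \<open>Inl\<close> and \<open>Inr\<close> index the first and the second block of \<open>p\<close> coordinates.
  Since \<^term>\<open>mat c\<close> is \<open>c\<close> times the identity, multiplying a complex matrix by the scalar \<open>c\<close>
  is written \<open>mat c ** A\<close>.
\<close>


section \<open>Matrices\<close>

definition ctrans :: "complex^'n^'m \<Rightarrow> complex^'m^'n"
  where "ctrans A = map_matrix cnj (transpose A)"

definition Im_mat :: "complex^'n^'n \<Rightarrow> complex^'n^'n"
  where "Im_mat A = mat (1 / (2 * \<i>)) ** (A - ctrans A)"

definition cdot :: "complex^'n \<Rightarrow> complex^'n \<Rightarrow> complex"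
  where "cdot u v = (\<Sum>i\<in>UNIV. u $ i * cnj (v $ i))"

definition loewner_le :: "complex^'n^'n \<Rightarrow> complex^'n^'n \<Rightarrow> bool"
  where "loewner_le A B \<longleftrightarrow>
    (\<forall>v. cdot ((B - A) *v v) v \<in> \<real> \<and> 0 \<le> Re (cdot ((B - A) *v v) v))"

definition eigenvalues :: "complex^'n^'n \<Rightarrow> complex set"
  where "eigenvalues A = {c. \<exists>v. v \<noteq> 0 \<and> A *v v = c *s v}"

text \<open>These two are only meant for Hermitian matrices, whose eigenvalues are real.\<close>

definition min_eigenvalue :: "complex^'n^'n \<Rightarrow> real"
  where "min_eigenvalue A = Min (Re ` eigenvalues A)"

definition max_eigenvalue :: "complex^'n^'n \<Rightarrow> real"
  where "max_eigenvalue A = Max (Re ` eigenvalues A)"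

definition matpow :: "complex^'n^'n \<Rightarrow> nat \<Rightarrow> complex^'n^'n"
  where "matpow A k = (((**) A) ^^ k) (mat 1)"

text \<open>
  The library functions \<^const>\<open>cos\<close> and \<^const>\<open>sin\<close> do not apply to matrices, because
  \<open>*\<close> on \<^type>\<open>vec\<close> is the componentwise product; the same power series is used here
  with matrix powers.
\<close>

definition mcos :: "complex^'n^'n \<Rightarrow> complex^'n^'n"
  where "mcos A = (\<Sum>k. cos_coeff k *\<^sub>R matpow A k)"

definition msin :: "complex^'n^'n \<Rightarrow> complex^'n^'n"
  where "msin A = (\<Sum>k. sin_coeff k *\<^sub>R matpow A k)"

text \<open>
  Block decomposition. With entries of type \<open>'a = complex\<close> these act on vectors, with
  \<open>'a = complex^'p\<close> on matrices (whose entries are rows).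
\<close>

definition upper :: "'a^('p::finite + 'p) \<Rightarrow> 'a^'p"
  where "upper y = (\<chi> i. y $ Inl i)"

definition lower :: "'a^('p::finite + 'p) \<Rightarrow> 'a^'p"
  where "lower y = (\<chi> i. y $ Inr i)"

definition stack :: "'a^'p \<Rightarrow> 'a^'p \<Rightarrow> 'a^('p::finite + 'p)"
  where "stack y1 y2 = (\<chi> k. case k of Inl i \<Rightarrow> y1 $ i | Inr i \<Rightarrow> y2 $ i)"

definition Jmat :: "complex^('p::finite + 'p)^('p + 'p)"
  where "Jmat = stack (\<chi> i. stack 0 (- (mat 1 :: complex^'p^'p) $ i))
                      (\<chi> i. stack ((mat 1 :: complex^'p^'p) $ i) 0)"


section \<open>Function spaces on the half-line\<close>

text \<open>
  Functions on the half-line are represented by functions on \<^typ>\<open>real\<close> of which only the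
  values on \<open>{0..}\<close> matter.
\<close>

abbreviation leb_half :: "real measure"
  where "leb_half \<equiv> lebesgue_on {0..}"

definition L2_half :: "(real \<Rightarrow> 'a::euclidean_space) set"
  where "L2_half = {f. f \<in> borel_measurable leb_half \<and> integrable leb_half (\<lambda>x. (norm (f x))\<^sup>2)}"

definition L2_norm :: "(real \<Rightarrow> 'a::euclidean_space) \<Rightarrow> real"
  where "L2_norm f = sqrt (LINT x|leb_half. (norm (f x))\<^sup>2)"

definition L1_loc_half :: "(real \<Rightarrow> 'a::euclidean_space) set"
  where "L1_loc_half = {f. \<forall>b\<ge>0. f absolutely_integrable_on {0..b}}"

text \<open>A pair \<open>(c, d)\<close> in \<open>P\<close> stands for the interval from \<open>c\<close> to \<open>d\<close>.\<close>

definition abs_continuous_on :: "real \<Rightarrow> real \<Rightarrow> (real \<Rightarrow> 'a::real_normed_vector) \<Rightarrow> bool"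
  where "abs_continuous_on a b y \<longleftrightarrow>
    (\<forall>\<epsilon>>0. \<exists>\<delta>>0. \<forall>P. finite P \<and> (\<forall>(c, d)\<in>P. a \<le> c \<and> c \<le> d \<and> d \<le> b)
        \<and> pairwise (\<lambda>(c, d) (c', d'). disjnt {c<..<d} {c'<..<d'}) P
        \<and> (\<Sum>(c, d)\<in>P. d - c) < \<delta>
      \<longrightarrow> (\<Sum>(c, d)\<in>P. norm (y d - y c)) < \<epsilon>)"

definition AC_loc_half :: "(real \<Rightarrow> 'a::real_normed_vector) set"
  where "AC_loc_half = {y. \<forall>b\<ge>0. abs_continuous_on 0 b y}"


section \<open>The operator and its resolvent set\<close>

text \<open>
  For locally absolutely continuous \<open>y\<close> the derivative exists almost everywhere, and
  \<open>dirac Q y\<close> is only considered up to null sets.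
\<close>

definition dirac ::
    "(real \<Rightarrow> complex^('p::finite + 'p)^('p + 'p)) \<Rightarrow> (real \<Rightarrow> complex^('p + 'p)) \<Rightarrow> real \<Rightarrow> complex^('p + 'p)"
  where "dirac Q y x = Jmat *v vector_derivative y (at x) + Q x *v y x"

definition dom_max ::
    "(real \<Rightarrow> complex^('p::finite + 'p)^('p + 'p)) \<Rightarrow> (real \<Rightarrow> complex^('p + 'p)) set"
  where "dom_max Q = {y \<in> L2_half. y \<in> AC_loc_half \<and> dirac Q y \<in> L2_half}"

definition dom_A ::
    "(real \<Rightarrow> complex^('p::finite + 'p)^('p + 'p)) \<Rightarrow> complex^'p^'p \<Rightarrow> (real \<Rightarrow> complex^('p + 'p)) set"
  where "dom_A Q \<Phi> = {y \<in> dom_max Q. mcos \<Phi> *v upper (y 0) + msin \<Phi> *v lower (y 0) = 0}"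

text \<open>
  Resolvent set of the operator \<open>T\<close> with domain \<open>D\<close> in the Hilbert space of square integrable
  functions modulo equality almost everywhere: \<open>T - z\<close> is onto, one-to-one and has a bounded
  inverse.
\<close>

definition resolvent_set ::
    "(real \<Rightarrow> complex^'n) set \<Rightarrow> ((real \<Rightarrow> complex^'n) \<Rightarrow> real \<Rightarrow> complex^'n) \<Rightarrow> complex set"
  where "resolvent_set D T = {z.
      (\<forall>f\<in>L2_half. \<exists>y\<in>D. AE x in leb_half. T y x - z *s y x = f x)
    \<and> (\<forall>y\<in>D. (AE x in leb_half. T y x - z *s y x = 0) \<longrightarrow> (AE x in leb_half. y x = 0))
    \<and> (\<exists>C. \<forall>y\<in>D. L2_norm y \<le> C * L2_norm (\<lambda>x. T y x - z *s y x))}"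

definition rho_A :: "(real \<Rightarrow> complex^('p::finite + 'p)^('p + 'p)) \<Rightarrow> complex^'p^'p \<Rightarrow> complex set"
  where "rho_A Q \<Phi> = resolvent_set (dom_A Q \<Phi>) (dirac Q)"


section \<open>Weyl solution and Weyl function\<close>

definition matrix_solution ::
    "(real \<Rightarrow> complex^('p::finite + 'p)^('p + 'p)) \<Rightarrow> complex \<Rightarrow> (real \<Rightarrow> complex^'p^('p + 'p)) \<Rightarrow> bool"
  where "matrix_solution Q z Y \<longleftrightarrow> Y \<in> AC_loc_half \<and>
    (AE x in leb_half. Jmat ** vector_derivative Y (at x) + Q x ** Y x = mat z ** Y x)"

text \<open>\<^const>\<open>extensional\<close> fixes the irrelevant values outside the half-line, so that the
  description is definite.\<close>

definition weyl_solution ::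
    "(real \<Rightarrow> complex^('p::finite + 'p)^('p + 'p)) \<Rightarrow> complex^'p^'p \<Rightarrow> complex \<Rightarrow> real \<Rightarrow> complex^'p^('p + 'p)"
  where "weyl_solution Q \<Phi> z = (THE v. v \<in> extensional {0..} \<and> matrix_solution Q z v \<and>
    v \<in> L2_half \<and> mcos \<Phi> ** upper (v 0) + msin \<Phi> ** lower (v 0) = mat 1)"

definition weyl_function ::
    "(real \<Rightarrow> complex^('p::finite + 'p)^('p + 'p)) \<Rightarrow> complex^'p^'p \<Rightarrow> complex \<Rightarrow> complex^'p^'p"
  where "weyl_function Q \<Phi> z =
    - (msin \<Phi> ** upper (weyl_solution Q \<Phi> z 0)) + mcos \<Phi> ** lower (weyl_solution Q \<Phi> z 0)"


section \<open>Essential bounds of the imaginary part\<close>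

text \<open>The limits inferior and superior along \<^const>\<open>ae_filter\<close> are the essential infimum and
  the essential supremum.\<close>

definition alpha_Q :: "(real \<Rightarrow> complex^'n^'n) \<Rightarrow> ereal"
  where "alpha_Q Q = Liminf (ae_filter leb_half) (\<lambda>x. ereal (min_eigenvalue (Im_mat (Q x))))"

definition beta_Q :: "(real \<Rightarrow> complex^'n^'n) \<Rightarrow> ereal"
  where "beta_Q Q = Limsup (ae_filter leb_half) (\<lambda>x. ereal (max_eigenvalue (Im_mat (Q x))))"

definition upper_half :: "ereal \<Rightarrow> complex set"
  where "upper_half a = {z. a < ereal (Im z)}"

definition lower_half :: "ereal \<Rightarrow> complex set"
  where "lower_half a = {z. ereal (Im z) < a}"

end

theory Submission
  imports Defs
begin

text \<open>
  The weight of the Dirac expression is the identity. For \<open>y\<close> and \<open>u\<close> in the maximal domain the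
  boundary form \<open>\<langle>J y(x), u(x)\<rangle>\<close> is therefore integrable on the half-line, and so is its derivative:
  the Lagrange identity expresses it through \<open>D(Q) y\<close>, \<open>D(Q) u\<close> and the bounded imaginary part of the
  potential. An integrable function with integrable derivative tends to \<open>0\<close>, so integration by parts
  over the whole half-line leaves only the boundary form at \<open>0\<close> (\<open>lagrange_half_line\<close>). The integral
  formulas for the Weyl function are this identity for two columns of Weyl solutions, read in
  coordinates of \<open>\<complex>\<^sup>2\<^sup>p\<close> adapted to the boundary condition (\<open>weyl_identity\<close>).

  Since solutions are determined by their initial values, a Weyl solution is \<open>\<phi> M + \<psi>\<close> for a matrix \<open>M\<close>,
  and \<open>M\<close> is the Weyl function as soon as \<open>\<phi> M + \<psi>\<close> is square integrable (\<open>weyl_solution_eq\<close>,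
  \<open>weyl_function_eq\<close>). Existence and uniqueness of \<open>M\<close> have two sources. At a point of the resolvent
  set, cut off \<open>\<psi>\<close> near the origin and correct the error with the resolvent
  (\<open>rho_A_weyl_regular\<close>). In the two half-planes the energy \<open>\<integral> y\<^sup>* (Im z - Q\<^sub>2) y\<close> is definite; solutions
  on \<open>[0, n]\<close> with a boundary condition at \<open>n\<close> are then bounded uniformly in \<open>n\<close> and converge along a
  subsequence (\<open>definite_weyl_regular\<close>). There the quadratic form of the imaginary part of the Weyl
  function is the energy of the Weyl solution, which gives its sign (\<open>weyl_function_definite\<close>).

  For holomorphy at \<open>a\<close>, let \<open>r\<close> be the resolvent at \<open>a\<close> applied to the Weyl solution at \<open>a\<close>. The
  difference of the Weyl solutions at \<open>z\<close> and \<open>a\<close> is \<open>(z - a) r\<close> up to an error of second order in the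
  graph norm, and boundary values are continuous in the graph norm (\<open>weyl_function_derivative\<close>).

  These arguments differentiate products of solutions that are absolutely continuous in the sense of
  small variation over short families of intervals. So it is proved first that such functions are
  differentiable almost everywhere and are the integrals of their derivatives: the total variation
  splits them into monotone ones, whose Stieltjes measures have densities by the Radon-Nikodym
  theorem, and indefinite integrals are differentiable almost everywhere.
\<close>

section \<open>Absolutely continuous functions\<close>

text \<open>The families of intervals in the definition of absolute continuity. They are named
  because they will be cut, shrunk and joined.\<close>

definition nonoverlapping :: "real \<Rightarrow> real \<Rightarrow> (real \<times> real) set \<Rightarrow> bool"
  where "nonoverlapping a b P \<longleftrightarrow> finite P \<and> (\<forall>(c, d)\<in>P. a \<le> c \<and> c \<le> d \<and> d \<le> b)
        \<and> pairwise (\<lambda>(c, d) (c', d'). disjnt {c<..<d} {c'<..<d'}) P"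

definition variation_over :: "(real \<Rightarrow> 'a::real_normed_vector) \<Rightarrow> (real \<times> real) set \<Rightarrow> real"
  where "variation_over f P = (\<Sum>(c, d)\<in>P. norm (f d - f c))"

definition family_length :: "(real \<times> real) set \<Rightarrow> real"
  where "family_length P = (\<Sum>(c, d)\<in>P. d - c)"

lemma abs_continuous_on_alt:
  "abs_continuous_on a b f \<longleftrightarrow>
    (\<forall>e>0. \<exists>d>0. \<forall>P. nonoverlapping a b P \<and> family_length P < d \<longrightarrow> variation_over f P < e)"
  unfolding abs_continuous_on_def nonoverlapping_def variation_over_def family_length_def
  by (simp add: conj_assoc)

lemma abs_continuous_onE:
  assumes "abs_continuous_on a b f" "e > 0"
  obtains d where "d > 0" "\<And>P. nonoverlapping a b P \<Longrightarrow> family_length P < d \<Longrightarrow> variation_over f P < e"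
  using assms unfolding abs_continuous_on_alt by blast

lemma nonoverlapping_mono:
  "nonoverlapping a b P \<Longrightarrow> a' \<le> a \<Longrightarrow> b \<le> b' \<Longrightarrow> nonoverlapping a' b' P"
  unfolding nonoverlapping_def by fastforce

lemma nonoverlapping_single: "a \<le> c \<Longrightarrow> c \<le> d \<Longrightarrow> d \<le> b \<Longrightarrow> nonoverlapping a b {(c, d)}"
  unfolding nonoverlapping_def by auto

lemma abs_continuous_on_subset:
  "abs_continuous_on a b f \<Longrightarrow> a \<le> a' \<Longrightarrow> b' \<le> b \<Longrightarrow> abs_continuous_on a' b' f"
  unfolding abs_continuous_on_alt by (meson nonoverlapping_mono)

lemma abs_continuous_on_imp_continuous_on:
  fixes f :: "real \<Rightarrow> 'a::real_normed_vector"
  assumes "abs_continuous_on a b f"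
  shows "continuous_on {a..b} f"
  unfolding continuous_on_iff
proof (intro ballI allI impI)
  fix x and e :: real
  assume x: "x \<in> {a..b}" and e: "e > 0"
  obtain d where d: "d > 0"
    "\<And>P. nonoverlapping a b P \<Longrightarrow> family_length P < d \<Longrightarrow> variation_over f P < e"
    using abs_continuous_onE[OF assms e] by blast
  show "\<exists>d>0. \<forall>x'\<in>{a..b}. dist x' x < d \<longrightarrow> dist (f x') (f x) < e"
  proof (intro exI conjI ballI impI)
    fix y assume y: "y \<in> {a..b}" "dist y x < d"
    have "variation_over f {(min x y, max x y)} < e"
      using x y by (intro d(2) nonoverlapping_single)
        (auto simp: family_length_def dist_real_def min_def max_def)
    then show "dist (f y) (f x) < e"
      by (auto simp: variation_over_def dist_norm min_def max_def norm_minus_commute split: if_splits)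
  qed (use d in auto)
qed

text \<open>Every closure property of absolute continuity that is needed (sums, bounded linear images,
  bounded bilinear products, Lipschitz functions) says that the increments of one function are
  controlled by those of two others.\<close>

lemma abs_continuous_on_dominated:
  fixes f :: "real \<Rightarrow> 'a::real_normed_vector" and g :: "real \<Rightarrow> 'b::real_normed_vector"
    and h :: "real \<Rightarrow> 'c::real_normed_vector"
  assumes f: "abs_continuous_on a b f" and g: "abs_continuous_on a b g"
    and le: "\<And>c d. a \<le> c \<Longrightarrow> c \<le> d \<Longrightarrow> d \<le> b \<Longrightarrow>
                norm (h d - h c) \<le> K * (norm (f d - f c) + norm (g d - g c))"
  shows "abs_continuous_on a b h"
  unfolding abs_continuous_on_alt
proof (intro allI impI)
  fix e :: real assume e: "e > 0"
  define L where "L = \<bar>K\<bar> + 1"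
  have L: "L > 0" "K \<le> L" by (auto simp: L_def)
  then have e': "e / (2 * L) > 0" using e by simp
  obtain d1 where d1: "d1 > 0"
    "\<And>P. nonoverlapping a b P \<Longrightarrow> family_length P < d1 \<Longrightarrow> variation_over f P < e / (2 * L)"
    using abs_continuous_onE[OF f e'] by blast
  obtain d2 where d2: "d2 > 0"
    "\<And>P. nonoverlapping a b P \<Longrightarrow> family_length P < d2 \<Longrightarrow> variation_over g P < e / (2 * L)"
    using abs_continuous_onE[OF g e'] by blast
  show "\<exists>d>0. \<forall>P. nonoverlapping a b P \<and> family_length P < d \<longrightarrow> variation_over h P < e"
  proof (intro exI conjI allI impI)
    show "min d1 d2 > 0" using d1 d2 by simp
    fix P assume P: "nonoverlapping a b P \<and> family_length P < min d1 d2"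
    have "variation_over h P \<le> (\<Sum>p\<in>P. L * (norm (f (snd p) - f (fst p)) + norm (g (snd p) - g (fst p))))"
      unfolding variation_over_def case_prod_beta
    proof (rule sum_mono)
      fix p assume "p \<in> P"
      then have "a \<le> fst p" "fst p \<le> snd p" "snd p \<le> b"
        using P unfolding nonoverlapping_def by auto
      from le[OF this] have "norm (h (snd p) - h (fst p))
          \<le> K * (norm (f (snd p) - f (fst p)) + norm (g (snd p) - g (fst p)))" .
      also have "\<dots> \<le> L * (norm (f (snd p) - f (fst p)) + norm (g (snd p) - g (fst p)))"
        using L by (intro mult_right_mono) auto
      finally show "norm (h (snd p) - h (fst p)) \<le> \<dots>" .
    qed
    also have "\<dots> = L * (variation_over f P + variation_over g P)"
      unfolding variation_over_def case_prod_beta by (simp add: sum_distrib_left sum.distrib distrib_left)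
    also have "\<dots> < L * (e / (2 * L) + e / (2 * L))"
      using P d1(2)[of P] d2(2)[of P] L by (intro mult_strict_left_mono add_strict_mono) auto
    also have "\<dots> = e" using L by (simp add: field_simps)
    finally show "variation_over h P < e" .
  qed
qed

lemma abs_continuous_on_lipschitz:
  fixes f :: "real \<Rightarrow> 'a::real_normed_vector"
  assumes "\<And>c d. a \<le> c \<Longrightarrow> c \<le> d \<Longrightarrow> d \<le> b \<Longrightarrow> norm (f d - f c) \<le> K * (d - c)"
  shows "abs_continuous_on a b f"
proof -
  have id: "abs_continuous_on a b (\<lambda>x::real. x)"
    unfolding abs_continuous_on_alt
  proof (intro allI impI exI conjI)
    fix e :: real and P assume *: "nonoverlapping a b P \<and> family_length P < e"
    have "variation_over (\<lambda>x. x) P = family_length P"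
      using * unfolding variation_over_def family_length_def nonoverlapping_def
      by (intro sum.cong) auto
    with * show "variation_over (\<lambda>x. x) P < e" by simp
  qed
  show ?thesis
  proof (rule abs_continuous_on_dominated[OF id id, where K = "K / 2"])
    fix c d assume "a \<le> c" "c \<le> d" "d \<le> b"
    with assms[of c d] show "norm (f d - f c) \<le> K / 2 * (norm (d - c) + norm (d - c))"
      by (simp add: algebra_simps)
  qed
qed

lemma abs_continuous_on_add:
  assumes "abs_continuous_on a b f" "abs_continuous_on a b g"
  shows "abs_continuous_on a b (\<lambda>x. f x + g x)"
proof (rule abs_continuous_on_dominated[OF assms, where K = 1])
  fix c d
  show "norm (f d + g d - (f c + g c)) \<le> 1 * (norm (f d - f c) + norm (g d - g c))"
    using norm_triangle_ineq[of "f d - f c" "g d - g c"] by (simp add: algebra_simps)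
qed

lemma abs_continuous_on_diff:
  assumes "abs_continuous_on a b f" "abs_continuous_on a b g"
  shows "abs_continuous_on a b (\<lambda>x. f x - g x)"
proof (rule abs_continuous_on_dominated[OF assms, where K = 1])
  fix c d
  show "norm (f d - g d - (f c - g c)) \<le> 1 * (norm (f d - f c) + norm (g d - g c))"
    using norm_triangle_ineq4[of "f d - f c" "g d - g c"] by (simp add: algebra_simps)
qed

lemma abs_continuous_on_linear:
  assumes "bounded_linear h" "abs_continuous_on a b f"
  shows "abs_continuous_on a b (\<lambda>x. h (f x))"
proof -
  interpret bounded_linear h by fact
  obtain K where K: "\<And>x. norm (h x) \<le> norm x * K" using bounded by blast
  show ?thesis
  proof (rule abs_continuous_on_dominated[OF assms(2,2), where K = "K / 2"])
    fix c d
    show "norm (h (f d) - h (f c)) \<le> K / 2 * (norm (f d - f c) + norm (f d - f c))"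
      using K[of "f d - f c"] by (simp add: diff mult.commute)
  qed
qed

lemma abs_continuous_on_bilinear:
  fixes f :: "real \<Rightarrow> 'a::real_normed_vector" and g :: "real \<Rightarrow> 'b::real_normed_vector"
    and bil :: "'a \<Rightarrow> 'b \<Rightarrow> 'c::real_normed_vector"
  assumes h: "bounded_bilinear bil" and f: "abs_continuous_on a b f" and g: "abs_continuous_on a b g"
  shows "abs_continuous_on a b (\<lambda>x. bil (f x) (g x))"
proof -
  interpret bounded_bilinear bil by fact
  obtain K where K: "K > 0" "\<And>x y. norm (bil x y) \<le> norm x * norm y * K" using pos_bounded by blast
  have "bounded (f ` {a..b})" "bounded (g ` {a..b})"
    using f g by (auto intro!: compact_imp_bounded compact_continuous_image abs_continuous_on_imp_continuous_on)
  then obtain A B where A: "\<And>x. x \<in> {a..b} \<Longrightarrow> norm (f x) \<le> A" and B: "\<And>x. x \<in> {a..b} \<Longrightarrow> norm (g x) \<le> B"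
    unfolding bounded_iff by blast
  define M where "M = max A B"
  show ?thesis
  proof (rule abs_continuous_on_dominated[OF f g, where K = "K * M"])
    fix c d assume cd: "a \<le> c" "c \<le> d" "d \<le> b"
    have M: "norm (f d) \<le> M" "norm (g c) \<le> M" using A[of d] B[of c] cd by (auto simp: M_def)
    have "bil (f d) (g d) - bil (f c) (g c) = bil (f d) (g d - g c) + bil (f d - f c) (g c)"
      by (simp add: diff_left diff_right)
    also have "norm \<dots> \<le> norm (f d) * norm (g d - g c) * K + norm (f d - f c) * norm (g c) * K"
      by (rule norm_triangle_le) (intro add_mono K)
    also have "\<dots> \<le> M * norm (g d - g c) * K + norm (f d - f c) * M * K"
      using M K by (intro add_mono mult_right_mono mult_left_mono) auto
    finally show "norm (bil (f d) (g d) - bil (f c) (g c)) \<le> K * M * (norm (f d - f c) + norm (g d - g c))"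
      by (simp add: algebra_simps)
  qed
qed

subsection \<open>The total variation function\<close>

lemma nonoverlapping_empty [simp]: "nonoverlapping a b {}"
  by (simp add: nonoverlapping_def)

lemma nonoverlapping_Un:
  assumes P: "nonoverlapping a c P" and R: "nonoverlapping c b R" and "a \<le> c" "c \<le> b"
  shows "nonoverlapping a b (P \<union> R)"
proof -
  have 1: "a \<le> u \<and> u \<le> v \<and> v \<le> b" if "(u, v) \<in> P \<union> R" for u v
    using that P R assms(3,4) unfolding nonoverlapping_def by force
  have 2: "disjnt {u<..<v} {u'<..<v'}" if "(u, v) \<in> P" "(u', v') \<in> R" for u v u' v'
  proof -
    have "v \<le> c" "c \<le> u'" using that P R unfolding nonoverlapping_def by auto
    then show ?thesis by (auto simp: disjnt_def)
  qed
  have "pairwise (\<lambda>(c, d) (c', d'). disjnt {c<..<d} {c'<..<d'}) (P \<union> R)"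
    unfolding pairwise_def
  proof (intro ballI impI)
    fix p q assume pq: "p \<in> P \<union> R" "q \<in> P \<union> R" "p \<noteq> q"
    obtain u v u' v' where eq: "p = (u, v)" "q = (u', v')" by (cases p, cases q)
    have A: "(u, v) \<in> P \<union> R" "(u', v') \<in> P \<union> R" and ne: "(u, v) \<noteq> (u', v')"
      using pq eq by auto
    have PP: "pairwise (\<lambda>(c, d) (c', d'). disjnt {c<..<d} {c'<..<d'}) P"
      "pairwise (\<lambda>(c, d) (c', d'). disjnt {c<..<d} {c'<..<d'}) R"
      using P R unfolding nonoverlapping_def by auto
    consider "(u, v) \<in> P" "(u', v') \<in> P" | "(u, v) \<in> R" "(u', v') \<in> R"
      | "(u, v) \<in> P" "(u', v') \<in> R" | "(u, v) \<in> R" "(u', v') \<in> P"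
      using A by blast
    then have "disjnt {u<..<v} {u'<..<v'}"
    proof cases
      case 1 show ?thesis using pairwiseD[OF PP(1) 1 ne] by simp
    next
      case 2 show ?thesis using pairwiseD[OF PP(2) 2 ne] by simp
    next
      case 3 show ?thesis by (rule 2[OF 3])
    next
      case 4 show ?thesis using 2[OF 4(2,1)] by (simp add: disjnt_sym)
    qed
    then show "(case p of (c, d) \<Rightarrow> \<lambda>(c', d'). disjnt {c<..<d} {c'<..<d'}) q"
      by (simp add: eq)
  qed
  moreover have "finite (P \<union> R)" using P R unfolding nonoverlapping_def by simp
  ultimately show ?thesis using 1 unfolding nonoverlapping_def by blast
qed

text \<open>Degenerate intervals have no variation, but they escape disjointness: several
  families may share one. So they are dropped before families are mapped or joined.\<close>

lemma nonoverlapping_nondegenerate: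
  assumes P: "nonoverlapping a b P"
  obtains R where "nonoverlapping a b R" "\<And>c d. (c, d) \<in> R \<Longrightarrow> c < d"
    "variation_over f R = variation_over f P"
proof
  let ?R = "{p \<in> P. fst p < snd p}"
  have fin: "finite P" using P by (simp add: nonoverlapping_def)
  show "nonoverlapping a b ?R"
    using P unfolding nonoverlapping_def by (auto intro: pairwise_subset)
  show "c < d" if "(c, d) \<in> ?R" for c d using that by simp
  show "variation_over f ?R = variation_over f P"
    unfolding variation_over_def
  proof (rule sum.mono_neutral_left[OF fin])
    show "\<forall>p\<in>P - ?R. (case p of (c, d) \<Rightarrow> norm (f d - f c)) = 0"
    proof
      fix p assume p: "p \<in> P - ?R"
      then have "fst p \<le> snd p" "\<not> fst p < snd p"
        using P unfolding nonoverlapping_def by (auto simp: case_prod_beta)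
      then show "(case p of (c, d) \<Rightarrow> norm (f d - f c)) = 0" by (simp add: case_prod_beta)
    qed
  qed auto
qed

text \<open>Shrinking the intervals of a family keeps them disjoint. As long as they stay nondegenerate, no
  two of them become equal, so the new family still has one member for each old one.\<close>

lemma nonoverlapping_shrink:
  assumes P: "nonoverlapping a b P" and R: "R \<subseteq> P"
    and h: "\<And>p. p \<in> R \<Longrightarrow> fst p \<le> fst (h p) \<and> fst (h p) < snd (h p) \<and> snd (h p) \<le> snd p"
    and h': "\<And>p. p \<in> R \<Longrightarrow> a' \<le> fst (h p) \<and> snd (h p) \<le> b'"
  shows "inj_on h R" and "nonoverlapping a' b' (h ` R)"
proof -
  have disj: "disjnt {fst (h p)<..<snd (h p)} {fst (h q)<..<snd (h q)}" if "p \<in> R" "q \<in> R" "p \<noteq> q" for p q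
  proof -
    have "disjnt {fst p<..<snd p} {fst q<..<snd q}"
      using that P R unfolding nonoverlapping_def pairwise_def by (auto simp: case_prod_beta)
    moreover have "{fst (h p)<..<snd (h p)} \<subseteq> {fst p<..<snd p}" "{fst (h q)<..<snd (h q)} \<subseteq> {fst q<..<snd q}"
      using h[OF that(1)] h[OF that(2)] by auto
    ultimately show ?thesis unfolding disjnt_def by blast
  qed
  show "inj_on h R"
  proof (rule inj_onI, rule ccontr)
    fix p q assume pq: "p \<in> R" "q \<in> R" "h p = h q" "p \<noteq> q"
    from disj[OF pq(1,2,4)] h[OF pq(1)] pq(3) show False by (simp add: disjnt_def)
  qed
  show "nonoverlapping a' b' (h ` R)"
    unfolding nonoverlapping_def
  proof (intro conjI)
    show "finite (h ` R)" using P R by (auto simp: nonoverlapping_def intro: finite_subset)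
    show "\<forall>(c, d)\<in>h ` R. a' \<le> c \<and> c \<le> d \<and> d \<le> b'"
    proof clarify
      fix c d p assume p: "p \<in> R" "(c, d) = h p"
      then have "c = fst (h p)" "d = snd (h p)" by (metis fst_conv, metis snd_conv)
      with h[OF p(1)] h'[OF p(1)] show "a' \<le> c \<and> c \<le> d \<and> d \<le> b'" by simp
    qed
    show "pairwise (\<lambda>(c, d) (c', d'). disjnt {c<..<d} {c'<..<d'}) (h ` R)"
      unfolding pairwise_def
    proof (intro ballI impI)
      fix x y assume "x \<in> h ` R" "y \<in> h ` R" "x \<noteq> y"
      then obtain p q where pq: "p \<in> R" "q \<in> R" "p \<noteq> q" "x = h p" "y = h q" by auto
      from disj[OF pq(1-3)] show "(case x of (c, d) \<Rightarrow> \<lambda>(c', d'). disjnt {c<..<d} {c'<..<d'}) y"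
        unfolding pq by (simp add: case_prod_beta)
    qed
  qed
qed

text \<open>Cutting the intervals of a family at \<open>c\<close> does not decrease the variation, by the
  triangle inequality.\<close>

lemma nonoverlapping_split:
  assumes P: "nonoverlapping a b P" and c: "a \<le> c" "c \<le> b"
  obtains P1 P2 where "nonoverlapping a c P1" "nonoverlapping c b P2"
    "variation_over f P \<le> variation_over f P1 + variation_over f P2"
proof -
  obtain P0 where P0: "nonoverlapping a b P0" "\<And>c d. (c, d) \<in> P0 \<Longrightarrow> c < d"
    "variation_over f P0 = variation_over f P"
    using nonoverlapping_nondegenerate[OF P] by blast
  have fin: "finite P0" and ab: "\<And>p. p \<in> P0 \<Longrightarrow> a \<le> fst p \<and> snd p \<le> b"
    using P0(1) by (auto simp: nonoverlapping_def)
  have nd: "fst p < snd p" if "p \<in> P0" for p using P0(2)[of "fst p" "snd p"] that by simp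
  let ?l = "\<lambda>p. (fst p, min (snd p) c)" and ?r = "\<lambda>p. (max (fst p) c, snd p)"
  let ?L = "{p\<in>P0. fst p < c}" and ?R = "{p\<in>P0. snd p > c}"
  have l: "inj_on ?l ?L" "nonoverlapping a c (?l ` ?L)"
    by (rule nonoverlapping_shrink[OF P0(1), where R = ?L and a' = a and b' = c]; use nd ab in auto)+
  have r: "inj_on ?r ?R" "nonoverlapping c b (?r ` ?R)"
    by (rule nonoverlapping_shrink[OF P0(1), where R = ?R and a' = c and b' = b]; use nd ab in auto)+
  have vl: "variation_over f (?l ` ?L) = (\<Sum>p\<in>P0. if fst p < c then norm (f (min (snd p) c) - f (fst p)) else 0)"
    unfolding variation_over_def using fin
    by (subst sum.reindex[OF l(1)]) (simp add: case_prod_beta sum.If_cases Int_def)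
  have vr: "variation_over f (?r ` ?R) = (\<Sum>p\<in>P0. if snd p > c then norm (f (snd p) - f (max (fst p) c)) else 0)"
    unfolding variation_over_def using fin
    by (subst sum.reindex[OF r(1)]) (simp add: case_prod_beta sum.If_cases Int_def)
  have "variation_over f P0 \<le> variation_over f (?l ` ?L) + variation_over f (?r ` ?R)"
    unfolding vl vr sum.distrib[symmetric] unfolding variation_over_def case_prod_beta
  proof (rule sum_mono)
    fix p assume "p \<in> P0"
    have "norm (f (snd p) - f (fst p)) \<le> norm (f c - f (fst p)) + norm (f (snd p) - f c)"
      using norm_triangle_ineq[of "f c - f (fst p)" "f (snd p) - f c"] by simp
    then show "norm (f (snd p) - f (fst p)) \<le> (if fst p < c then norm (f (min (snd p) c) - f (fst p)) else 0) +
          (if snd p > c then norm (f (snd p) - f (max (fst p) c)) else 0)"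
      using nd[OF \<open>p \<in> P0\<close>] by (auto simp: min_def max_def)
  qed
  with that[OF l(2) r(2)] P0(3) show thesis by simp
qed

lemma family_length_eq_measure:
  assumes P: "nonoverlapping a b P"
  shows "family_length P = measure lborel (\<Union>p\<in>P. {fst p<..<snd p})"
proof -
  let ?I = "\<lambda>p::real\<times>real. {fst p<..<snd p}"
  have fin: "finite P" and le: "\<And>p. p \<in> P \<Longrightarrow> fst p \<le> snd p"
    using P unfolding nonoverlapping_def by auto
  have dis: "disjoint_family_on ?I P"
    using P unfolding nonoverlapping_def pairwise_def disjoint_family_on_def disjnt_def
    by (simp add: case_prod_beta)
  have "family_length P = (\<Sum>p\<in>P. measure lborel (?I p))"
    unfolding family_length_def using le by (intro sum.cong) (auto simp: case_prod_beta)
  also have "\<dots> = measure lborel (\<Union>p\<in>P. ?I p)"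
    by (rule measure_finite_Union[symmetric]) (use fin dis le in auto)
  finally show ?thesis .
qed

lemma family_length_le:
  assumes P: "nonoverlapping a b P" and "a \<le> b"
  shows "family_length P \<le> b - a"
proof -
  have fin: "finite P" and le: "\<And>p. p \<in> P \<Longrightarrow> a \<le> fst p \<and> fst p \<le> snd p \<and> snd p \<le> b"
    using P unfolding nonoverlapping_def by auto
  have "measure lborel (\<Union>p\<in>P. {fst p<..<snd p}) \<le> measure lborel {a..b}"
  proof (rule measure_mono_fmeasurable)
    show "(\<Union>p\<in>P. {fst p<..<snd p}) \<subseteq> {a..b}" using le by fastforce
    show "(\<Union>p\<in>P. {fst p<..<snd p}) \<in> sets lborel" using fin by auto
    show "{a..b} \<in> fmeasurable lborel"
      using emeasure_lborel_cbox_finite[of a b] by (auto simp: fmeasurable_def)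
  qed
  then show ?thesis using \<open>a \<le> b\<close> family_length_eq_measure[OF P] by simp
qed

text \<open>The supremum means something only if the variations are bounded; this is an assumption of
  every lemma about it.\<close>

definition total_variation :: "(real \<Rightarrow> 'a::real_normed_vector) \<Rightarrow> real \<Rightarrow> real \<Rightarrow> real"
  where "total_variation f a x = Sup (variation_over f ` {P. nonoverlapping a x P})"

lemma bounded_variation_subinterval:
  assumes B: "\<And>P. nonoverlapping a b P \<Longrightarrow> variation_over f P \<le> B" and "x \<le> b"
  shows "bdd_above (variation_over f ` {P. nonoverlapping a x P})"
  using B nonoverlapping_mono[of a x _ a b] \<open>x \<le> b\<close> by (intro bdd_aboveI2[where M = B]) auto

lemma variation_over_le_total_variation:
  assumes "\<And>P. nonoverlapping a b P \<Longrightarrow> variation_over f P \<le> B" "x \<le> b" "nonoverlapping a x P"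
  shows "variation_over f P \<le> total_variation f a x"
  unfolding total_variation_def
  using assms by (intro cSUP_upper bounded_variation_subinterval) auto

lemma total_variation_increment_ge:
  assumes B: "\<And>P. nonoverlapping a b P \<Longrightarrow> variation_over f P \<le> B" and xy: "a \<le> x" "x \<le> y" "y \<le> b"
  shows "norm (f y - f x) \<le> total_variation f a y - total_variation f a x"
proof -
  have "total_variation f a x \<le> total_variation f a y - norm (f y - f x)"
    unfolding total_variation_def[of f a x]
  proof (rule cSUP_least)
    show "{P. nonoverlapping a x P} \<noteq> {}" using nonoverlapping_empty by blast
    fix P assume "P \<in> {P. nonoverlapping a x P}"
    then have P: "nonoverlapping a x P" by simp
    show "variation_over f P \<le> total_variation f a y - norm (f y - f x)"
    proof (cases "x = y")
      case True
      then show ?thesis using variation_over_le_total_variation[OF B _ P] xy by simp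
    next
      case False
      have "nonoverlapping a y (P \<union> {(x, y)})"
        by (rule nonoverlapping_Un[OF P nonoverlapping_single]) (use xy in auto)
      then have "variation_over f (P \<union> {(x, y)}) \<le> total_variation f a y"
        using variation_over_le_total_variation[OF B] xy by blast
      moreover have "(x, y) \<notin> P" using P False xy unfolding nonoverlapping_def by force
      ultimately show ?thesis
        using P unfolding nonoverlapping_def variation_over_def by simp
    qed
  qed
  then show ?thesis by simp
qed

text \<open>Cut a family that almost realises the variation up to \<open>y\<close> at the point \<open>x\<close>: the
  part to the left of \<open>x\<close> is accounted for by the variation up to \<open>x\<close>.\<close>

lemma total_variation_increment_approx:
  assumes B: "\<And>P. nonoverlapping a b P \<Longrightarrow> variation_over f P \<le> B" and xy: "a \<le> x" "x \<le> y" "y \<le> b"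
    and "e > 0"
  obtains R where "nonoverlapping x y R" "total_variation f a y - total_variation f a x < variation_over f R + e"
proof -
  have "{P. nonoverlapping a y P} \<noteq> {}" using nonoverlapping_empty by blast
  then obtain P where P: "nonoverlapping a y P" "total_variation f a y - e < variation_over f P"
    using less_cSupD[of "variation_over f ` {P. nonoverlapping a y P}" "total_variation f a y - e"] \<open>e > 0\<close>
    unfolding total_variation_def by auto
  obtain P1 P2 where P12: "nonoverlapping a x P1" "nonoverlapping x y P2"
    "variation_over f P \<le> variation_over f P1 + variation_over f P2"
    using nonoverlapping_split[OF P(1) xy(1,2)] by blast
  have "variation_over f P1 \<le> total_variation f a x"
    using variation_over_le_total_variation[OF B _ P12(1)] xy by simp
  with P P12 have "total_variation f a y - total_variation f a x < variation_over f P2 + e" by simp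
  with P12 that show thesis by blast
qed

text \<open>Given a short family, choose inside each of its intervals a family that almost realises the
  increment of the total variation there. The union of the chosen families is at most as long as the
  given one, so the variation of \<open>f\<close> over it is small.\<close>

lemma abs_continuous_on_total_variation:
  fixes f :: "real \<Rightarrow> 'a::real_normed_vector"
  assumes f: "abs_continuous_on a b f"
    and B: "\<And>P. nonoverlapping a b P \<Longrightarrow> variation_over f P \<le> B"
  shows "abs_continuous_on a b (total_variation f a)"
  unfolding abs_continuous_on_alt
proof (intro allI impI)
  fix e :: real assume "e > 0"
  then have e2: "e / 2 > 0" by simp
  obtain \<delta> where \<delta>: "\<delta> > 0"
    "\<And>P. nonoverlapping a b P \<Longrightarrow> family_length P < \<delta> \<Longrightarrow> variation_over f P < e / 2"
    using abs_continuous_onE[OF f e2] by blast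
  let ?V = "total_variation f a"
  show "\<exists>d>0. \<forall>P. nonoverlapping a b P \<and> family_length P < d \<longrightarrow> variation_over ?V P < e"
  proof (intro exI[of _ \<delta>] conjI allI impI \<delta>(1))
    fix P assume P: "nonoverlapping a b P \<and> family_length P < \<delta>"
    \<comment> \<open>The tolerance for one interval; over all intervals it adds up to at most \<open>e / 2\<close>.\<close>
    define \<eta> where "\<eta> = e / (2 * (real (card P) + 1))"
    have \<eta>: "\<eta> > 0" using \<open>e > 0\<close> by (simp add: \<eta>_def)
    have fin: "finite P" and le: "\<And>p. p \<in> P \<Longrightarrow> a \<le> fst p \<and> fst p \<le> snd p \<and> snd p \<le> b"
      using P unfolding nonoverlapping_def by auto
    have "\<exists>R. nonoverlapping (fst p) (snd p) R \<and> (\<forall>(c, d)\<in>R. c < d)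
        \<and> ?V (snd p) - ?V (fst p) < variation_over f R + \<eta>" if p: "p \<in> P" for p
    proof -
      have l: "a \<le> fst p" "fst p \<le> snd p" "snd p \<le> b" using le[OF p] by auto
      obtain R where R: "nonoverlapping (fst p) (snd p) R" "?V (snd p) - ?V (fst p) < variation_over f R + \<eta>"
        using total_variation_increment_approx[OF B l \<eta>] by blast
      obtain R' where "nonoverlapping (fst p) (snd p) R'" "\<And>c d. (c, d) \<in> R' \<Longrightarrow> c < d"
        "variation_over f R' = variation_over f R"
        using nonoverlapping_nondegenerate[OF R(1)] by blast
      with R show ?thesis by (metis (no_types, lifting) case_prodI2)
    qed
    then obtain R where R: "\<And>p. p \<in> P \<Longrightarrow> nonoverlapping (fst p) (snd p) (R p)"
      "\<And>p c d. p \<in> P \<Longrightarrow> (c, d) \<in> R p \<Longrightarrow> c < d"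
      "\<And>p. p \<in> P \<Longrightarrow> ?V (snd p) - ?V (fst p) < variation_over f (R p) + \<eta>"
      by (metis (no_types, lifting) case_prodD)
    have Rin: "fst p \<le> c" "c < d" "d \<le> snd p" if "p \<in> P" "(c, d) \<in> R p" for p c d
      using R(1)[OF that(1)] R(2)[OF that] that(2) unfolding nonoverlapping_def by auto
    have Pdis: "{fst p<..<snd p} \<inter> {fst q<..<snd q} = {}" if "p \<in> P" "q \<in> P" "p \<noteq> q" for p q
      using that P unfolding nonoverlapping_def pairwise_def disjnt_def by (simp add: case_prod_beta)
    have Rdis: "R p \<inter> R q = {}" if pq: "p \<in> P" "q \<in> P" "p \<noteq> q" for p q
    proof (rule ccontr)
      assume "R p \<inter> R q \<noteq> {}"
      then obtain c d where "(c, d) \<in> R p" "(c, d) \<in> R q" by auto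
      from Rin[OF pq(1) this(1)] Rin[OF pq(2) this(2)]
      have "(c + d) / 2 \<in> {fst p<..<snd p} \<inter> {fst q<..<snd q}" by auto
      with Pdis[OF pq] show False by auto
    qed
    define T where "T = (\<Union>p\<in>P. R p)"
    have finR: "finite (R p)" if "p \<in> P" for p using R(1)[OF that] by (simp add: nonoverlapping_def)
    have T: "nonoverlapping a b T"
      unfolding nonoverlapping_def
    proof (intro conjI)
      show "finite T" using fin finR by (simp add: T_def)
      show "\<forall>(c, d)\<in>T. a \<le> c \<and> c \<le> d \<and> d \<le> b"
      proof clarify
        fix c d assume "(c, d) \<in> T"
        then obtain p where p: "p \<in> P" "(c, d) \<in> R p" unfolding T_def by blast
        from Rin[OF p] le[OF p(1)] show "a \<le> c \<and> c \<le> d \<and> d \<le> b" by linarith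
      qed
      show "pairwise (\<lambda>(c, d) (c', d'). disjnt {c<..<d} {c'<..<d'}) T"
        unfolding pairwise_def
      proof (intro ballI impI)
        fix x y assume xy: "x \<in> T" "y \<in> T" "x \<noteq> y"
        obtain c d c' d' where eq: "x = (c, d)" "y = (c', d')" by (cases x, cases y)
        obtain p q where pq: "p \<in> P" "(c, d) \<in> R p" "q \<in> P" "(c', d') \<in> R q"
          using xy unfolding T_def eq by blast
        have "disjnt {c<..<d} {c'<..<d'}"
        proof (cases "p = q")
          case True
          have "pairwise (\<lambda>(c, d) (c', d'). disjnt {c<..<d} {c'<..<d'}) (R p)"
            using R(1)[OF pq(1)] by (simp add: nonoverlapping_def)
          from pairwiseD[OF this pq(2), of "(c', d')"] show ?thesis using pq True xy eq by simp
        next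
          case False
          have "{c<..<d} \<subseteq> {fst p<..<snd p}" "{c'<..<d'} \<subseteq> {fst q<..<snd q}"
            using Rin[OF pq(1,2)] Rin[OF pq(3,4)] by auto
          then show ?thesis
            using Pdis[OF pq(1,3) False] unfolding disjnt_def by blast
        qed
        then show "(case x of (c, d) \<Rightarrow> \<lambda>(c', d'). disjnt {c<..<d} {c'<..<d'}) y" by (simp add: eq)
      qed
    qed
    have "family_length T = (\<Sum>p\<in>P. family_length (R p))"
      unfolding T_def family_length_def by (rule sum.UNION_disjoint) (use fin finR Rdis in auto)
    also have "\<dots> \<le> family_length P"
      unfolding family_length_def[of P] case_prod_beta
      using R(1) le by (intro sum_mono family_length_le) auto
    finally have vT: "variation_over f T < e / 2" using \<delta>(2)[OF T] P by simp
    have "variation_over ?V P = (\<Sum>p\<in>P. ?V (snd p) - ?V (fst p))"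
      unfolding variation_over_def case_prod_beta
    proof (rule sum.cong[OF refl])
      fix p assume "p \<in> P"
      from total_variation_increment_ge[OF B, of a b "fst p" "snd p"] le[OF this]
      have "0 \<le> ?V (snd p) - ?V (fst p)" by (meson norm_ge_zero order_trans)
      then show "norm (?V (snd p) - ?V (fst p)) = ?V (snd p) - ?V (fst p)" by simp
    qed
    also have "\<dots> \<le> (\<Sum>p\<in>P. variation_over f (R p) + \<eta>)"
      using R(3) by (intro sum_mono less_imp_le)
    also have "\<dots> = variation_over f T + card P * \<eta>"
      unfolding T_def variation_over_def sum.distrib
      by (subst sum.UNION_disjoint) (use fin finR Rdis in auto)
    also have "card P * \<eta> \<le> e / 2" using \<open>e > 0\<close> by (simp add: \<eta>_def field_simps)
    finally show "variation_over ?V P < e" using vT by simp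
  qed
qed

subsection \<open>Absolutely continuous functions are indefinite integrals\<close>

definition indefinite_integral_on :: "(real \<Rightarrow> 'a::euclidean_space) \<Rightarrow> (real \<Rightarrow> 'a) \<Rightarrow> real \<Rightarrow> real \<Rightarrow> bool"
  where "indefinite_integral_on f g a b \<longleftrightarrow> g absolutely_integrable_on {a..b} \<and>
    (\<forall>x\<in>{a..b}. f x = f a + integral {a..x} g)"

lemma indefinite_integral_onD:
  assumes "indefinite_integral_on f g a b"
  shows "g absolutely_integrable_on {a..b}"
    and "x \<in> {a..b} \<Longrightarrow> f x = f a + integral {a..x} g"
    and "x \<in> {a..b} \<Longrightarrow> g integrable_on {a..x}"
proof -
  show "g absolutely_integrable_on {a..b}" "x \<in> {a..b} \<Longrightarrow> f x = f a + integral {a..x} g"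
    using assms unfolding indefinite_integral_on_def by blast+
  then show "x \<in> {a..b} \<Longrightarrow> g integrable_on {a..x}"
    unfolding absolutely_integrable_on_def by (auto intro: integrable_on_subinterval)
qed

text \<open>The Stieltjes measure of \<open>F\<close> vanishes on Lebesgue null sets. Indeed such a set lies in an open
  set of small Lebesgue measure; absolute continuity bounds the Stieltjes measure of every finite
  union of intervals in the open set, hence of the open set itself. By the Radon-Nikodym theorem the
  Stieltjes measure then has a density, which is the integrand.\<close>

lemma mono_abs_continuous_indefinite_integral:
  fixes F :: "real \<Rightarrow> real"
  assumes ab: "a \<le> b" and F: "abs_continuous_on a b F"
    and mono: "\<And>x y. a \<le> x \<Longrightarrow> x \<le> y \<Longrightarrow> y \<le> b \<Longrightarrow> F x \<le> F y"
  shows "\<exists>g. indefinite_integral_on F g a b"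
proof -
  \<comment> \<open>Continued by constants, \<open>F\<close> defines a measure on the line that does not charge the outside of
    the interval.\<close>
  define G where "G x = F (max a (min b x))" for x
  have GF: "G x = F x" if "x \<in> {a..b}" for x using that by (simp add: G_def)
  have monoG: "G x \<le> G y" if "x \<le> y" for x y
    unfolding G_def by (rule mono) (use that ab in auto)
  have contG: "continuous_on UNIV G"
    unfolding G_def
    by (rule continuous_on_compose2[OF abs_continuous_on_imp_continuous_on[OF F]])
      (use ab in \<open>auto intro!: continuous_intros\<close>)
  define \<mu> where "\<mu> = interval_measure G"
  have sets_\<mu>: "sets \<mu> = sets borel" by (simp add: \<mu>_def)
  have Icc: "emeasure \<mu> {c..d} = ennreal (G d - G c)" if "c \<le> d" for c d
    unfolding \<mu>_def by (rule emeasure_interval_measure_Icc[OF that monoG contG])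
  have small: "emeasure \<mu> (N \<inter> {a<..<b}) \<le> ennreal e" if N: "N \<in> null_sets lborel" and e: "e > 0" for N e
  proof -
    obtain \<delta> where \<delta>: "\<delta> > 0"
      "\<And>P. nonoverlapping a b P \<Longrightarrow> family_length P < \<delta> \<Longrightarrow> variation_over F P < e"
      using abs_continuous_onE[OF F e] by blast
    define N' where "N' = N \<inter> {a<..<b}"
    have N': "N' \<in> null_sets lborel" unfolding N'_def using N by (intro null_set_Int2) auto
    then have N'L: "N' \<in> null_sets lebesgue" by (simp add: null_sets_completionI)
    then have "N' \<in> sets lebesgue" by auto
    then obtain T where T: "open T" "N' \<subseteq> T" "emeasure lebesgue (T - N') < ennreal \<delta>"
      using sets_lebesgue_outer_open[of N' \<delta>] \<delta>(1) by metis
    define U where "U = T \<inter> {a<..<b}"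
    have U: "open U" "N' \<subseteq> U" "U \<subseteq> {a<..<b}" using T by (auto simp: U_def N'_def)
    have "emeasure lebesgue T = emeasure lebesgue (T - N')"
      using emeasure_Diff_null_set[OF N'L, of T] T(1) by simp
    moreover have "emeasure lebesgue U \<le> emeasure lebesgue T"
      using T by (intro emeasure_mono) (auto simp: U_def)
    ultimately have "emeasure lborel U < ennreal \<delta>" using T U by simp
    moreover from this have mU2: "emeasure lborel U < \<infinity>"
      by (rule order.strict_trans) simp
    ultimately have mU: "measure lborel U < \<delta>" "emeasure lborel U < \<infinity>"
      using \<delta>(1) by (auto simp: emeasure_eq_ennreal_measure top.not_eq_extremum ennreal_less_iff)
    obtain D where D: "countable D" "\<And>X. X \<in> D \<Longrightarrow> \<exists>c d. X = cbox c d" "\<Union>D = U"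
      using open_countable_Union_open_cbox[OF U(1)] by metis
    have fin: "emeasure \<mu> (\<Union>\<F>) \<le> ennreal e" if \<F>: "finite \<F>" "\<F> \<subseteq> D" for \<F>
    proof -
      obtain p where p: "p division_of (\<Union>\<F>)"
        using elementary_unions_intervals[OF \<F>(1)] D(2) \<F>(2) by (metis subsetD)
      note pD = division_ofD[OF p]
      have kk: "k = {Inf k..Sup k} \<and> Inf k \<le> Sup k" if "k \<in> p" for k
      proof -
        obtain c d where cd: "k = cbox c d" using pD(4)[OF \<open>k \<in> p\<close>] by blast
        with pD(3)[OF \<open>k \<in> p\<close>] have "c \<le> d" by auto
        then show ?thesis using cd by simp
      qed
      have kle: "Inf k \<le> Sup k" if "k \<in> p" for k using kk[OF that] by blast
      have kU: "k \<subseteq> U" if "k \<in> p" for k using pD(2)[OF that] \<F> D(3) by blast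
      have kab: "Inf k \<in> {a<..<b}" "Sup k \<in> {a<..<b}" if "k \<in> p" for k
        using kU[OF that] U(3) kk[OF that] by (metis atLeastAtMost_iff order_refl subsetD)+
      define h where "h = (\<lambda>k::real set. (Inf k, Sup k))"
      have inj: "inj_on h p" unfolding h_def inj_on_def using kk by (metis prod.inject)
      have P: "nonoverlapping a b (h ` p)"
        unfolding nonoverlapping_def
      proof (intro conjI)
        show "finite (h ` p)" using pD(1) by simp
        show "\<forall>(c, d)\<in>h ` p. a \<le> c \<and> c \<le> d \<and> d \<le> b"
          using kle kab by (auto simp: h_def less_imp_le)
        show "pairwise (\<lambda>(c, d) (c', d'). disjnt {c<..<d} {c'<..<d'}) (h ` p)"
          unfolding pairwise_def
        proof (intro ballI impI)
          fix x y assume "x \<in> h ` p" "y \<in> h ` p" "x \<noteq> y"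
          then obtain k l where kl: "k \<in> p" "l \<in> p" "k \<noteq> l" "x = h k" "y = h l" by auto
          have "interior k \<inter> interior l = {}" by (rule pD(5)[OF kl(1-3)])
          moreover have "interior k = {Inf k<..<Sup k}" "interior l = {Inf l<..<Sup l}"
            using kk[OF kl(1)] kk[OF kl(2)] by (metis interior_atLeastAtMost_real)+
          ultimately show "(case x of (c, d) \<Rightarrow> \<lambda>(c', d'). disjnt {c<..<d} {c'<..<d'}) y"
            by (simp add: kl(4,5) h_def disjnt_def)
        qed
      qed
      have "family_length (h ` p) = measure lborel (\<Union>q\<in>h ` p. {fst q<..<snd q})"
        by (rule family_length_eq_measure[OF P])
      also have "\<dots> \<le> measure lborel U"
      proof (rule measure_mono_fmeasurable)
        have "{Inf k<..<Sup k} \<subseteq> U" if "k \<in> p" for k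
          using kU[OF that] kk[OF that] by (metis greaterThanLessThan_subseteq_atLeastAtMost_iff order_refl order_trans)
        then show "(\<Union>q\<in>h ` p. {fst q<..<snd q}) \<subseteq> U" by (auto simp: h_def)
        show "(\<Union>q\<in>h ` p. {fst q<..<snd q}) \<in> sets lborel" using pD(1) by auto
        show "U \<in> fmeasurable lborel" using U(1) mU(2) by (auto simp: fmeasurable_def)
      qed
      finally have vP: "variation_over F (h ` p) < e" using \<delta>(2)[OF P] mU(1) by simp
      have "emeasure \<mu> (\<Union>\<F>) = emeasure \<mu> (\<Union>k\<in>p. {Inf k..Sup k})"
      proof -
        have "\<Union>\<F> = (\<Union>k\<in>p. k)" using pD(6) by simp
        also have "\<dots> = (\<Union>k\<in>p. {Inf k..Sup k})" by (rule SUP_cong[OF refl conjunct1[OF kk]])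
        finally show ?thesis by simp
      qed
      also have "\<dots> \<le> (\<Sum>k\<in>p. emeasure \<mu> {Inf k..Sup k})"
        using pD(1) by (intro emeasure_subadditive_finite) (auto simp: sets_\<mu>)
      also have "\<dots> = (\<Sum>k\<in>p. ennreal (norm (F (Sup k) - F (Inf k))))"
      proof (rule sum.cong[OF refl])
        fix k assume k: "k \<in> p"
        have "F (Inf k) \<le> F (Sup k)" using mono kab[OF k] kle[OF k] by auto
        then show "emeasure \<mu> {Inf k..Sup k} = ennreal (norm (F (Sup k) - F (Inf k)))"
          using Icc kle[OF k] GF kab[OF k] by auto
      qed
      also have "\<dots> = ennreal (\<Sum>k\<in>p. norm (F (Sup k) - F (Inf k)))" by simp
      also have "(\<Sum>k\<in>p. norm (F (Sup k) - F (Inf k))) = variation_over F (h ` p)"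
        unfolding variation_over_def by (subst sum.reindex[OF inj]) (simp add: h_def)
      also have "ennreal \<dots> \<le> ennreal e" using vP by (intro ennreal_leI) simp
      finally show ?thesis .
    qed
    have "emeasure \<mu> U \<le> ennreal e"
    proof (cases "D = {}")
      case True
      then show ?thesis using D(3) by auto
    next
      case False
      define K where "K n = \<Union>(from_nat_into D ` {..<n})" for n :: nat
      have inD: "from_nat_into D i \<in> D" for i using False by (rule from_nat_into)
      have KU: "(\<Union>n. K n) = U"
      proof
        show "(\<Union>n. K n) \<subseteq> U" using inD D(3) by (auto simp: K_def)
        show "U \<subseteq> (\<Union>n. K n)"
        proof
          fix x assume "x \<in> U"
          then obtain X where X: "X \<in> D" "x \<in> X" using D(3) by blast
          then obtain i where "from_nat_into D i = X" using from_nat_into_surj[OF D(1)] by blast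
          then have "x \<in> K (Suc i)" using X by (auto simp: K_def)
          then show "x \<in> (\<Union>n. K n)" by blast
        qed
      qed
      have "from_nat_into D i \<in> sets \<mu>" for i
      proof -
        obtain c d where "from_nat_into D i = cbox c d" using D(2)[OF inD] by blast
        then show ?thesis by (simp add: sets_\<mu>)
      qed
      then have "K n \<in> sets \<mu>" for n unfolding K_def by auto
      moreover have "incseq K" unfolding incseq_def K_def by (intro allI impI Union_mono image_mono) auto
      ultimately have "(SUP n. emeasure \<mu> (K n)) = emeasure \<mu> U"
        using SUP_emeasure_incseq[of K \<mu>] KU by (auto simp: image_subset_iff)
      moreover have "(SUP n. emeasure \<mu> (K n)) \<le> ennreal e"
        unfolding K_def using inD by (intro SUP_least fin) auto
      ultimately show ?thesis by simp
    qed
    moreover have "emeasure \<mu> N' \<le> emeasure \<mu> U"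
      using U by (intro emeasure_mono) (auto simp: sets_\<mu>)
    ultimately show ?thesis by (simp add: N'_def)
  qed
  have out: "emeasure \<mu> {..a} = 0" "emeasure \<mu> {b..} = 0"
  proof -
    have "{a - real n..a} \<in> null_sets \<mu>" for n
      by (rule null_setsI) (auto simp: Icc sets_\<mu> G_def)
    then have "(\<Union>n. {a - real n..a}) \<in> null_sets \<mu>" by blast
    moreover have "{..a} \<subseteq> (\<Union>n. {a - real n..a})"
    proof
      fix x assume "x \<in> {..a}"
      moreover obtain n where "a - x \<le> real n" using real_arch_simple by blast
      ultimately have "x \<in> {a - real n..a}" by simp
      then show "x \<in> (\<Union>n. {a - real n..a})" by blast
    qed
    ultimately have "{..a} \<in> null_sets \<mu>" by (auto intro: null_sets_subset simp: sets_\<mu>)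
    then show "emeasure \<mu> {..a} = 0" by (rule null_setsD1)
    have "{b..b + real n} \<in> null_sets \<mu>" for n
      by (rule null_setsI) (auto simp: Icc sets_\<mu> G_def)
    then have "(\<Union>n. {b..b + real n}) \<in> null_sets \<mu>" by blast
    moreover have "{b..} \<subseteq> (\<Union>n. {b..b + real n})"
    proof
      fix x assume "x \<in> {b..}"
      moreover obtain n where "x - b \<le> real n" using real_arch_simple by blast
      ultimately have "x \<in> {b..b + real n}" by simp
      then show "x \<in> (\<Union>n. {b..b + real n})" by blast
    qed
    ultimately have "{b..} \<in> null_sets \<mu>" by (auto intro: null_sets_subset simp: sets_\<mu>)
    then show "emeasure \<mu> {b..} = 0" by (rule null_setsD1)
  qed
  have "absolutely_continuous lborel \<mu>"
    unfolding absolutely_continuous_def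
  proof
    fix N assume N: "N \<in> null_sets (lborel :: real measure)"
    then have Ns: "N \<in> sets borel" by auto
    have "emeasure \<mu> (N \<inter> {a<..<b}) = 0"
    proof -
      have "emeasure \<mu> (N \<inter> {a<..<b}) \<le> 0"
        by (rule ennreal_le_epsilon) (use small[OF N] in simp)
      then show ?thesis by simp
    qed
    moreover have "emeasure \<mu> N \<le> emeasure \<mu> ((N \<inter> {a<..<b}) \<union> ({..a} \<union> {b..}))"
      using Ns by (intro emeasure_mono) (auto simp: sets_\<mu>)
    moreover have "\<dots> \<le> emeasure \<mu> (N \<inter> {a<..<b}) + emeasure \<mu> ({..a} \<union> {b..})"
      using Ns by (intro emeasure_subadditive) (auto simp: sets_\<mu>)
    moreover have "emeasure \<mu> ({..a} \<union> {b..}) \<le> emeasure \<mu> {..a} + emeasure \<mu> {b..}"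
      by (intro emeasure_subadditive) (auto simp: sets_\<mu>)
    ultimately have "emeasure \<mu> N = 0" using out by simp
    then show "N \<in> null_sets \<mu>" using Ns by (intro null_setsI) (auto simp: sets_\<mu>)
  qed
  then obtain h where h: "h \<in> borel_measurable lborel" "density lborel h = \<mu>"
    using sigma_finite_measure.Radon_Nikodym[OF sigma_finite_lborel, of \<mu>] by (auto simp: sets_\<mu>)
  have hx: "(\<integral>\<^sup>+t. h t * indicator {a..x} t \<partial>lborel) = ennreal (F x - F a)" if "x \<in> {a..b}" for x
    using emeasure_density[OF h(1), of "{a..x}"] Icc[of a x] that GF ab by (simp add: h(2))
  define g where "g t = enn2real (h t)" for t
  have gm [measurable]: "g \<in> borel_measurable borel" unfolding g_def using h(1) by measurable
  have "AE t in lborel. h t * indicator {a..b} t \<noteq> \<infinity>"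
    by (rule nn_integral_PInf_AE) (use h(1) hx[of b] ab in auto)
  then have AEg: "AE t in lborel. \<forall>x\<in>{a..b}. ennreal (indicator {a..x} t *\<^sub>R g t) = h t * indicator {a..x} t"
  proof eventually_elim
    case (elim t)
    then have "t \<in> {a..b} \<Longrightarrow> h t \<noteq> \<infinity>" by auto
    then show ?case by (auto simp: g_def indicator_def top.not_eq_extremum)
  qed
  have g: "has_bochner_integral lborel (\<lambda>t. indicator {a..x} t *\<^sub>R g t) (F x - F a)" if x: "x \<in> {a..b}" for x
  proof (rule has_bochner_integral_nn_integral)
    show "0 \<le> F x - F a" using mono[of a x] x by simp
    have "(\<integral>\<^sup>+t. ennreal (indicator {a..x} t *\<^sub>R g t) \<partial>lborel) = (\<integral>\<^sup>+t. h t * indicator {a..x} t \<partial>lborel)"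
      using AEg by (intro nn_integral_cong_AE) (use x in auto)
    then show "(\<integral>\<^sup>+t. ennreal (indicator {a..x} t *\<^sub>R g t) \<partial>lborel) = ennreal (F x - F a)"
      using hx[OF x] by simp
    show "(\<lambda>t. indicator {a..x} t *\<^sub>R g t) \<in> borel_measurable lborel" by measurable
    show "AE t in lborel. 0 \<le> indicator {a..x} t *\<^sub>R g t" by (simp add: g_def)
  qed
  have gi: "g integrable_on {a..x}" "integral {a..x} g = F x - F a" if x: "x \<in> {a..b}" for x
  proof -
    have si: "set_integrable lborel {a..x} g"
      using g[OF x] by (auto simp: set_integrable_def has_bochner_integral_iff)
    show "g integrable_on {a..x}" by (rule set_borel_integral_eq_integral(1)[OF si])
    have "integral {a..x} g = (LINT t:{a..x}|lborel. g t)"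
      by (rule set_borel_integral_eq_integral(2)[OF si, symmetric])
    also have "\<dots> = F x - F a"
      using g[OF x] by (auto simp: set_lebesgue_integral_def has_bochner_integral_iff)
    finally show "integral {a..x} g = F x - F a" .
  qed
  have "g absolutely_integrable_on {a..b}"
    by (rule nonnegative_absolutely_integrable_1) (use gi(1)[of b] ab in \<open>auto simp: g_def\<close>)
  with gi show ?thesis unfolding indefinite_integral_on_def by (intro exI[of _ g]) auto
qed

lemma indefinite_integral_on_combine:
  fixes f :: "real \<Rightarrow> 'a::euclidean_space"
  assumes 1: "indefinite_integral_on f g1 a c" and 2: "indefinite_integral_on f g2 c b"
    and "a \<le> c" "c \<le> b"
  shows "\<exists>g. indefinite_integral_on f g a b"
proof -
  define g where "g x = (if x \<le> c then g1 x else g2 x)" for x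
  have g1: "g absolutely_integrable_on {a..c}"
  proof (rule absolutely_integrable_spike[OF _ negligible_empty])
    show "g1 absolutely_integrable_on {a..c}" by (rule indefinite_integral_onD(1)[OF 1])
  qed (auto simp: g_def)
  have g2: "g absolutely_integrable_on {c..b}"
  proof (rule absolutely_integrable_spike[OF _ negligible_sing[of c]])
    show "g2 absolutely_integrable_on {c..b}" by (rule indefinite_integral_onD(1)[OF 2])
  qed (auto simp: g_def)
  have "{a..b} = {a..c} \<union> {c..b}" using assms by auto
  then have gab: "g absolutely_integrable_on {a..b}"
    using set_integrable_Un[OF g1 g2] by simp
  have l: "f x = f a + integral {a..x} g" if "x \<in> {a..c}" for x
  proof -
    have "integral {a..x} g = integral {a..x} g1"
      using that by (intro integral_cong) (auto simp: g_def)
    then show ?thesis using indefinite_integral_onD(2)[OF 1 that] by simp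
  qed
  have r: "f x = f a + integral {a..x} g" if x: "x \<in> {c..b}" for x
  proof -
    have "integral {c..x} g = integral {c..x} g2"
      by (rule integral_spike[of "{c}"]) (auto simp: g_def)
    moreover have "f x = f c + integral {c..x} g2" by (rule indefinite_integral_onD(2)[OF 2 x])
    moreover have "f c = f a + integral {a..c} g" by (rule l) (use assms in auto)
    moreover have "integral {a..c} g + integral {c..x} g = integral {a..x} g"
    proof (rule Henstock_Kurzweil_Integration.integral_combine)
      have "g integrable_on {a..b}" using gab by (simp add: absolutely_integrable_on_def)
      then show "g integrable_on {a..x}" by (rule integrable_on_subinterval) (use x in auto)
    qed (use x assms in auto)
    ultimately show ?thesis by (metis add.assoc)
  qed
  have "f x = f a + integral {a..x} g" if "x \<in> {a..b}" for x
  proof (cases "x \<le> c")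
    case True
    then show ?thesis using that by (intro l) auto
  next
    case False
    then show ?thesis using that by (intro r) auto
  qed
  with gab show ?thesis unfolding indefinite_integral_on_def by blast
qed

text \<open>An absolutely continuous function has bounded variation on short intervals by definition, so
  the decomposition into monotone parts is only ever applied on short intervals, whose number is
  finite.\<close>

lemma abs_continuous_indefinite_integral_real:
  fixes f :: "real \<Rightarrow> real"
  assumes ab: "a \<le> b" and f: "abs_continuous_on a b f"
  shows "\<exists>g. indefinite_integral_on f g a b"
proof -
  obtain \<delta> where \<delta>: "\<delta> > 0"
    "\<And>P. nonoverlapping a b P \<Longrightarrow> family_length P < \<delta> \<Longrightarrow> variation_over f P < 1"
    using abs_continuous_onE[OF f, of 1] by auto
  have short: "\<exists>g. indefinite_integral_on f g c d" if cd: "a \<le> c" "c \<le> d" "d \<le> b" "d - c < \<delta>" for c d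
  proof -
    have ac: "abs_continuous_on c d f" by (rule abs_continuous_on_subset[OF f cd(1,3)])
    have B: "variation_over f P \<le> 1" if P: "nonoverlapping c d P" for P
      using \<delta>(2)[of P] nonoverlapping_mono[OF P cd(1,3)] family_length_le[OF P cd(2)] cd(4) by simp
    let ?V = "total_variation f c"
    have inc: "norm (f y - f x) \<le> ?V y - ?V x" if "c \<le> x" "x \<le> y" "y \<le> d" for x y
      by (rule total_variation_increment_ge[OF B that])
    have incV: "?V x \<le> ?V y" and incVf: "?V x - f x \<le> ?V y - f y" if "c \<le> x" "x \<le> y" "y \<le> d" for x y
      using inc[OF that] by (auto simp: abs_le_iff)
    have V: "abs_continuous_on c d ?V" by (rule abs_continuous_on_total_variation[OF ac B])
    obtain g1 where g1: "indefinite_integral_on ?V g1 c d"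
      using mono_abs_continuous_indefinite_integral[OF cd(2) V incV] by blast
    obtain g2 where g2: "indefinite_integral_on (\<lambda>x. ?V x - f x) g2 c d"
      using mono_abs_continuous_indefinite_integral[OF cd(2) abs_continuous_on_diff[OF V ac] incVf]
      by blast
    note i = indefinite_integral_onD(3)[OF g1] indefinite_integral_onD(3)[OF g2]
    note g1x = indefinite_integral_onD(2)[OF g1] and g2x = indefinite_integral_onD(2)[OF g2]
    have "indefinite_integral_on f (\<lambda>x. g1 x - g2 x) c d"
      unfolding indefinite_integral_on_def
    proof (intro conjI ballI)
      show "(\<lambda>x. g1 x - g2 x) absolutely_integrable_on {c..d}"
        by (intro set_integral_diff indefinite_integral_onD(1)[OF g1] indefinite_integral_onD(1)[OF g2])
      fix x assume x: "x \<in> {c..d}"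
      show "f x = f c + integral {c..x} (\<lambda>x. g1 x - g2 x)"
        using g1x[OF x] g2x[OF x] by (simp add: integral_diff[OF i(1)[OF x] i(2)[OF x]])
    qed
    then show ?thesis by blast
  qed
  have "\<exists>g. indefinite_integral_on f g c b" if "a \<le> c" "c \<le> b" "b - c < real n * (\<delta> / 2)" for n c
    using that
  proof (induction n arbitrary: c)
    case 0
    then show ?case by simp
  next
    case (Suc n)
    show ?case
    proof (cases "b - c < \<delta>")
      case True
      then show ?thesis using short Suc.prems by blast
    next
      case False
      define d where "d = c + \<delta> / 2"
      have d: "c \<le> d" "d \<le> b" "d - c < \<delta>" using False \<delta>(1) by (auto simp: d_def)
      obtain g1 where "indefinite_integral_on f g1 c d" using short[of c d] d Suc.prems by auto
      moreover obtain g2 where "indefinite_integral_on f g2 d b"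
        using Suc.IH[of d] d Suc.prems by (auto simp: d_def algebra_simps)
      ultimately show ?thesis using indefinite_integral_on_combine d by blast
    qed
  qed
  moreover obtain n where "b - a < real n * (\<delta> / 2)"
    using reals_Archimedean3[of "\<delta> / 2"] \<delta>(1) half_gt_zero by blast
  ultimately show ?thesis using ab by blast
qed

lemma abs_continuous_indefinite_integral:
  fixes f :: "real \<Rightarrow> 'a::euclidean_space"
  assumes ab: "a \<le> b" and f: "abs_continuous_on a b f"
  shows "\<exists>g. indefinite_integral_on f g a b"
proof -
  have "\<exists>g. indefinite_integral_on (\<lambda>x. f x \<bullet> i) g a b" for i
    by (rule abs_continuous_indefinite_integral_real[OF ab])
      (rule abs_continuous_on_linear[OF bounded_linear_inner_left f])
  then obtain g where g: "\<And>i. indefinite_integral_on (\<lambda>x. f x \<bullet> i) (g i) a b" by metis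
  define G where "G x = (\<Sum>i\<in>Basis. g i x *\<^sub>R i)" for x
  have ga: "(\<lambda>x. g i x *\<^sub>R i) absolutely_integrable_on {a..b}" for i
    by (rule absolutely_integrable_linear[OF indefinite_integral_onD(1)[OF g] bounded_linear_scaleR_left, unfolded o_def])
  show ?thesis unfolding indefinite_integral_on_def
  proof (intro exI[of _ G] conjI ballI)
    show "G absolutely_integrable_on {a..b}"
      unfolding G_def by (intro absolutely_integrable_sum ga) auto
    fix x assume x: "x \<in> {a..b}"
    have gi: "g i integrable_on {a..x}" for i by (rule indefinite_integral_onD(3)[OF g x])
    have "integral {a..x} G = (\<Sum>i\<in>Basis. integral {a..x} (\<lambda>x. g i x *\<^sub>R i))"
      unfolding G_def using gi
      by (intro integral_sum) (auto intro!: integrable_linear[OF _ bounded_linear_scaleR_left, unfolded o_def])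
    also have "\<dots> = (\<Sum>i\<in>Basis. integral {a..x} (g i) *\<^sub>R i)"
      by (intro sum.cong refl integral_linear[OF gi bounded_linear_scaleR_left, unfolded o_def])
    also have "\<dots> = (\<Sum>i\<in>Basis. ((f x - f a) \<bullet> i) *\<^sub>R i)"
    proof (rule sum.cong[OF refl])
      fix i :: 'a
      have "f x \<bullet> i = f a \<bullet> i + integral {a..x} (g i)"
        by (rule indefinite_integral_onD(2)[OF g x])
      then show "integral {a..x} (g i) *\<^sub>R i = ((f x - f a) \<bullet> i) *\<^sub>R i"
        by (simp add: inner_diff_left)
    qed
    also have "\<dots> = f x - f a" by (rule euclidean_representation)
    finally show "f x = f a + integral {a..x} G" by simp
  qed
qed

text \<open>Averages of an integrable function over intervals to the right of a point converge almost
  everywhere to its value there; this gives the right derivative. The left derivative is the right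
  derivative of the reflected function.\<close>

lemma indefinite_integral_on_imp_has_vector_derivative:
  fixes f :: "real \<Rightarrow> 'a::euclidean_space"
  assumes fg: "indefinite_integral_on f g a b"
  shows "\<exists>N. negligible N \<and> (\<forall>x\<in>{a<..<b} - N. (f has_vector_derivative g x) (at x))"
proof -
  define G where "G x = (if x \<in> {a..b} then g x else 0)" for x
  have "g integrable_on {a..b}"
    using indefinite_integral_onD(1)[OF fg] by (rule set_lebesgue_integral_eq_integral(1))
  then have "G integrable_on UNIV"
    unfolding G_def using integrable_restrict_UNIV[of "{a..b}" g] by simp
  then have G: "G integrable_on cbox c d" for c d
    by (rule integrable_on_subcbox) simp
  have G': "(\<lambda>x. G (- x)) integrable_on cbox c d" for c d
    using G[of "-d" "-c"] Henstock_Kurzweil_Integration.integrable_reflect_real[where f = G and a = "-d" and b = "-c"] by simp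
  obtain N1 where N1: "negligible N1" "\<And>x e. x \<notin> N1 \<Longrightarrow> 0 < e \<Longrightarrow>
      \<exists>d>0. \<forall>h. 0 < h \<and> h < d \<longrightarrow>
        norm (integral (cbox x (x + h *\<^sub>R One)) G /\<^sub>R h ^ DIM(real) - G x) < e"
    using integrable_ccontinuous_explicit[OF G] by metis
  obtain N2 where N2: "negligible N2" "\<And>x e. x \<notin> N2 \<Longrightarrow> 0 < e \<Longrightarrow>
      \<exists>d>0. \<forall>h. 0 < h \<and> h < d \<longrightarrow>
        norm (integral (cbox x (x + h *\<^sub>R One)) (\<lambda>x. G (- x)) /\<^sub>R h ^ DIM(real) - G (- x)) < e"
    using integrable_ccontinuous_explicit[of "\<lambda>x. G (- x)", OF G'] by metis
  show ?thesis
  proof (intro exI conjI ballI)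
    show "negligible (N1 \<union> uminus ` N2)"
      using N1(1) N2(1)
      by (intro negligible_Un negligible_differentiable_image_negligible) (auto intro!: derivative_intros)
    fix x assume "x \<in> {a<..<b} - (N1 \<union> uminus ` N2)"
    then have x: "a < x" "x < b" "x \<notin> N1" "- x \<notin> N2" using image_eqI[of x uminus "- x" N2] by auto
    have diff: "f v - f u = integral {u..v} G" if "a \<le> u" "u \<le> v" "v \<le> b" for u v
    proof -
      have "f v - f u = integral {a..v} g - integral {a..u} g"
        using indefinite_integral_onD(2)[OF fg, of u] indefinite_integral_onD(2)[OF fg, of v] that
        by simp
      also have "\<dots> = integral {u..v} g"
        using Henstock_Kurzweil_Integration.integral_combine[of a u v g] that
          indefinite_integral_onD(3)[OF fg, of v] by (simp add: algebra_simps)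
      also have "\<dots> = integral {u..v} G"
        by (intro integral_cong) (use that in \<open>auto simp: G_def\<close>)
      finally show ?thesis .
    qed
    have Gx: "G x = g x" using x by (simp add: G_def)
    show "(f has_vector_derivative g x) (at x)"
      unfolding has_vector_derivative_def has_derivative_at'
    proof (intro conjI allI impI)
      show "bounded_linear (\<lambda>t. t *\<^sub>R g x)" by (rule bounded_linear_scaleR_left)
      fix e :: real assume e: "0 < e"
      obtain d1 where d1: "d1 > 0" "\<And>h. 0 < h \<Longrightarrow> h < d1 \<Longrightarrow> norm (integral {x..x + h} G /\<^sub>R h - G x) < e"
        using N1(2)[OF x(3) e] by auto
      obtain d2 where d2: "d2 > 0"
        "\<And>h. 0 < h \<Longrightarrow> h < d2 \<Longrightarrow> norm (integral {-x..-x + h} (\<lambda>x. G (- x)) /\<^sub>R h - G x) < e"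
        using N2(2)[OF x(4) e] by auto
      define d where "d = min (min d1 d2) (min (x - a) (b - x))"
      show "\<exists>d>0. \<forall>x'. 0 < norm (x' - x) \<and> norm (x' - x) < d \<longrightarrow>
              norm (f x' - f x - (x' - x) *\<^sub>R g x) / norm (x' - x) < e"
      proof (intro exI conjI allI impI)
        show "d > 0" using d1 d2 x by (simp add: d_def)
        fix y assume y: "0 < norm (y - x) \<and> norm (y - x) < d"
        show "norm (f y - f x - (y - x) *\<^sub>R g x) / norm (y - x) < e"
        proof (cases "y > x")
          case True
          define h where "h = y - x"
          have h: "0 < h" "h < d1" "y = x + h" using y True by (auto simp: h_def d_def)
          have fe: "f y - f x = integral {x..x + h} G"
            unfolding h(3) by (rule diff) (use x y True in \<open>auto simp: h_def d_def\<close>)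
          moreover have "norm (integral {x..x + h} G - h *\<^sub>R G x) / h = norm (integral {x..x + h} G /\<^sub>R h - G x)"
          proof -
            have "integral {x..x + h} G /\<^sub>R h - G x = (integral {x..x + h} G - h *\<^sub>R G x) /\<^sub>R h"
              using h(1) by (simp add: scaleR_diff_right)
            then show ?thesis using h(1) by (simp add: divide_inverse mult.commute)
          qed
          moreover have "y - x = h" "norm h = h" using h by auto
          ultimately show ?thesis using d1(2)[OF h(1,2)] by (simp only: Gx[symmetric])
        next
          case False
          define h where "h = x - y"
          have h: "0 < h" "h < d2" "y = x - h" using y False by (auto simp: h_def d_def)
          have "f x - f y = integral {x - h..x} G"
            unfolding h(3) by (rule diff) (use x y False in \<open>auto simp: h_def d_def\<close>)
          also have "\<dots> = integral {-x..-x + h} (\<lambda>x. G (- x))"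
            using Henstock_Kurzweil_Integration.integral_reflect_real[where f = "\<lambda>x. G (- x)" and a = "- x" and b = "- x + h"] by (simp add: add.commute)
          finally have fe: "f x - f y = integral {-x..-x + h} (\<lambda>x. G (- x))" .
          moreover have "norm (integral {-x..-x + h} (\<lambda>x. G (- x)) - h *\<^sub>R G x) / h
              = norm (integral {-x..-x + h} (\<lambda>x. G (- x)) /\<^sub>R h - G x)"
          proof -
            have "integral {-x..-x + h} (\<lambda>x. G (- x)) /\<^sub>R h - G x
                = (integral {-x..-x + h} (\<lambda>x. G (- x)) - h *\<^sub>R G x) /\<^sub>R h"
              using h(1) by (simp add: scaleR_diff_right)
            then show ?thesis using h(1) by (simp add: divide_inverse mult.commute)
          qed
          moreover have "norm (f y - f x - (y - x) *\<^sub>R g x) = norm (f x - f y - h *\<^sub>R G x)"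
            unfolding norm_minus_cancel[of "f x - f y - h *\<^sub>R G x", symmetric]
            by (simp add: h_def Gx algebra_simps)
          moreover have "norm (y - x) = h" using h by auto
          ultimately show ?thesis using d2(2)[OF h(1,2)] by (simp only:)
        qed
      qed
    qed
  qed
qed

lemma abs_continuous_on_has_vector_derivative:
  fixes f :: "real \<Rightarrow> 'a::euclidean_space"
  assumes "a \<le> b" "abs_continuous_on a b f"
  shows "\<exists>N. negligible N \<and> (\<forall>x\<in>{a<..<b} - N. (f has_vector_derivative vector_derivative f (at x)) (at x))"
    and "(\<lambda>x. vector_derivative f (at x)) absolutely_integrable_on {a..b}"
    and "integral {a..b} (\<lambda>x. vector_derivative f (at x)) = f b - f a"
proof -
  obtain g where g: "indefinite_integral_on f g a b" using abs_continuous_indefinite_integral[OF assms] by blast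
  obtain N where N: "negligible N" "\<And>x. x \<in> {a<..<b} - N \<Longrightarrow> (f has_vector_derivative g x) (at x)"
    using indefinite_integral_on_imp_has_vector_derivative[OF g] by (elim exE conjE) (metis (no_types))
  have eq: "vector_derivative f (at x) = g x" if "x \<in> {a..b} - (N \<union> {a, b})" for x
    by (rule vector_derivative_at[OF N(2)]) (use that in auto)
  have neg: "negligible (N \<union> {a, b})" using N(1) by auto
  show "\<exists>N. negligible N \<and> (\<forall>x\<in>{a<..<b} - N. (f has_vector_derivative vector_derivative f (at x)) (at x))"
  proof (intro exI[of _ N] conjI ballI)
    fix x assume x: "x \<in> {a<..<b} - N"
    have "vector_derivative f (at x) = g x" by (rule vector_derivative_at[OF N(2)[OF x]])
    with N(2)[OF x] show "(f has_vector_derivative vector_derivative f (at x)) (at x)" by simp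
  qed (rule N(1))
  show "(\<lambda>x. vector_derivative f (at x)) absolutely_integrable_on {a..b}"
    by (rule absolutely_integrable_spike[OF indefinite_integral_onD(1)[OF g] neg eq])
  have "integral {a..b} (\<lambda>x. vector_derivative f (at x)) = integral {a..b} g"
    by (rule integral_spike[OF neg]) (simp add: eq)
  also have "\<dots> = f b - f a" using indefinite_integral_onD(2)[OF g, of b] \<open>a \<le> b\<close> by simp
  finally show "integral {a..b} (\<lambda>x. vector_derivative f (at x)) = f b - f a" .
qed

section \<open>Locally absolutely continuous functions on the half-line\<close>

lemma AE_leb_half_iff: "(AE x in leb_half. P x) \<longleftrightarrow> (AE x in lebesgue. 0 \<le> x \<longrightarrow> P x)"
  by (subst AE_restrict_space_iff) auto

lemma AC_loc_half_subinterval: "y \<in> AC_loc_half \<Longrightarrow> 0 \<le> a \<Longrightarrow> a \<le> b \<Longrightarrow> abs_continuous_on a b y"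
  unfolding AC_loc_half_def using abs_continuous_on_subset[of 0 b y a b] by simp

lemma AC_loc_half_continuous_on:
  assumes "y \<in> AC_loc_half" shows "continuous_on {0..} y"
proof -
  show ?thesis
    unfolding continuous_on_eq_continuous_within
  proof
    fix x :: real assume x: "x \<in> {0..}"
    have "continuous (at x within {0..x + 1}) y"
      using abs_continuous_on_imp_continuous_on[OF AC_loc_half_subinterval[OF assms order_refl, of "x + 1"]] x
      by (auto simp: continuous_on_eq_continuous_within)
    moreover have "at x within {0..x + 1} = at x within {0..}"
      by (rule at_within_nhd[of _ "{..<x + 1}"]) auto
    ultimately show "continuous (at x within {0..}) y" by simp
  qed
qed

lemma AC_loc_half_differentiable:
  fixes y :: "real \<Rightarrow> 'a::euclidean_space"
  assumes y: "y \<in> AC_loc_half"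
  shows "AE x in leb_half. (y has_vector_derivative vector_derivative y (at x)) (at x)"
proof -
  let ?P = "\<lambda>x. (y has_vector_derivative vector_derivative y (at x)) (at x)"
  have "AE x in lebesgue. x \<in> {0<..<real n} \<longrightarrow> ?P x" for n
  proof -
    have n: "0 \<le> real n" by simp
    obtain N where N: "negligible N" "\<forall>x\<in>{0<..<real n} - N. ?P x"
      using abs_continuous_on_has_vector_derivative(1)[OF n AC_loc_half_subinterval[OF y order_refl n]]
      by (elim exE conjE)
    have "{x \<in> space lebesgue. \<not> (x \<in> {0<..<real n} \<longrightarrow> ?P x)} \<subseteq> N" using N by auto
    with N(1) show ?thesis by (intro AE_I'[of N]) (auto simp: negligible_iff_null_sets)
  qed
  then have "AE x in lebesgue. \<forall>n::nat. x \<in> {0<..<real n} \<longrightarrow> ?P x" unfolding AE_all_countable by blast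
  moreover have "AE x in lebesgue. x \<noteq> (0::real)"
    by (rule AE_I'[of "{0}"]) (auto simp flip: negligible_iff_null_sets)
  ultimately show ?thesis unfolding AE_leb_half_iff
  proof eventually_elim
    case (elim x)
    obtain n where "x < real n" using reals_Archimedean2 by blast
    with elim show ?case by auto
  qed
qed

text \<open>The integrand may be any function that is a derivative of \<open>y\<close> almost everywhere, such as one
  given by a product rule or a differential equation.\<close>

lemma AC_loc_half_integral:
  fixes y :: "real \<Rightarrow> 'a::euclidean_space"
  assumes y: "y \<in> AC_loc_half" and y': "AE x in leb_half. (y has_vector_derivative y' x) (at x)"
    and ab: "0 \<le> a" "a \<le> b"
  shows "y' absolutely_integrable_on {a..b}" and "integral {a..b} y' = y b - y a"
proof -
  obtain N where N: "N \<in> null_sets lebesgue" "{x \<in> space lebesgue. \<not> (0 \<le> x \<longrightarrow> (y has_vector_derivative y' x) (at x))} \<subseteq> N"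
    using y' unfolding AE_leb_half_iff completion.AE_iff_null_sets by blast
  have neg: "negligible N" using N(1) by (simp add: negligible_iff_null_sets)
  have eq: "y' x = vector_derivative y (at x)" if "x \<in> {a..b} - N" for x
  proof (rule vector_derivative_at[symmetric])
    have "0 \<le> x" "x \<notin> N" using that ab by auto
    then show "(y has_vector_derivative y' x) (at x)" using N(2) by auto
  qed
  note ac = abs_continuous_on_has_vector_derivative[OF ab(2) AC_loc_half_subinterval[OF y ab]]
  show "y' absolutely_integrable_on {a..b}"
    by (rule absolutely_integrable_spike[OF ac(2) neg eq])
  show "integral {a..b} y' = y b - y a"
    unfolding ac(3)[symmetric] by (rule integral_spike[OF neg]) (simp add: eq)
qed

lemma AC_loc_half_add: "f \<in> AC_loc_half \<Longrightarrow> g \<in> AC_loc_half \<Longrightarrow> (\<lambda>x. f x + g x) \<in> AC_loc_half"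
  unfolding AC_loc_half_def by (auto intro: abs_continuous_on_add)

lemma AC_loc_half_diff: "f \<in> AC_loc_half \<Longrightarrow> g \<in> AC_loc_half \<Longrightarrow> (\<lambda>x. f x - g x) \<in> AC_loc_half"
  unfolding AC_loc_half_def by (auto intro: abs_continuous_on_diff)

lemma AC_loc_half_linear: "bounded_linear h \<Longrightarrow> f \<in> AC_loc_half \<Longrightarrow> (\<lambda>x. h (f x)) \<in> AC_loc_half"
  unfolding AC_loc_half_def by (auto intro: abs_continuous_on_linear)

lemma AC_loc_half_bilinear:
  "bounded_bilinear h \<Longrightarrow> f \<in> AC_loc_half \<Longrightarrow> g \<in> AC_loc_half \<Longrightarrow> (\<lambda>x. h (f x) (g x)) \<in> AC_loc_half"
  unfolding AC_loc_half_def by (auto intro: abs_continuous_on_bilinear)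

lemma borel_measurable_leb_half_continuous:
  fixes f :: "real \<Rightarrow> 'a::euclidean_space"
  shows "continuous_on {0..} f \<Longrightarrow> f \<in> borel_measurable leb_half"
  by (rule continuous_imp_measurable_on_sets_lebesgue) auto

text \<open>Lebesgue measure is complete, so functions that are changed on a null set remain
  measurable. This concerns \<open>dirac Q y\<close>, which is arbitrary where \<open>y\<close> is not differentiable.\<close>

lemma borel_measurable_leb_half_cong_AE:
  fixes f g :: "real \<Rightarrow> 'a::euclidean_space"
  assumes "f \<in> borel_measurable leb_half" "AE x in leb_half. f x = g x"
  shows "g \<in> borel_measurable leb_half"
proof -
  obtain N where N: "N \<in> null_sets lebesgue" "{x \<in> space lebesgue. \<not> (0 \<le> x \<longrightarrow> f x = g x)} \<subseteq> N"
    using assms(2) unfolding AE_leb_half_iff completion.AE_iff_null_sets by blast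
  define f' g' where "f' x = (if x \<in> {0..} then f x else 0)"
    and "g' x = (if x \<in> {0..} then g x else 0)" for x
  have f': "f' \<in> borel_measurable lebesgue"
    unfolding f'_def by (rule borel_measurable_if_I[OF assms(1)]) auto
  have eq: "f' x = g' x" if "x \<notin> N" for x using N(2) that by (auto simp: f'_def g'_def)
  have "g' \<in> borel_measurable lebesgue"
  proof (rule measurableI)
    fix A :: "'a set" assume A: "A \<in> sets borel"
    have "f' -` A \<inter> space lebesgue - N \<in> sets lebesgue"
      using measurable_sets[OF f' A] N(1) by (intro sets.Diff) auto
    moreover have "g' -` A \<inter> N \<in> null_sets lebesgue"
      by (rule null_sets_completion_subset[OF _ N(1)]) auto
    then have "g' -` A \<inter> N \<in> sets lebesgue" by auto
    moreover have "g' -` A \<inter> space lebesgue = (f' -` A \<inter> space lebesgue - N) \<union> (g' -` A \<inter> N)"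
      using eq by auto
    ultimately show "g' -` A \<inter> space lebesgue \<in> sets lebesgue" by (metis sets.Un)
  qed auto
  then show ?thesis unfolding g'_def by (rule borel_measurable_if_D)
qed

lemma continuous_AE_zero_leb_half:
  fixes f :: "real \<Rightarrow> 'a::euclidean_space"
  assumes cont: "continuous_on {0..} f" and zero: "AE x in leb_half. f x = 0" and "x \<ge> 0"
  shows "f x = 0"
proof (rule ccontr)
  assume "f x \<noteq> 0"
  then have "norm (f x) > 0" by simp
  then obtain d where d: "d > 0" "\<And>y. y \<in> {0..} \<Longrightarrow> dist y x < d \<Longrightarrow> dist (f y) (f x) < norm (f x)"
    using cont \<open>x \<ge> 0\<close> unfolding continuous_on_iff by (metis atLeast_iff)
  have nz: "f y \<noteq> 0" if "y \<in> {x..x + d / 2}" for y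
    using d(2)[of y] d(1) that \<open>x \<ge> 0\<close> by (auto simp: dist_real_def)
  have "AE y in lebesgue. y \<notin> {x..x + d / 2}"
    using zero unfolding AE_leb_half_iff by eventually_elim (use nz \<open>x \<ge> 0\<close> in auto)
  then have "{x..x + d / 2} \<in> null_sets lebesgue" by (simp add: completion.null_sets_iff_AE)
  then have "emeasure lebesgue {x..x + d / 2} = 0" by (rule null_setsD1)
  then show False using d(1) by simp
qed

lemma borel_measurable_L1_loc_half:
  fixes Q :: "real \<Rightarrow> 'a::euclidean_space"
  assumes "Q \<in> L1_loc_half" shows "Q \<in> borel_measurable leb_half"
proof -
  have "(\<lambda>x. if x \<in> {0..} then Q x else 0) \<in> borel_measurable lebesgue"
  proof (rule borel_measurable_LIMSEQ_metric)
    fix n :: nat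
    have "Q absolutely_integrable_on {0..real n}" using assms by (simp add: L1_loc_half_def)
    then show "(\<lambda>x. indicator {0..real n} x *\<^sub>R Q x) \<in> borel_measurable lebesgue"
      unfolding set_integrable_def by (rule borel_measurable_integrable)
  next
    fix x :: real
    obtain N :: nat where N: "x \<le> real N" using real_arch_simple by blast
    have "eventually (\<lambda>n. indicator {0..real n} x *\<^sub>R Q x = (if x \<in> {0..} then Q x else 0)) sequentially"
      using eventually_ge_at_top[of N]
    proof eventually_elim
      case (elim n)
      then have "x \<le> real n" using N by (meson of_nat_mono order_trans)
      then show ?case by (auto simp: indicator_def)
    qed
    then show "(\<lambda>n. indicator {0..real n} x *\<^sub>R Q x) \<longlonglongrightarrow> (if x \<in> {0..} then Q x else 0)"
      by (rule tendsto_eventually)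
  qed
  then show ?thesis by (rule borel_measurable_if_D)
qed

lemma integrable_lebesgue_on_interval:
  fixes f :: "real \<Rightarrow> 'a::euclidean_space"
  shows "f absolutely_integrable_on {0..b} \<longleftrightarrow> integrable (lebesgue_on {0..b}) f"
  by (simp add: set_integrable_def integrable_restrict_space)

lemma AE_lebesgue_on_interval:
  assumes "AE x in leb_half. P x" shows "AE x in lebesgue_on {0..b}. P x"
proof -
  have "AE x in lebesgue. 0 \<le> x \<longrightarrow> P x" using assms by (simp add: AE_leb_half_iff)
  then have "AE x in lebesgue. x \<in> {0..b} \<longrightarrow> P x" by eventually_elim auto
  then show ?thesis by (subst AE_restrict_space_iff) auto
qed

lemma has_bochner_integral_leb_half_AE:
  fixes f g :: "real \<Rightarrow> 'a::euclidean_space"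
  assumes f: "has_bochner_integral leb_half f I" and eq: "AE x in leb_half. f x = g x"
  shows "has_bochner_integral leb_half g I"
proof -
  have "f \<in> borel_measurable leb_half" using f by (auto simp: has_bochner_integral_iff)
  from has_bochner_integral_cong_AE[OF this borel_measurable_leb_half_cong_AE[OF this eq] eq] f
  show ?thesis by simp
qed

section \<open>Complex matrices and the block structure\<close>

lemma ctrans_nth [simp]: "ctrans A $ i $ j = cnj (A $ j $ i)"
  by (simp add: ctrans_def transpose_def map_matrix_def)

lemma matrix_mult_nth: "(A ** B) $ i $ j = (\<Sum>l\<in>UNIV. A $ i $ l * B $ l $ j)"
  by (simp add: matrix_matrix_mult_def)

lemma mat_mult_nth: "(mat c ** A) $ i $ j = c * A $ i $ j"
  by (simp add: matrix_matrix_mult_def mat_def if_distrib[of "\<lambda>x. x * _"] cong: if_cong)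

lemma mult_mat_nth: "(A ** mat c) $ i $ j = A $ i $ j * c"
  by (simp add: matrix_matrix_mult_def mat_def if_distrib[of "\<lambda>x. _ * x"] cong: if_cong)

lemma mat_mult_vec: "mat c *v x = c *s x" for x :: "complex^'n"
  by (simp add: vec_eq_iff matrix_vector_mult_def mat_def if_distrib[of "\<lambda>x. x * _"] cong: if_cong)

lemma ctrans_mat: "ctrans (mat c :: complex^'n^'n) = mat (cnj c)"
  by (simp add: vec_eq_iff mat_def)

lemma ctrans_mult: "ctrans (A ** B) = ctrans B ** ctrans A" for A :: "complex^'n^'m"
  by (simp add: vec_eq_iff matrix_matrix_mult_def mult.commute)

lemma ctrans_ctrans: "ctrans (ctrans A) = A"
  by (simp add: vec_eq_iff)

lemma matrix_mult_uminus_left: "(- A) ** B = - (A ** B)" for A :: "complex^'n^'m"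
  by (simp add: vec_eq_iff matrix_matrix_mult_def sum_negf)

lemma matrix_mult_uminus_right: "A ** (- B) = - (A ** B)" for A :: "complex^'n^'m"
  by (simp add: vec_eq_iff matrix_matrix_mult_def sum_negf)

lemma matrix_mult_add_right: "A ** (B + C) = A ** B + A ** C" for A :: "complex^'n^'m"
  by (simp add: vec_eq_iff matrix_matrix_mult_def distrib_left sum.distrib)

lemma matrix_mult_add_left: "(A + B) ** C = A ** C + B ** C" for A :: "complex^'n^'m"
  by (simp add: vec_eq_iff matrix_matrix_mult_def distrib_right sum.distrib)

lemma matrix_vector_uminus_left: "(- A) *v x = - (A *v x)" for A :: "complex^'n^'m"
  by (simp add: vec_eq_iff matrix_vector_mult_def sum_negf)

lemma matrix_vector_uminus_right: "A *v (- x) = - (A *v x)" for A :: "complex^'n^'m"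
  by (simp add: vec_eq_iff matrix_vector_mult_def sum_negf)

lemma matrix_vector_scale: "A *v (c *s x) = c *s (A *v x)" for A :: "complex^'n^'m"
  by (simp add: vec_eq_iff matrix_vector_mult_def sum_distrib_left mult_ac)

lemma vector_scale_diff_left: "(a - b) *s x = a *s x - b *s x" for x :: "complex^'n"
  by (simp add: vec_eq_iff left_diff_distrib)

lemma vector_scale_diff_right: "a *s (x - y) = a *s x - a *s y" for x :: "complex^'n"
  by (simp add: vec_eq_iff right_diff_distrib)

lemma vector_scale_add_right: "a *s (x + y) = a *s x + a *s y" for x :: "complex^'n"
  by (simp add: vec_eq_iff distrib_left)

lemma bounded_bilinear_matrix_vector:
  "bounded_bilinear ((*v) :: complex^'n^'m \<Rightarrow> complex^'n \<Rightarrow> complex^'m)"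
  unfolding bilinear_conv_bounded_bilinear[symmetric] bilinear_def
  by (intro conjI allI linearI)
    (simp_all add: vec_eq_iff matrix_vector_mult_def distrib_left distrib_right sum.distrib scaleR_sum_right)

lemma bounded_bilinear_matrix_mult:
  "bounded_bilinear ((**) :: complex^'n^'m \<Rightarrow> complex^'k^'n \<Rightarrow> complex^'k^'m)"
  unfolding bilinear_conv_bounded_bilinear[symmetric] bilinear_def
  by (intro conjI allI linearI)
    (simp_all add: vec_eq_iff matrix_matrix_mult_def distrib_left distrib_right sum.distrib scaleR_sum_right)

lemmas bounded_linear_matrix_vector = bounded_bilinear.bounded_linear_right[OF bounded_bilinear_matrix_vector]
lemmas bounded_linear_matrix_vector_left = bounded_bilinear.bounded_linear_left[OF bounded_bilinear_matrix_vector]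

lemma norm_vector_scale: "norm (c *s x) = norm c * norm x" for x :: "complex^'n"
  by (simp add: norm_vec_def norm_mult L2_set_right_distrib)

lemma bounded_linear_vector_scale: "bounded_linear (\<lambda>x. c *s x :: complex^'n)"
  by (rule bounded_linear_intro[where K = "norm c"])
    (simp_all add: vector_scale_add_right norm_vector_scale mult.commute vec_eq_iff)

subsection \<open>The sesquilinear form\<close>

lemma cdot_add_left: "cdot (x + y) z = cdot x z + cdot y z"
  and cdot_add_right: "cdot x (y + z) = cdot x y + cdot x z"
  and cdot_diff_left: "cdot (x - y) z = cdot x z - cdot y z"
  and cdot_diff_right: "cdot x (y - z) = cdot x y - cdot x z"
  and cdot_uminus_left: "cdot (- x) z = - cdot x z"
  and cdot_uminus_right: "cdot x (- z) = - cdot x z"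
  and cdot_scale_left: "cdot (c *s x) z = c * cdot x z"
  and cdot_scale_right: "cdot x (c *s z) = cnj c * cdot x z"
  and cdot_scaleR_left: "cdot (r *\<^sub>R x) z = r *\<^sub>R cdot x z"
  and cdot_scaleR_right: "cdot x (r *\<^sub>R z) = r *\<^sub>R cdot x z"
  by (simp_all add: cdot_def algebra_simps sum.distrib sum_subtractf sum_negf sum_distrib_left scaleR_sum_right)

lemma cdot_zero [simp]: "cdot 0 x = 0" "cdot x 0 = 0"
  by (simp_all add: cdot_def)

lemma cnj_cdot: "cnj (cdot x y) = cdot y x"
  by (simp add: cdot_def mult.commute)

lemma cdot_self: "cdot x x = of_real ((norm x)\<^sup>2)"
  by (simp add: cdot_def norm_vec_def L2_set_def sum_nonneg complex_norm_square[symmetric] of_real_sum[symmetric]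
      del: of_real_sum of_real_power)

lemma inner_eq_Re_cdot: "inner x y = Re (cdot x y)"
  by (simp add: cdot_def inner_vec_def inner_complex_def)

lemma norm_cdot_le: "norm (cdot x y) \<le> norm x * norm y"
proof -
  have "norm (cdot x y) \<le> (\<Sum>i\<in>UNIV. norm (x $ i) * norm (y $ i))"
    unfolding cdot_def by (rule order_trans[OF norm_sum]) (simp add: norm_mult)
  also have "\<dots> \<le> norm x * norm y"
    unfolding norm_vec_def using L2_set_mult_ineq[of "\<lambda>i. norm (x $ i)" "\<lambda>i. norm (y $ i)" UNIV] by simp
  finally show ?thesis .
qed

lemma bounded_bilinear_cdot: "bounded_bilinear cdot"
  by (rule bounded_bilinear.intro)
    (auto simp: cdot_add_left cdot_add_right cdot_scaleR_left cdot_scaleR_right intro!: exI[of _ 1] norm_cdot_le)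

lemma cdot_matrix_left: "cdot (A *v x) y = cdot x (ctrans A *v y)"
proof -
  have "cdot (A *v x) y = (\<Sum>i\<in>UNIV. \<Sum>j\<in>UNIV. A $ i $ j * x $ j * cnj (y $ i))"
    by (simp add: cdot_def matrix_vector_mult_def sum_distrib_right)
  also have "\<dots> = (\<Sum>j\<in>UNIV. \<Sum>i\<in>UNIV. A $ i $ j * x $ j * cnj (y $ i))"
    by (rule sum.swap)
  also have "\<dots> = cdot x (ctrans A *v y)"
    by (simp add: cdot_def matrix_vector_mult_def sum_distrib_left mult_ac)
  finally show ?thesis .
qed

lemma cdot_axis: "cdot x (axis i 1) = x $ i"
  by (simp add: cdot_def axis_def if_distrib[of "\<lambda>a. _ * a"] if_distrib[of cnj] cong: if_cong)

lemma cdot_matrix_axis: "cdot (A *v axis j 1) (axis i 1) = A $ i $ j"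
  unfolding cdot_axis by (simp add: matrix_vector_mult_def axis_def if_distrib[of "\<lambda>a. _ * a"] cong: if_cong)

lemmas matrix_vector_scaleR = bounded_bilinear.scaleR_right[OF bounded_bilinear_matrix_vector]

lemma norm_matrix_vector_le: "norm (A *v x) \<le> onorm (\<lambda>u. A *v u) * norm x" for A :: "complex^'n^'m"
  by (rule onorm[OF bounded_linear_matrix_vector])

lemma norm_matrix_vector_le_norm:
  obtains K where "K > 0" "\<And>(A :: complex^'n^'m) x. norm (A *v x) \<le> K * norm A * norm x"
  using bounded_bilinear.pos_bounded[OF bounded_bilinear_matrix_vector] by (metis mult.assoc mult.commute)

subsection \<open>Imaginary part\<close>

lemma ctrans_Im_mat: "ctrans (Im_mat A) = Im_mat A"
  by (simp add: vec_eq_iff Im_mat_def mat_mult_nth field_simps)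

lemma cdot_Im_mat: "2 * \<i> * cdot (Im_mat A *v x) y = cdot (A *v x) y - cdot x (A *v y)"
proof -
  have "Im_mat A *v x = (1 / (2 * \<i>)) *s (A *v x - ctrans A *v x)"
    unfolding Im_mat_def matrix_vector_mul_assoc[symmetric] mat_mult_vec matrix_vector_mult_diff_rdistrib ..
  then have "2 * \<i> * cdot (Im_mat A *v x) y = (2 * \<i> * (1 / (2 * \<i>))) * cdot (A *v x - ctrans A *v x) y"
    by (simp only: cdot_scale_left mult.assoc)
  then show ?thesis
    by (simp add: cdot_diff_left cdot_matrix_left[of "ctrans A"] ctrans_ctrans)
qed

lemma cdot_hermitian_real:
  assumes "ctrans A = A" shows "cdot (A *v x) x \<in> \<real>"
proof -
  have "cnj (cdot (A *v x) x) = cdot (A *v x) x"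
    using cdot_matrix_left[of A x x] assms by (simp add: cnj_cdot)
  then show ?thesis by (simp add: Reals_cnj_iff)
qed

lemma cdot_Im_mat_self: "Re (cdot (Im_mat M *v e) e) = Im (cdot (M *v e) e)"
proof -
  have "2 * \<i> * cdot (Im_mat M *v e) e = cdot (M *v e) e - cnj (cdot (M *v e) e)"
    by (simp add: cdot_Im_mat cnj_cdot)
  then have "Im (2 * \<i> * cdot (Im_mat M *v e) e) = Im (cdot (M *v e) e - cnj (cdot (M *v e) e))" by simp
  then show ?thesis by simp
qed

subsection \<open>Blocks\<close>

lemma upper_stack [simp]: "upper (stack a b) = a" and lower_stack [simp]: "lower (stack a b) = b"
  by (simp_all add: upper_def lower_def stack_def)

lemma stack_upper_lower: "stack (upper y) (lower y) = y"
  by (auto simp: vec_eq_iff upper_def lower_def stack_def split: sum.split)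

lemma upper_add: "upper (x + y) = upper x + upper y" and lower_add: "lower (x + y) = lower x + lower y"
  and upper_diff: "upper (x' - y') = upper x' - upper y'" and lower_diff: "lower (x' - y') = lower x' - lower y'"
  and upper_zero [simp]: "upper 0 = 0" and lower_zero [simp]: "lower 0 = 0"
  by (simp_all add: upper_def lower_def vec_eq_iff)

lemma upper_mult_vec: "upper (A *v x) = upper A *v x" and lower_mult_vec: "lower (A *v x) = lower A *v x"
  by (simp_all add: upper_def lower_def vec_eq_iff matrix_vector_mult_def)

lemma stack_mult_vec: "stack A B *v x = stack (A *v x) (B *v x)"
  by (auto simp: vec_eq_iff stack_def matrix_vector_mult_def split: sum.split)

lemma stack_add: "stack a b + stack c d = stack (a + c) (b + d)"
  by (auto simp: vec_eq_iff stack_def split: sum.split)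

lemma sum_UNIV_sum: "(\<Sum>k\<in>(UNIV :: ('a::finite + 'b::finite) set). f k) = (\<Sum>i\<in>UNIV. f (Inl i)) + (\<Sum>i\<in>UNIV. f (Inr i))"
  using sum.Plus[of "UNIV :: 'a set" "UNIV :: 'b set" f] by (simp add: UNIV_Plus_UNIV)

lemma cdot_stack: "cdot (stack a b) (stack c d) = cdot a c + cdot b d"
  by (simp add: cdot_def sum_UNIV_sum stack_def)

lemma cdot_upper_lower: "cdot x y = cdot (upper x) (upper y) + cdot (lower x) (lower y)"
  by (subst (1 2) stack_upper_lower[symmetric]) (rule cdot_stack)

lemma norm_stack: "(norm (stack a b :: complex^('p::finite + 'p)))\<^sup>2 = (norm a)\<^sup>2 + (norm b)\<^sup>2"
proof -
  have "complex_of_real ((norm (stack a b))\<^sup>2) = of_real ((norm a)\<^sup>2 + (norm b)\<^sup>2)"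
    unfolding cdot_self[symmetric] of_real_add by (rule cdot_stack)
  then show ?thesis by (simp only: of_real_eq_iff)
qed

lemma Jmat_mult_vec: "Jmat *v y = stack (- lower y) (upper y)"
  by (auto simp: vec_eq_iff Jmat_def stack_def upper_def lower_def matrix_vector_mult_def sum_UNIV_sum
      mat_def if_distrib[of "\<lambda>x. x * _"] if_distrib[of uminus] split: sum.split cong: if_cong)

lemma cdot_Jmat: "cdot (Jmat *v x) y = cdot (upper x) (lower y) - cdot (lower x) (upper y)"
  by (simp add: Jmat_mult_vec cdot_upper_lower[of "stack _ _"] cdot_uminus_left)

lemma cdot_Jmat_skew: "cdot (Jmat *v x) y = - cdot x (Jmat *v y)"
  unfolding cdot_Jmat by (simp add: Jmat_mult_vec cdot_upper_lower[of x] cdot_uminus_right)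

lemma norm_Jmat: "norm (Jmat *v y) = norm y"
proof -
  have "(norm (Jmat *v y))\<^sup>2 = (norm (stack (upper y) (lower y)))\<^sup>2"
    unfolding Jmat_mult_vec norm_stack by simp
  then show ?thesis by (simp add: stack_upper_lower)
qed

section \<open>Matrix cosine and sine\<close>

lemma matpow_0 [simp]: "matpow A 0 = mat 1" and matpow_Suc: "matpow A (Suc k) = A ** matpow A k"
  by (simp_all add: matpow_def)

lemma matpow_commutes: "B ** A = A ** B \<Longrightarrow> B ** matpow A k = matpow A k ** B"
  by (induction k) (simp_all add: matpow_Suc matrix_mul_assoc, metis matrix_mul_assoc)

lemma norm_matpow_bound:
  fixes A :: "complex^'n^'n"
  obtains K L where "\<And>k. norm (matpow A k) \<le> K * L ^ k" "L \<ge> 0"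
proof -
  obtain c where c: "c > 0" "\<And>(A :: complex^'n^'n) (B :: complex^'n^'n). norm (A ** B) \<le> norm A * norm B * c"
    using bounded_bilinear.pos_bounded[OF bounded_bilinear_matrix_mult] by blast
  have *: "norm (matpow A k) \<le> norm (mat 1 :: complex^'n^'n) * (c * norm A) ^ k" for k
  proof (induction k)
    case (Suc k)
    have "norm (matpow A (Suc k)) \<le> norm A * norm (matpow A k) * c"
      unfolding matpow_Suc by (rule c(2))
    also have "\<dots> \<le> norm A * (norm (mat 1 :: complex^'n^'n) * (c * norm A) ^ k) * c"
      using Suc c(1) by (intro mult_right_mono mult_left_mono) auto
    finally show ?case by (simp add: mult_ac)
  qed simp
  show thesis by (rule that[OF *]) (use c(1) in simp)
qed

text \<open>The bound by the coefficients of the exponential series makes all series below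
  converge.\<close>

definition entire_coeffs :: "(nat \<Rightarrow> real) \<Rightarrow> bool"
  where "entire_coeffs c \<longleftrightarrow> (\<forall>k. \<bar>c k\<bar> \<le> inverse (fact k))"

lemma entire_coeffs_trig: "entire_coeffs cos_coeff" "entire_coeffs sin_coeff" "entire_coeffs (\<lambda>k. - sin_coeff k)"
  unfolding entire_coeffs_def cos_coeff_def sin_coeff_def
  by (auto simp: divide_inverse abs_mult power_abs)

lemma summable_matpow_series:
  assumes "entire_coeffs c"
  shows "summable (\<lambda>k. c k *\<^sub>R matpow A k)"
    and "summable (\<lambda>k. (of_real (c k) * matpow A k $ i $ j) * x ^ k)"
proof -
  obtain K L where KL: "\<And>k. norm (matpow A k) \<le> K * L ^ k" "L \<ge> 0"
    using norm_matpow_bound[of A] by blast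
  have c: "\<bar>c k\<bar> \<le> inverse (fact k)" for k using assms by (simp add: entire_coeffs_def)
  have "norm (c k *\<^sub>R matpow A k) \<le> K * (inverse (fact k) * L ^ k)" for k
  proof -
    have "norm (c k *\<^sub>R matpow A k) \<le> inverse (fact k) * (K * L ^ k)"
      unfolding norm_scaleR using c KL(1) by (intro mult_mono) auto
    then show ?thesis by (simp add: mult_ac)
  qed
  then show "summable (\<lambda>k. c k *\<^sub>R matpow A k)"
    by (intro summable_comparison_test'[OF summable_mult[OF summable_exp[of L]]]) auto
  have "norm ((of_real (c k) * matpow A k $ i $ j) * x ^ k) \<le> K * (inverse (fact k) * (L * norm x) ^ k)" for k
  proof -
    have "norm (matpow A k $ i $ j) \<le> norm (matpow A k)"
      by (rule order_trans[OF Finite_Cartesian_Product.norm_nth_le Finite_Cartesian_Product.norm_nth_le])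
    also have "\<dots> \<le> K * L ^ k" by (rule KL)
    finally have KLij: "norm (matpow A k $ i $ j) \<le> K * L ^ k" .
    then have "0 \<le> K * L ^ k" by (rule order_trans[OF norm_ge_zero])
    with KLij have "norm ((of_real (c k) * matpow A k $ i $ j) * x ^ k) \<le> inverse (fact k) * (K * L ^ k) * norm x ^ k"
      unfolding norm_mult norm_power norm_of_real using c by (intro mult_mono) auto
    then show ?thesis by (simp add: mult_ac power_mult_distrib)
  qed
  then show "summable (\<lambda>k. (of_real (c k) * matpow A k $ i $ j) * x ^ k)"
    by (intro summable_comparison_test'[OF summable_mult[OF summable_exp[of "L * norm x"]]]) auto
qed

text \<open>A parameter is added to the matrix cosine and sine, so that their entries become power series
  in one variable, which can be differentiated term by term.\<close>

definition matrix_series :: "(nat \<Rightarrow> real) \<Rightarrow> complex^'n^'n \<Rightarrow> complex \<Rightarrow> complex^'n^'n"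
  where "matrix_series c A x = (\<chi> i j. \<Sum>k. (of_real (c k) * matpow A k $ i $ j) * x ^ k)"

lemma suminf_matpow:
  assumes "entire_coeffs c" shows "(\<Sum>k. c k *\<^sub>R matpow A k) = matrix_series c A 1"
proof -
  have "(\<Sum>k. c k *\<^sub>R matpow A k) $ i $ j = (\<Sum>k. (c k *\<^sub>R matpow A k) $ i $ j)" for i j
    by (rule bounded_linear.suminf[OF bounded_linear_compose[OF bounded_linear_vec_nth[of j] bounded_linear_vec_nth[of i]]
        summable_matpow_series(1)[OF assms]])
  then show ?thesis by (simp add: matrix_series_def vec_eq_iff scaleR_conv_of_real[where 'a = complex])
qed

lemma matrix_series_mult_left:
  assumes "entire_coeffs c"
  shows "(B ** matrix_series c A x) $ i $ j = (\<Sum>k. (of_real (c k) * (B ** matpow A k) $ i $ j) * x ^ k)"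
proof -
  have "(B ** matrix_series c A x) $ i $ j = (\<Sum>l\<in>UNIV. \<Sum>k. B $ i $ l * ((of_real (c k) * matpow A k $ l $ j) * x ^ k))"
    unfolding matrix_matrix_mult_def matrix_series_def
    by (simp add: suminf_mult[OF summable_matpow_series(2)[OF assms]])
  also have "\<dots> = (\<Sum>k. \<Sum>l\<in>UNIV. B $ i $ l * ((of_real (c k) * matpow A k $ l $ j) * x ^ k))"
    by (rule suminf_sum[symmetric]) (intro summable_mult summable_matpow_series(2)[OF assms])
  also have "\<dots> = (\<Sum>k. (of_real (c k) * (B ** matpow A k) $ i $ j) * x ^ k)"
    by (simp add: matrix_matrix_mult_def sum_distrib_left sum_distrib_right mult_ac)
  finally show ?thesis .
qed

lemma matrix_series_mult_right:
  assumes "entire_coeffs c"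
  shows "(matrix_series c A x ** B) $ i $ j = (\<Sum>k. (of_real (c k) * (matpow A k ** B) $ i $ j) * x ^ k)"
proof -
  have "(matrix_series c A x ** B) $ i $ j = (\<Sum>l\<in>UNIV. \<Sum>k. ((of_real (c k) * matpow A k $ i $ l) * x ^ k) * B $ l $ j)"
    unfolding matrix_matrix_mult_def matrix_series_def
    by (simp add: suminf_mult2[OF summable_matpow_series(2)[OF assms]])
  also have "\<dots> = (\<Sum>k. \<Sum>l\<in>UNIV. ((of_real (c k) * matpow A k $ i $ l) * x ^ k) * B $ l $ j)"
    by (rule suminf_sum[symmetric]) (intro summable_mult2 summable_matpow_series(2)[OF assms])
  also have "\<dots> = (\<Sum>k. (of_real (c k) * (matpow A k ** B) $ i $ j) * x ^ k)"
    by (simp add: matrix_matrix_mult_def sum_distrib_left sum_distrib_right mult_ac)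
  finally show ?thesis .
qed

lemma matrix_series_commutes:
  assumes c: "entire_coeffs c" and B: "B ** A = A ** B"
  shows "B ** matrix_series c A x = matrix_series c A x ** B"
  by (simp add: vec_eq_iff matrix_series_mult_left[OF c] matrix_series_mult_right[OF c] matpow_commutes[OF B])

lemma DERIV_matrix_series:
  assumes c: "entire_coeffs c" and d: "entire_coeffs (diffs c)"
  shows "((\<lambda>x. matrix_series c A x $ i $ j) has_field_derivative (A ** matrix_series (diffs c) A x) $ i $ j) (at x)"
proof -
  have "diffs (\<lambda>k. of_real (c k) * matpow A k $ i $ j) k = of_real (diffs c k) * (A ** matpow A k) $ i $ j" for k
    by (simp add: diffs_def matpow_Suc)
  then show ?thesis
    using termdiffs_strong_converges_everywhere[OF summable_matpow_series(2)[OF c, of A i j], of x]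
    by (simp add: matrix_series_mult_left[OF d]) (simp add: matrix_series_def)
qed

text \<open>With \<open>C\<close> and \<open>S\<close> for the cosine and sine of \<open>x A\<close>, the derivative of \<open>C\<^sup>2 + S\<^sup>2\<close> with respect to \<open>x\<close>
  is \<open>- A S C - C A S + A C S + S A C\<close>, which vanishes because \<open>A\<close>, \<open>C\<close> and \<open>S\<close> commute.\<close>

lemma mcos_msin:
  fixes A :: "complex^'n^'n"
  shows mcos_msin_commute: "mcos A ** msin A = msin A ** mcos A"
    and mcos_msin_squares: "mcos A ** mcos A + msin A ** msin A = mat 1"
proof -
  let ?C = "matrix_series cos_coeff A" and ?S = "matrix_series sin_coeff A"
  note e = entire_coeffs_trig
  have CS: "mcos A = ?C 1" "msin A = ?S 1"
    by (simp_all add: mcos_def msin_def suminf_matpow e)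
  have AC: "A ** ?C x = ?C x ** A" and AS: "A ** ?S x = ?S x ** A" for x
    by (simp_all add: matrix_series_commutes e)
  have comm: "?C x ** ?S x = ?S x ** ?C x" for x
    by (rule matrix_series_commutes[OF e(2)]) (simp add: AC)
  then show "mcos A ** msin A = msin A ** mcos A" by (simp add: CS)
  have minus: "matrix_series (\<lambda>k. - sin_coeff k) A x = - ?S x" for x
    using suminf_minus[OF summable_matpow_series(2)[OF e(2), of A]]
    by (simp add: matrix_series_def vec_eq_iff)
  have dC: "((\<lambda>x. ?C x $ i $ j) has_field_derivative (- (A ** ?S x)) $ i $ j) (at x)" for i j x
    using DERIV_matrix_series[OF e(1), of A i j x] unfolding diffs_cos_coeff
    by (simp add: e minus matrix_mult_uminus_right)
  have dS: "((\<lambda>x. ?S x $ i $ j) has_field_derivative (A ** ?C x) $ i $ j) (at x)" for i j x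
    using DERIV_matrix_series[OF e(2), of A i j x] unfolding diffs_sin_coeff by (simp add: e)
  define E where "E x = ?C x ** ?C x + ?S x ** ?S x" for x
  have dE: "((\<lambda>x. E x $ i $ j) has_field_derivative 0) (at x)" for i j x
  proof -
    let ?C' = "- (A ** ?S x)" and ?S' = "A ** ?C x"
    have "((\<lambda>x. E x $ i $ j) has_field_derivative
        (\<Sum>l\<in>UNIV. ?C' $ i $ l * ?C x $ l $ j + ?C x $ i $ l * ?C' $ l $ j) +
        (\<Sum>l\<in>UNIV. ?S' $ i $ l * ?S x $ l $ j + ?S x $ i $ l * ?S' $ l $ j)) (at x)"
      unfolding E_def vector_add_component matrix_mult_nth[of "matrix_series _ _ _" "matrix_series _ _ _"]
      by (intro DERIV_add DERIV_sum) (auto intro!: DERIV_mult'[THEN DERIV_cong] dC dS simp del: vector_uminus_component)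
    also have "(\<Sum>l\<in>UNIV. ?C' $ i $ l * ?C x $ l $ j + ?C x $ i $ l * ?C' $ l $ j) +
        (\<Sum>l\<in>UNIV. ?S' $ i $ l * ?S x $ l $ j + ?S x $ i $ l * ?S' $ l $ j)
        = (?C' ** ?C x + ?C x ** ?C' + (?S' ** ?S x + ?S x ** ?S')) $ i $ j"
      by (simp only: vector_add_component sum.distrib matrix_mult_nth[of ?C' "?C x"] matrix_mult_nth[of "?C x" ?C']
          matrix_mult_nth[of ?S' "?S x"] matrix_mult_nth[of "?S x" ?S'])
    also have "?C' ** ?C x + ?C x ** ?C' + (?S' ** ?S x + ?S x ** ?S') = 0"
    proof -
      have 1: "?C x ** (A ** ?S x) = A ** ?S x ** ?C x"
        by (metis AC comm matrix_mul_assoc)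
      have 2: "?S x ** (A ** ?C x) = A ** ?S x ** ?C x"
        by (metis AS matrix_mul_assoc)
      have 3: "A ** ?C x ** ?S x = A ** ?S x ** ?C x"
        by (metis comm matrix_mul_assoc)
      show ?thesis by (simp add: matrix_mult_uminus_left matrix_mult_uminus_right 1 2 3)
    qed
    finally show ?thesis by simp
  qed
  have "E 1 $ i $ j = E 0 $ i $ j" for i j
  proof -
    obtain c where "\<And>x. x \<in> UNIV \<Longrightarrow> E x $ i $ j = c"
      using has_field_derivative_zero_constant[of UNIV "\<lambda>x. E x $ i $ j"]
        dE by auto
    then show ?thesis by simp
  qed
  then have "E 1 = E 0" by (simp add: vec_eq_iff)
  moreover have "?C 0 = mat 1" "?S 0 = 0"
    by (simp_all add: matrix_series_def vec_eq_iff powser_zero cos_coeff_def sin_coeff_def)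
  ultimately show "mcos A ** mcos A + msin A ** msin A = mat 1"
    by (simp add: E_def CS)
qed

lemma ctrans_matpow: "ctrans A = A \<Longrightarrow> ctrans (matpow A k) = matpow A k"
  by (induction k) (simp_all add: ctrans_mat matpow_Suc ctrans_mult matpow_commutes)

lemma bounded_linear_ctrans: "bounded_linear (ctrans :: complex^'n^'m \<Rightarrow> _)"
  unfolding linear_conv_bounded_linear[symmetric] by (rule linearI) (simp_all add: vec_eq_iff)

lemma ctrans_mcos: "ctrans A = A \<Longrightarrow> ctrans (mcos A) = mcos A"
  and ctrans_msin: "ctrans A = A \<Longrightarrow> ctrans (msin A) = msin A"
  unfolding mcos_def msin_def
  using bounded_linear.suminf[OF bounded_linear_ctrans summable_matpow_series(1)[OF entire_coeffs_trig(1), of A]]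
    bounded_linear.suminf[OF bounded_linear_ctrans summable_matpow_series(1)[OF entire_coeffs_trig(2), of A]]
  by (simp_all add: linear_simps[OF bounded_linear_ctrans] ctrans_matpow)

section \<open>Extremal eigenvalues of Hermitian matrices\<close>

text \<open>The quadratic form of \<open>s A\<close> attains its maximum over the unit sphere at an eigenvector. The sign
  of \<open>s\<close> selects the largest or the smallest eigenvalue.\<close>

lemma hermitian_extremal_eigenvalue:
  fixes A :: "complex^'n^'n" and s :: real
  assumes herm: "ctrans A = A" and s: "s \<noteq> 0"
  shows "\<exists>c\<in>eigenvalues A. \<forall>v. s * Re (cdot (A *v v) v) \<le> s * Re c * (norm v)\<^sup>2"
proof -
  interpret A: bounded_linear "(*v) A" by (rule bounded_linear_matrix_vector)
  define q where "q v = s * ((A *v v) \<bullet> v)" for v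
  have sym: "(A *v v) \<bullet> w = v \<bullet> (A *v w)" for v w
    by (simp add: inner_eq_Re_cdot cdot_matrix_left herm)
  have "continuous_on (sphere 0 1) q"
    unfolding q_def by (intro continuous_intros A.continuous_on)
  moreover have "(sphere 0 1 :: (complex^'n) set) \<noteq> {}" by simp
  ultimately obtain v0 where v0: "v0 \<in> sphere 0 1" and max: "\<And>v. v \<in> sphere 0 1 \<Longrightarrow> q v \<le> q v0"
    using continuous_attains_sup[OF compact_sphere] by metis
  define m where "m = q v0"
  have scale: "q (r *\<^sub>R v) = r\<^sup>2 * q v" for r v
    by (simp add: q_def A.scaleR power2_eq_square)
  have le: "q v \<le> m * (norm v)\<^sup>2" for v
  proof (cases "v = 0")
    case False
    have "q (inverse (norm v) *\<^sub>R v) \<le> m" unfolding m_def by (rule max) (use False in simp)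
    then show ?thesis using False by (simp add: scale field_simps)
  qed (simp add: q_def)
  define B where "B v = m *\<^sub>R v - s *\<^sub>R (A *v v)" for v
  have Blin: "B (v + r *\<^sub>R w) = B v + r *\<^sub>R B w" for v w r
    by (simp add: B_def A.add A.scaleR algebra_simps)
  have Bsym: "B v \<bullet> w = v \<bullet> B w" for v w
    by (simp add: B_def inner_diff_left inner_diff_right sym)
  have Bpos: "0 \<le> B v \<bullet> v" for v
    using le[of v] by (simp add: B_def q_def inner_diff_left power2_norm_eq_inner)
  have B0: "B v0 \<bullet> v0 = 0"
    using v0 by (simp add: B_def m_def q_def inner_diff_left power2_norm_eq_inner[symmetric])
  define w where "w = B v0"
  define n k where "n = w \<bullet> w" and "k = B w \<bullet> w"
  have k: "k \<ge> 0" unfolding k_def by (rule Bpos)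
  define t where "t = - n / (k + 1)"
  \<comment> \<open>At a zero of a nonnegative quadratic form the associated linear map vanishes; otherwise moving
    from \<open>v0\<close> against \<open>w\<close> would make the form negative.\<close>
  have "0 \<le> B (v0 + t *\<^sub>R w) \<bullet> (v0 + t *\<^sub>R w)" by (rule Bpos)
  also have "\<dots> = 2 * t * n + t\<^sup>2 * k"
    using B0 Bsym[of w v0]
    by (simp add: Blin inner_add_left inner_add_right n_def k_def w_def[symmetric] power2_eq_square algebra_simps inner_commute)
  also have "\<dots> = - (n\<^sup>2 * (k + 2)) / (k + 1)\<^sup>2"
    using k by (simp add: t_def power2_eq_square divide_simps) (simp add: algebra_simps)
  finally have "n = 0" using k
    by (smt (verit, best) divide_nonneg_pos mult_pos_pos zero_less_divide_iff zero_less_power zero_eq_power2 zero_le_power2 minus_divide_left)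
  then have "w = 0" by (simp add: n_def)
  then have "s *\<^sub>R (A *v v0) = m *\<^sub>R v0" by (simp add: w_def B_def)
  then have "A *v v0 = (m / s) *\<^sub>R v0"
    using s by (metis divide_inverse_commute eq_vector_fraction_iff scaleR_scaleR)
  then have "A *v v0 = complex_of_real (m / s) *s v0"
    by (simp add: vec_eq_iff scaleR_conv_of_real[where 'a = complex])
  moreover have "v0 \<noteq> 0" using v0 by auto
  ultimately have "complex_of_real (m / s) \<in> eigenvalues A" unfolding eigenvalues_def by blast
  moreover have "s * Re (cdot (A *v v) v) \<le> s * Re (complex_of_real (m / s)) * (norm v)\<^sup>2" for v
    using le[of v] s by (simp add: q_def inner_eq_Re_cdot)
  ultimately show ?thesis by blast
qed

lemma eigenvalue_hermitian_real:
  assumes "ctrans A = A" "A *v v = c *s v" "v \<noteq> 0"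
  shows "cnj c = c"
proof -
  have "c * cdot v v = cnj c * cdot v v"
    using cdot_matrix_left[of A v v] assms by (simp add: cdot_scale_left cdot_scale_right)
  moreover have "cdot v v \<noteq> 0" using assms(3) by (simp add: cdot_self)
  ultimately show ?thesis by simp
qed

text \<open>Eigenvectors for different eigenvalues are orthogonal. Finiteness is needed for the extremal
  eigenvalues, being a \<^const>\<open>Max\<close> and a \<^const>\<open>Min\<close>, to bound the others.\<close>

lemma finite_eigenvalues:
  assumes herm: "ctrans A = A" shows "finite (eigenvalues A)"
proof -
  have "\<forall>c\<in>eigenvalues A. \<exists>v. v \<noteq> 0 \<and> A *v v = c *s v" by (simp add: eigenvalues_def)
  then obtain v where v: "\<And>c. c \<in> eigenvalues A \<Longrightarrow> v c \<noteq> 0 \<and> A *v v c = c *s v c" by metis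
  have orth: "cdot (v c) (v d) = 0" if "c \<in> eigenvalues A" "d \<in> eigenvalues A" "c \<noteq> d" for c d
  proof -
    have "c * cdot (v c) (v d) = d * cdot (v c) (v d)"
      using cdot_matrix_left[of A "v c" "v d"] herm v[OF that(1)] v[OF that(2)]
        eigenvalue_hermitian_real[OF herm, of "v d" d] by (simp add: cdot_scale_left cdot_scale_right)
    then show ?thesis using that(3) by simp
  qed
  have inj: "inj_on v (eigenvalues A)"
  proof (rule inj_onI, rule ccontr)
    fix c d assume *: "c \<in> eigenvalues A" "d \<in> eigenvalues A" "v c = v d" "c \<noteq> d"
    from orth[OF *(1,2,4)] *(3) have "v d = 0" by (simp add: cdot_self)
    with v[OF *(2)] show False by simp
  qed
  have "finite (v ` eigenvalues A)"
  proof (rule pairwise_orthogonal_imp_finite)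
    show "pairwise orthogonal (v ` eigenvalues A)"
      unfolding pairwise_def orthogonal_def inner_eq_Re_cdot using orth by (auto, metis zero_complex.sel(1))
  qed
  then show ?thesis using inj by (rule finite_imageD)
qed

lemma cdot_le_max_eigenvalue:
  assumes "ctrans A = A" shows "Re (cdot (A *v v) v) \<le> max_eigenvalue A * (norm v)\<^sup>2"
proof -
  obtain c where c: "c \<in> eigenvalues A" "Re (cdot (A *v v) v) \<le> Re c * (norm v)\<^sup>2"
    using hermitian_extremal_eigenvalue[OF assms, of 1] by auto
  have "Re c \<le> max_eigenvalue A"
    unfolding max_eigenvalue_def using c(1) finite_eigenvalues[OF assms] by (intro Max_ge) auto
  then show ?thesis using c(2) by (meson mult_right_mono order_trans zero_le_power2)
qed

lemma min_eigenvalue_le_cdot: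
  assumes "ctrans A = A" shows "min_eigenvalue A * (norm v)\<^sup>2 \<le> Re (cdot (A *v v) v)"
proof -
  obtain c where c: "c \<in> eigenvalues A" "Re c * (norm v)\<^sup>2 \<le> Re (cdot (A *v v) v)"
    using hermitian_extremal_eigenvalue[OF assms, of "-1"] by auto
  have "min_eigenvalue A \<le> Re c"
    unfolding min_eigenvalue_def using c(1) finite_eigenvalues[OF assms] by (intro Min_le) auto
  then show ?thesis using c(2) by (meson mult_right_mono order_trans zero_le_power2)
qed

section \<open>Square integrable functions on the half-line\<close>

lemma L2_halfD:
  assumes "f \<in> L2_half"
  shows "f \<in> borel_measurable leb_half" "integrable leb_half (\<lambda>x. (norm (f x))\<^sup>2)"
  using assms by (simp_all add: L2_half_def)

text \<open>Closure of \<open>L\<^sup>2\<close> under sums, linear maps, bounded multipliers and changes on null sets is an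
  instance of this comparison.\<close>

lemma L2_half_bounded_by:
  fixes f :: "real \<Rightarrow> 'a::euclidean_space" and g :: "real \<Rightarrow> 'b::euclidean_space"
    and h :: "real \<Rightarrow> 'c::euclidean_space"
  assumes f: "f \<in> borel_measurable leb_half" and g: "g \<in> L2_half" and h: "h \<in> L2_half"
    and le: "AE x in leb_half. norm (f x) \<le> K * (norm (g x) + norm (h x))"
  shows "f \<in> L2_half"
proof -
  have "integrable leb_half (\<lambda>x. (norm (f x))\<^sup>2)"
  proof (rule Bochner_Integration.integrable_bound)
    show "integrable leb_half (\<lambda>x. 2 * K\<^sup>2 * ((norm (g x))\<^sup>2 + (norm (h x))\<^sup>2))"
      using L2_halfD(2)[OF g] L2_halfD(2)[OF h] by simp
    show "(\<lambda>x. (norm (f x))\<^sup>2) \<in> borel_measurable leb_half" using f by measurable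
    show "AE x in leb_half. norm ((norm (f x))\<^sup>2) \<le> norm (2 * K\<^sup>2 * ((norm (g x))\<^sup>2 + (norm (h x))\<^sup>2))"
      using le
    proof eventually_elim
      case (elim x)
      have "(norm (f x))\<^sup>2 \<le> (K * (norm (g x) + norm (h x)))\<^sup>2" using elim by (intro power_mono) auto
      also have "\<dots> = K\<^sup>2 * (norm (g x) + norm (h x))\<^sup>2" by (simp add: power_mult_distrib)
      also have "\<dots> \<le> K\<^sup>2 * (2 * ((norm (g x))\<^sup>2 + (norm (h x))\<^sup>2))"
        using sum_squares_bound[of "norm (g x)" "norm (h x)"]
        by (intro mult_left_mono) (auto simp: power2_sum)
      finally show ?case by (simp add: algebra_simps)
    qed
  qed
  with f show ?thesis by (simp add: L2_half_def)
qed

lemma L2_half_add: "f \<in> L2_half \<Longrightarrow> g \<in> L2_half \<Longrightarrow> (\<lambda>x. f x + g x) \<in> L2_half"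
  by (rule L2_half_bounded_by[of _ f g 1]) (auto intro: L2_halfD norm_triangle_ineq borel_measurable_add)

lemma L2_half_diff: "f \<in> L2_half \<Longrightarrow> g \<in> L2_half \<Longrightarrow> (\<lambda>x. f x - g x) \<in> L2_half"
  by (rule L2_half_bounded_by[of _ f g 1]) (auto intro: L2_halfD norm_triangle_ineq4 borel_measurable_diff)

lemma L2_half_linear:
  fixes f :: "real \<Rightarrow> 'a::euclidean_space" and h :: "'a \<Rightarrow> 'b::euclidean_space"
  assumes h: "bounded_linear h" and f: "f \<in> L2_half"
  shows "(\<lambda>x. h (f x)) \<in> L2_half"
proof -
  obtain K where K: "\<And>x. norm (h x) \<le> norm x * K" using bounded_linear.bounded[OF h] by blast
  show ?thesis
  proof (rule L2_half_bounded_by[OF _ f f])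
    show "(\<lambda>x. h (f x)) \<in> borel_measurable leb_half"
      by (rule borel_measurable_continuous_on[OF _ L2_halfD(1)[OF f]])
        (rule linear_continuous_on[OF h])
    show "AE x in leb_half. norm (h (f x)) \<le> K / 2 * (norm (f x) + norm (f x))"
      using K by (intro AE_I2) (simp add: mult.commute)
  qed
qed

lemma L2_half_cong_AE:
  fixes f g :: "real \<Rightarrow> 'a::euclidean_space"
  assumes f: "f \<in> L2_half" and fg: "AE x in leb_half. f x = g x"
  shows "g \<in> L2_half"
proof (rule L2_half_bounded_by[OF _ f f, where K = 1])
  show "g \<in> borel_measurable leb_half" by (rule borel_measurable_leb_half_cong_AE[OF L2_halfD(1)[OF f] fg])
  show "AE x in leb_half. norm (g x) \<le> 1 * (norm (f x) + norm (f x))" using fg by eventually_elim simp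
qed

lemma L2_half_cong:
  fixes f g :: "real \<Rightarrow> 'a::euclidean_space"
  assumes "f \<in> L2_half" "\<And>x. x \<ge> 0 \<Longrightarrow> f x = g x" shows "g \<in> L2_half"
  by (rule L2_half_cong_AE[OF assms(1)]) (auto intro!: AE_I2 simp: assms(2))

lemma L2_half_sum:
  fixes f :: "'i \<Rightarrow> real \<Rightarrow> 'a::euclidean_space"
  assumes "finite I" "\<And>i. i \<in> I \<Longrightarrow> f i \<in> L2_half"
  shows "(\<lambda>x. \<Sum>i\<in>I. f i x) \<in> L2_half"
  using assms
proof (induction I)
  case empty
  then show ?case by (simp add: L2_half_def)
next
  case (insert i I)
  then show ?case by (simp add: L2_half_add)
qed

lemma matrix_L2_half:
  fixes V :: "real \<Rightarrow> complex^'p^'n"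
  assumes "\<And>j. (\<lambda>x. V x *v axis j 1) \<in> L2_half"
  shows "V \<in> L2_half"
proof -
  define L :: "'p \<Rightarrow> complex^'n \<Rightarrow> complex^'p^'n" where "L j w = (\<chi> i k. if k = j then w $ i else 0)" for j w
  have L: "bounded_linear (L j)" for j
    unfolding linear_conv_bounded_linear[symmetric] by (rule linearI) (auto simp: L_def vec_eq_iff)
  have "V x = (\<Sum>j\<in>UNIV. L j (V x *v axis j 1))" for x
    by (simp add: vec_eq_iff L_def matrix_vector_mult_def axis_def if_distrib[of "\<lambda>a. _ * a"] cong: if_cong)
  moreover have "(\<lambda>x. \<Sum>j\<in>UNIV. L j (V x *v axis j 1)) \<in> L2_half"
    by (intro L2_half_sum L2_half_linear[OF L] assms) auto
  ultimately show ?thesis by simp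
qed

lemma compact_support_L2_half:
  fixes f :: "real \<Rightarrow> 'a::euclidean_space"
  assumes f: "f \<in> borel_measurable leb_half"
    and B: "\<And>x. 0 \<le> x \<Longrightarrow> x \<le> 1 \<Longrightarrow> norm (f x) \<le> B" and zero: "\<And>x. x > 1 \<Longrightarrow> f x = 0"
  shows "f \<in> L2_half"
proof -
  have "integrable leb_half (\<lambda>x. (norm (f x))\<^sup>2)"
  proof (rule Bochner_Integration.integrable_bound)
    show "integrable leb_half (\<lambda>x. indicator {0..1} x * B\<^sup>2)"
      by (intro integrable_mult_left integrable_real_indicator)
        (auto simp: sets_restrict_space_iff emeasure_restrict_space)
    show "(\<lambda>x. (norm (f x))\<^sup>2) \<in> borel_measurable leb_half" using f by measurable
    show "AE x in leb_half. norm ((norm (f x))\<^sup>2) \<le> norm (indicator {0..1} x * B\<^sup>2)"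
    proof (rule AE_I2)
      fix x :: real assume "x \<in> space leb_half"
      then have x: "x \<ge> 0" by simp
      show "norm ((norm (f x))\<^sup>2) \<le> norm (indicator {0..1} x * B\<^sup>2)"
      proof (cases "x \<le> 1")
        case True
        then have "(norm (f x))\<^sup>2 \<le> B\<^sup>2" using B[OF x] by (intro power_mono) auto
        then show ?thesis using x True by simp
      qed (simp add: zero)
    qed
  qed
  with f show ?thesis by (simp add: L2_half_def)
qed

lemma L2_norm_cong_AE:
  fixes f g :: "real \<Rightarrow> 'a::euclidean_space"
  assumes "f \<in> borel_measurable leb_half" "AE x in leb_half. f x = g x"
  shows "L2_norm f = L2_norm g"
proof -
  have "g \<in> borel_measurable leb_half" by (rule borel_measurable_leb_half_cong_AE[OF assms])
  then have "(LINT x|leb_half. (norm (f x))\<^sup>2) = (LINT x|leb_half. (norm (g x))\<^sup>2)"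
    using assms by (intro integral_cong_AE) auto
  then show ?thesis by (simp add: L2_norm_def)
qed

lemma L2_norm_nonneg: "0 \<le> L2_norm f"
  by (simp add: L2_norm_def)

lemma L2_norm_square: "(L2_norm f)\<^sup>2 = (LINT x|leb_half. (norm (f x))\<^sup>2)"
  by (simp add: L2_norm_def)

lemma L2_norm_scale: "L2_norm (\<lambda>x. c *s f x) = norm c * L2_norm f" for f :: "real \<Rightarrow> complex^'n"
  by (simp add: L2_norm_def norm_vector_scale power_mult_distrib real_sqrt_mult)

lemma integrable_L2_product:
  fixes f :: "real \<Rightarrow> 'a::euclidean_space" and g :: "real \<Rightarrow> 'b::euclidean_space"
  assumes f: "f \<in> L2_half" and g: "g \<in> L2_half"
  shows "integrable leb_half (\<lambda>x. norm (f x) * norm (g x))"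
proof (rule Bochner_Integration.integrable_bound)
  show "integrable leb_half (\<lambda>x. (norm (f x))\<^sup>2 + (norm (g x))\<^sup>2)"
    using L2_halfD(2)[OF f] L2_halfD(2)[OF g] by simp
  show "(\<lambda>x. norm (f x) * norm (g x)) \<in> borel_measurable leb_half"
    using L2_halfD(1)[OF f] L2_halfD(1)[OF g] by measurable
  show "AE x in leb_half. norm (norm (f x) * norm (g x)) \<le> norm ((norm (f x))\<^sup>2 + (norm (g x))\<^sup>2)"
  proof (rule AE_I2)
    fix x
    have "2 * (norm (f x) * norm (g x)) \<le> (norm (f x))\<^sup>2 + (norm (g x))\<^sup>2"
      using sum_squares_bound[of "norm (f x)" "norm (g x)"] by simp
    moreover have "0 \<le> norm (f x) * norm (g x)" by simp
    ultimately show "norm (norm (f x) * norm (g x)) \<le> norm ((norm (f x))\<^sup>2 + (norm (g x))\<^sup>2)"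
      unfolding real_norm_def by linarith
  qed
qed

text \<open>The integral of \<open>(t \<bar>f\<bar> - \<bar>g\<bar>)\<^sup>2\<close> is a quadratic polynomial in \<open>t\<close> without negative values.\<close>

lemma L2_Cauchy_Schwarz:
  fixes f :: "real \<Rightarrow> 'a::euclidean_space" and g :: "real \<Rightarrow> 'b::euclidean_space"
  assumes f: "f \<in> L2_half" and g: "g \<in> L2_half"
  shows "(LINT x|leb_half. norm (f x) * norm (g x)) \<le> L2_norm f * L2_norm g"
proof -
  let ?a = "L2_norm f" and ?b = "L2_norm g" and ?I = "LINT x|leb_half. norm (f x) * norm (g x)"
  note i = integrable_L2_product[OF f g] L2_halfD(2)[OF f] L2_halfD(2)[OF g]
  have "0 \<le> t\<^sup>2 * ?a\<^sup>2 - 2 * t * ?I + ?b\<^sup>2" for t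
  proof -
    have "0 \<le> (LINT x|leb_half. (t * norm (f x) - norm (g x))\<^sup>2)" by simp
    also have "\<dots> = (LINT x|leb_half. t\<^sup>2 * (norm (f x))\<^sup>2 - 2 * t * (norm (f x) * norm (g x)) + (norm (g x))\<^sup>2)"
      by (intro Bochner_Integration.integral_cong refl) (simp add: power2_diff power_mult_distrib mult_ac)
    also have "\<dots> = t\<^sup>2 * ?a\<^sup>2 - 2 * t * ?I + ?b\<^sup>2"
      using i by (simp add: L2_norm_square)
    finally show ?thesis .
  qed
  note quad = this
  have I0: "?I \<ge> 0" by simp
  show ?thesis
  proof (cases "?a = 0")
    case True
    show ?thesis
    proof (rule ccontr)
      assume "\<not> ?thesis"
      then have "?I > 0" using True by simp
      \<comment> \<open>The polynomial is affine with negative slope; this is a point beyond its zero.\<close>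
      then show False using quad[of "(?b\<^sup>2 + 1) / (2 * ?I)"] True by (simp add: field_simps)
    qed
  next
    case False
    then have a: "?a > 0" using L2_norm_nonneg[of f] by simp
    have "?I\<^sup>2 \<le> ?a\<^sup>2 * ?b\<^sup>2"
      using quad[of "?I / ?a\<^sup>2"] a by (simp add: field_simps power2_eq_square)
    then have "?I\<^sup>2 \<le> (?a * ?b)\<^sup>2" by (simp add: power_mult_distrib)
    then show ?thesis by (rule power2_le_imp_le) (simp add: L2_norm_nonneg)
  qed
qed

lemma L2_norm_le:
  fixes f :: "real \<Rightarrow> 'a::euclidean_space" and g :: "real \<Rightarrow> 'b::euclidean_space"
  assumes f: "f \<in> L2_half" and g: "g \<in> L2_half"
    and le: "\<And>x. x \<ge> 0 \<Longrightarrow> norm (f x) \<le> K * norm (g x)" and K: "K \<ge> 0"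
  shows "L2_norm f \<le> K * L2_norm g"
proof (rule power2_le_imp_le)
  have "(L2_norm f)\<^sup>2 \<le> (LINT x|leb_half. K\<^sup>2 * (norm (g x))\<^sup>2)"
    unfolding L2_norm_square
  proof (rule integral_mono)
    fix x assume "x \<in> space leb_half"
    then have "(norm (f x))\<^sup>2 \<le> (K * norm (g x))\<^sup>2" using le[of x] by (intro power_mono) auto
    then show "(norm (f x))\<^sup>2 \<le> K\<^sup>2 * (norm (g x))\<^sup>2" by (simp add: power_mult_distrib)
  qed (use L2_halfD(2)[OF f] L2_halfD(2)[OF g] in auto)
  then show "(L2_norm f)\<^sup>2 \<le> (K * L2_norm g)\<^sup>2" by (simp add: power_mult_distrib L2_norm_square)
qed (use K in \<open>simp add: L2_norm_nonneg\<close>)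

lemma L2_norm_add_le:
  fixes f g :: "real \<Rightarrow> 'a::euclidean_space"
  assumes f: "f \<in> L2_half" and g: "g \<in> L2_half"
  shows "L2_norm (\<lambda>x. f x + g x) \<le> L2_norm f + L2_norm g"
proof (rule power2_le_imp_le)
  note i = integrable_L2_product[OF f g] L2_halfD(2)[OF f] L2_halfD(2)[OF g]
  have "(L2_norm (\<lambda>x. f x + g x))\<^sup>2 \<le> (LINT x|leb_half. (norm (f x))\<^sup>2 + 2 * (norm (f x) * norm (g x)) + (norm (g x))\<^sup>2)"
    unfolding L2_norm_square
  proof (rule integral_mono)
    show "integrable leb_half (\<lambda>x. (norm (f x + g x))\<^sup>2)" by (rule L2_halfD(2)[OF L2_half_add[OF f g]])
    show "integrable leb_half (\<lambda>x. (norm (f x))\<^sup>2 + 2 * (norm (f x) * norm (g x)) + (norm (g x))\<^sup>2)"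
      using i by simp
    fix x
    have "(norm (f x + g x))\<^sup>2 \<le> (norm (f x) + norm (g x))\<^sup>2"
      by (intro power_mono norm_triangle_ineq) auto
    then show "(norm (f x + g x))\<^sup>2 \<le> (norm (f x))\<^sup>2 + 2 * (norm (f x) * norm (g x)) + (norm (g x))\<^sup>2"
      by (simp add: power2_sum algebra_simps)
  qed
  also have "\<dots> = (L2_norm f)\<^sup>2 + 2 * (LINT x|leb_half. norm (f x) * norm (g x)) + (L2_norm g)\<^sup>2"
    using i by (simp add: L2_norm_square)
  also have "\<dots> \<le> (L2_norm f + L2_norm g)\<^sup>2"
    using L2_Cauchy_Schwarz[OF f g] by (simp add: power2_sum)
  finally show "(L2_norm (\<lambda>x. f x + g x))\<^sup>2 \<le> (L2_norm f + L2_norm g)\<^sup>2" .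
qed (simp add: L2_norm_nonneg)

lemma AE_zero_of_integral_square:
  fixes f :: "real \<Rightarrow> complex^'n"
  assumes f: "f \<in> L2_half" and "(LINT x|leb_half. (norm (f x))\<^sup>2) \<le> 0"
  shows "AE x in leb_half. f x = 0"
proof -
  have "(LINT x|leb_half. (norm (f x))\<^sup>2) = 0" using assms(2) by (simp add: order_antisym)
  then have "AE x in leb_half. (norm (f x))\<^sup>2 = 0"
    using integral_nonneg_eq_0_iff_AE[OF L2_halfD(2)[OF f]] by simp
  then show ?thesis by simp
qed

lemma borel_measurable_bilinear:
  fixes h :: "'a::euclidean_space \<Rightarrow> 'b::euclidean_space \<Rightarrow> 'c::euclidean_space"
  assumes h: "bounded_bilinear h" and "f \<in> borel_measurable M" "g \<in> borel_measurable M"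
  shows "(\<lambda>x. h (f x) (g x)) \<in> borel_measurable M"
  by (rule borel_measurable_continuous_Pair[OF assms(2,3)])
    (intro bounded_bilinear.continuous_on[OF h] continuous_intros)

lemma integrable_cdot:
  assumes f: "f \<in> L2_half" and g: "g \<in> L2_half"
  shows "integrable leb_half (\<lambda>x. cdot (f x) (g x))"
proof (rule Bochner_Integration.integrable_bound[OF integrable_L2_product[OF f g]])
  show "(\<lambda>x. cdot (f x) (g x)) \<in> borel_measurable leb_half"
    by (rule borel_measurable_bilinear[OF bounded_bilinear_cdot L2_halfD(1)[OF f] L2_halfD(1)[OF g]])
qed (simp add: norm_cdot_le)

lemma norm_integral_cdot_le:
  assumes f: "f \<in> L2_half" and g: "g \<in> L2_half"
  shows "norm (LINT x|leb_half. cdot (f x) (g x)) \<le> L2_norm f * L2_norm g"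
proof -
  have "norm (LINT x|leb_half. cdot (f x) (g x)) \<le> (LINT x|leb_half. norm (cdot (f x) (g x)))"
    by (rule integral_norm_bound)
  also have "\<dots> \<le> (LINT x|leb_half. norm (f x) * norm (g x))"
    by (intro integral_mono integrable_norm integrable_cdot integrable_L2_product f g) (simp add: norm_cdot_le)
  also have "\<dots> \<le> L2_norm f * L2_norm g" by (rule L2_Cauchy_Schwarz[OF f g])
  finally show ?thesis .
qed

lemma matrix_has_bochner_integral:
  fixes F :: "real \<Rightarrow> complex^'m^'n"
  assumes "\<And>i j. has_bochner_integral M (\<lambda>x. F x $ i $ j) (I $ i $ j)"
  shows "has_bochner_integral M F I"
proof -
  define L :: "'n \<Rightarrow> 'm \<Rightarrow> complex \<Rightarrow> complex^'m^'n"
    where "L i j c = (\<chi> k l. if k = i \<and> l = j then c else 0)" for i j c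
  have L: "bounded_linear (L i j)" for i j
    unfolding linear_conv_bounded_linear[symmetric] by (rule linearI) (auto simp: L_def vec_eq_iff)
  have expand: "A = (\<Sum>i\<in>UNIV. \<Sum>j\<in>UNIV. L i j (A $ i $ j))" for A
  proof -
    have "(\<Sum>i\<in>UNIV. \<Sum>j\<in>UNIV. L i j (A $ i $ j)) $ k $ l = A $ k $ l" for k l
    proof -
      have "(\<Sum>i\<in>UNIV. \<Sum>j\<in>UNIV. L i j (A $ i $ j)) $ k $ l
          = (\<Sum>i\<in>UNIV. \<Sum>j\<in>UNIV. if k = i then (if l = j then A $ i $ j else 0) else 0)"
        by (simp add: L_def if_distrib cong: if_cong) (intro sum.cong refl, simp)
      also have "\<dots> = (\<Sum>i\<in>UNIV. if k = i then A $ i $ l else 0)"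
        by (intro sum.cong refl) simp
      finally show ?thesis by simp
    qed
    then show ?thesis by (simp add: vec_eq_iff)
  qed
  have "has_bochner_integral M (\<lambda>x. \<Sum>i\<in>UNIV. \<Sum>j\<in>UNIV. L i j (F x $ i $ j))
      (\<Sum>i\<in>UNIV. \<Sum>j\<in>UNIV. L i j (I $ i $ j))"
    by (intro has_bochner_integral_sum has_bochner_integral_bounded_linear[OF L] assms)
  then show ?thesis unfolding expand[symmetric] .
qed

text \<open>An integrable function that has a limit at infinity has the limit \<open>0\<close>; so the boundary term at
  infinity of an integration by parts drops out as soon as it is integrable itself.\<close>

lemma has_bochner_integral_derivative_half_line:
  fixes F :: "real \<Rightarrow> complex"
  assumes F: "integrable leb_half F" and F': "integrable leb_half F'"
    and FTC: "\<And>b. b \<ge> 0 \<Longrightarrow> integral {0..b} F' = F b - F 0"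
  shows "has_bochner_integral leb_half F' (- F 0)"
proof -
  define I where "I = (LINT x|leb_half. F' x)"
  have si: "set_integrable lebesgue {0..} F'" using F' by (simp add: set_integrable_def integrable_restrict_space)
  have lim1: "((\<lambda>b. LINT x:{0..b}|lebesgue. F' x) \<longlongrightarrow> (LINT x:{0..}|lebesgue. F' x)) at_top"
    by (rule tendsto_set_lebesgue_integral_at_top[OF _ si]) auto
  have I: "(LINT x:{0..}|lebesgue. F' x) = I"
    unfolding I_def set_lebesgue_integral_def by (subst integral_restrict_space) auto
  have "(LINT x:{0..b}|lebesgue. F' x) = F b - F 0" if "b \<ge> 0" for b
  proof -
    have "set_integrable lebesgue {0..b} F'" by (rule set_integrable_subset[OF si]) auto
    then show ?thesis using FTC[OF that] by (simp add: set_lebesgue_integral_eq_integral(2))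
  qed
  then have "eventually (\<lambda>b. (LINT x:{0..b}|lebesgue. F' x) = F b - F 0) at_top"
    using eventually_ge_at_top[of "0::real"] by (rule eventually_mono[rotated])
  then have "((\<lambda>b. F b - F 0) \<longlongrightarrow> I) at_top" by (rule Lim_transform_eventually[OF lim1[unfolded I]])
  from tendsto_add[OF this tendsto_const[of "F 0"]] have lim: "(F \<longlongrightarrow> I + F 0) at_top" by simp
  have "I + F 0 = 0"
  proof (rule ccontr)
    define l where "l = norm (I + F 0)"
    assume "I + F 0 \<noteq> 0"
    then have l: "l > 0" by (simp add: l_def)
    have "((\<lambda>b. norm (F b)) \<longlongrightarrow> l) at_top" unfolding l_def by (rule tendsto_norm[OF lim])
    then have "eventually (\<lambda>b. norm (F b) > l / 2) at_top" by (rule order_tendstoD) (use l in simp)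
    then obtain R where R: "\<And>b. b \<ge> R \<Longrightarrow> norm (F b) > l / 2" unfolding eventually_at_top_linorder by blast
    define S where "S = max 0 R"
    \<comment> \<open>Over an interval of this length, integration of \<open>l / 2\<close> exceeds the integral of \<open>\<bar>F\<bar>\<close>.\<close>
    define T where "T = 2 * (LINT x|leb_half. norm (F x)) / l + 1"
    have "(LINT x|leb_half. norm (F x)) \<ge> 0" by simp
    then have T: "T > 0" using l unfolding T_def by (simp add: add_nonneg_pos)
    have fm: "emeasure leb_half {S..S + T} = ennreal T"
      using T by (subst emeasure_restrict_space) (auto simp: S_def)
    have "T * (l / 2) = (LINT x|leb_half. indicator {S..S + T} x * (l / 2))"
    proof -
      have "max S 0 = S" by (simp add: S_def)
      then show ?thesis using fm T by (simp add: measure_def)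
    qed
    also have "\<dots> \<le> (LINT x|leb_half. norm (F x))"
    proof (rule integral_mono)
      show "integrable leb_half (\<lambda>x. indicator {S..S + T} x * (l / 2))"
        using fm by (intro integrable_mult_left integrable_real_indicator)
          (auto simp: sets_restrict_space_iff S_def)
      show "integrable leb_half (\<lambda>x. norm (F x))" using F by simp
      fix x show "indicator {S..S + T} x * (l / 2) \<le> norm (F x)"
        using R[of x] by (auto simp: indicator_def S_def)
    qed
    finally have "l * l \<le> 0" using l by (simp add: T_def field_simps)
    moreover have "l * l > 0" using l by simp
    ultimately show False by simp
  qed
  then have "I = - F 0" by (simp add: eq_neg_iff_add_eq_0)
  then show ?thesis using F' by (simp add: has_bochner_integral_iff I_def)
qed

section \<open>Uniqueness for linear initial value problems\<close>

text \<open>Where \<open>y\<close> vanishes at the left end of an interval over which the integral of \<open>a\<close> is less than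
  \<open>1/2\<close>, the maximum of \<open>\<bar>y\<bar>\<close> on it is at most half of itself. Finitely many such intervals lead from
  \<open>0\<close> to \<open>t\<close>.\<close>

lemma AC_loc_half_gronwall:
  fixes y :: "real \<Rightarrow> 'a::euclidean_space"
  assumes y: "y \<in> AC_loc_half" and y0: "y 0 = 0"
    and a: "\<And>b. b \<ge> 0 \<Longrightarrow> a integrable_on {0..b}"
    and le: "AE x in leb_half. norm (vector_derivative y (at x)) \<le> a x * norm (y x)"
    and a0: "\<And>x. a x \<ge> 0" and "t \<ge> 0"
  shows "y t = 0"
proof -
  define b where "b = t"
  have b: "b \<ge> 0" using \<open>t \<ge> 0\<close> by (simp add: b_def)
  \<comment> \<open>The derivative, changed on a null set so that the estimate holds at every point.\<close>
  define g where "g x = (if norm (vector_derivative y (at x)) \<le> a x * norm (y x)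
      then vector_derivative y (at x) else 0)" for x
  have g_le: "norm (g x) \<le> a x * norm (y x)" for x using a0[of x] by (simp add: g_def)
  have g: "AE x in leb_half. (y has_vector_derivative g x) (at x)"
    using AC_loc_half_differentiable[OF y] le by eventually_elim (simp add: g_def)
  define A where "A t = integral {0..t} a" for t
  have "uniformly_continuous_on {0..b} A"
    unfolding A_def using indefinite_integral_continuous_1[OF a[OF b]]
    by (intro compact_uniformly_continuous) auto
  then obtain d where d: "d > 0" "\<And>s t. s \<in> {0..b} \<Longrightarrow> t \<in> {0..b} \<Longrightarrow> dist t s < d \<Longrightarrow> dist (A t) (A s) < 1/2"
    unfolding uniformly_continuous_on_def by (metis half_gt_zero zero_less_one)
  have step: "\<forall>x\<in>{s..e}. y x = 0" if s: "0 \<le> s" "s \<le> e" "e \<le> b" "e - s < d" "y s = 0" for s e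
  proof -
    have "continuous_on {s..e} (\<lambda>x. norm (y x))"
      using AC_loc_half_continuous_on[OF y] s by (intro continuous_intros) (auto intro: continuous_on_subset)
    then obtain t0 where t0: "t0 \<in> {s..e}" "\<And>x. x \<in> {s..e} \<Longrightarrow> norm (y x) \<le> norm (y t0)"
      using continuous_attains_sup[of "{s..e}" "\<lambda>x. norm (y x)"] s(2) compact_Icc by (metis atLeastatMost_empty_iff2 not_le)
    define M where "M = norm (y t0)"
    have ai: "a integrable_on {s..t0}"
      by (rule integrable_on_subinterval[OF a[OF b]]) (use s t0 in auto)
    have gi: "g absolutely_integrable_on {s..t0}" "integral {s..t0} g = y t0 - y s"
      using AC_loc_half_integral[OF y g] s t0 by auto
    have "M = norm (integral {s..t0} g)" using gi(2) s by (simp add: M_def)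
    also have "\<dots> \<le> integral {s..t0} (\<lambda>x. a x * M)"
    proof (rule integral_norm_bound_integral)
      show "g integrable_on {s..t0}" using gi(1) by (rule set_lebesgue_integral_eq_integral(1))
      show "(\<lambda>x. a x * M) integrable_on {s..t0}" by (rule integrable_on_mult_left[OF ai])
      fix x assume "x \<in> {s..t0}"
      then have "norm (y x) \<le> M" unfolding M_def using t0 by auto
      then show "norm (g x) \<le> a x * M" using g_le[of x] a0[of x] by (meson mult_left_mono order_trans)
    qed
    also have "\<dots> = (A t0 - A s) * M"
    proof -
      have "a integrable_on {0..t0}" by (rule integrable_on_subinterval[OF a[OF b]]) (use s t0 in auto)
      then have "integral {0..s} a + integral {s..t0} a = integral {0..t0} a"
        using s t0 by (intro Henstock_Kurzweil_Integration.integral_combine) auto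
      then show ?thesis by (simp add: A_def)
    qed
    also have "\<dots> \<le> 1/2 * M"
    proof (rule mult_right_mono)
      have "dist (A t0) (A s) < 1/2" by (rule d(2)) (use s t0 in \<open>auto simp: dist_real_def\<close>)
      then show "A t0 - A s \<le> 1/2" unfolding dist_real_def by linarith
    qed (simp add: M_def)
    finally have "M = 0" using norm_ge_zero[of "y t0"] unfolding M_def[symmetric] by simp
    then have "norm (y x) \<le> 0" if "x \<in> {s..e}" for x using t0(2)[OF that] unfolding M_def by simp
    then show ?thesis by simp
  qed
  have "\<forall>x\<in>{0..min b (real n * (d / 2))}. y x = 0" for n
  proof (induction n)
    case 0
    then show ?case using y0 b by auto
  next
    case (Suc n)
    let ?s = "min b (real n * (d / 2))" and ?e = "min b (real (Suc n) * (d / 2))"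
    have "?s \<in> {0..?s}" using b d(1) by auto
    then have "y ?s = 0" using Suc by blast
    then have "\<forall>x\<in>{?s..?e}. y x = 0"
      using b d(1) by (intro step) (auto simp: min_def algebra_simps)
    moreover have "x \<in> {0..?s} \<or> x \<in> {?s..?e}" if "x \<in> {0..?e}" for x using that by auto
    ultimately show ?case using Suc by blast
  qed
  note zero = this
  obtain n where "b < real n * (d / 2)" using reals_Archimedean3[of "d / 2"] d(1) half_gt_zero by blast
  then have "b \<in> {0..min b (real n * (d / 2))}" using b by simp
  then show ?thesis using zero b_def by blast
qed

section \<open>The Dirac expression\<close>

definition vector_solution ::
    "(real \<Rightarrow> complex^('p::finite + 'p)^('p + 'p)) \<Rightarrow> complex \<Rightarrow> (real \<Rightarrow> complex^('p + 'p)) \<Rightarrow> bool"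
  where "vector_solution Q z y \<longleftrightarrow> y \<in> AC_loc_half \<and> (AE x in leb_half. dirac Q y x = z *s y x)"

lemma dirac_linear:
  assumes y: "y \<in> AC_loc_half" and u: "u \<in> AC_loc_half"
  shows "AE x in leb_half. dirac Q (\<lambda>x. y x + u x) x = dirac Q y x + dirac Q u x"
    and "AE x in leb_half. dirac Q (\<lambda>x. y x - u x) x = dirac Q y x - dirac Q u x"
    and "AE x in leb_half. dirac Q (\<lambda>x. c *s y x) x = c *s dirac Q y x"
proof -
  note d = AC_loc_half_differentiable[OF y] AC_loc_half_differentiable[OF u]
  show "AE x in leb_half. dirac Q (\<lambda>x. y x + u x) x = dirac Q y x + dirac Q u x"
    using d
  proof eventually_elim
    case (elim x)
    show ?case unfolding dirac_def vector_derivative_at[OF has_vector_derivative_add[OF elim]]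
      by (simp add: matrix_vector_right_distrib)
  qed
  show "AE x in leb_half. dirac Q (\<lambda>x. y x - u x) x = dirac Q y x - dirac Q u x"
    using d
  proof eventually_elim
    case (elim x)
    show ?case unfolding dirac_def vector_derivative_at[OF has_vector_derivative_diff[OF elim]]
      by (simp add: matrix_vector_mult_diff_distrib)
  qed
  show "AE x in leb_half. dirac Q (\<lambda>x. c *s y x) x = c *s dirac Q y x"
    using d(1)
  proof eventually_elim
    case (elim x)
    show ?case
      unfolding dirac_def
        vector_derivative_at[OF bounded_linear.has_vector_derivative[OF bounded_linear_vector_scale elim]]
      by (simp add: matrix_vector_scale vector_scale_add_right)
  qed
qed

lemma AC_loc_half_scale: "y \<in> AC_loc_half \<Longrightarrow> (\<lambda>x. c *s y x) \<in> AC_loc_half" for y :: "real \<Rightarrow> complex^'n"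
  by (rule AC_loc_half_linear[OF bounded_linear_vector_scale])

lemma vector_solution_add:
  assumes "vector_solution Q z y" "vector_solution Q z u"
  shows "vector_solution Q z (\<lambda>x. y x + u x)"
proof -
  have ac: "y \<in> AC_loc_half" "u \<in> AC_loc_half" using assms by (auto simp: vector_solution_def)
  have "AE x in leb_half. dirac Q (\<lambda>x. y x + u x) x = z *s (y x + u x)"
    using dirac_linear(1)[OF ac, of Q] assms[unfolded vector_solution_def, THEN conjunct2]
    by eventually_elim (simp add: vector_scale_add_right)
  with ac show ?thesis by (simp add: vector_solution_def AC_loc_half_add)
qed

lemma vector_solution_diff:
  assumes "vector_solution Q z y" "vector_solution Q z u"
  shows "vector_solution Q z (\<lambda>x. y x - u x)"
proof -
  have ac: "y \<in> AC_loc_half" "u \<in> AC_loc_half" using assms by (auto simp: vector_solution_def)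
  have "AE x in leb_half. dirac Q (\<lambda>x. y x - u x) x = z *s (y x - u x)"
    using dirac_linear(2)[OF ac, of Q] assms[unfolded vector_solution_def, THEN conjunct2]
    by eventually_elim (simp add: vector_scale_diff_right)
  with ac show ?thesis by (simp add: vector_solution_def AC_loc_half_diff)
qed

lemma matrix_solution_imp_vector_solution:
  assumes "matrix_solution Q z Y"
  shows "vector_solution Q z (\<lambda>x. Y x *v c)"
  unfolding vector_solution_def
proof
  have Y: "Y \<in> AC_loc_half"
    and eq: "AE x in leb_half. Jmat ** vector_derivative Y (at x) + Q x ** Y x = mat z ** Y x"
    using assms by (auto simp: matrix_solution_def)
  show "(\<lambda>x. Y x *v c) \<in> AC_loc_half" by (rule AC_loc_half_linear[OF bounded_linear_matrix_vector_left Y])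
  show "AE x in leb_half. dirac Q (\<lambda>x. Y x *v c) x = z *s (Y x *v c)"
    using AC_loc_half_differentiable[OF Y] eq
  proof eventually_elim
    case (elim x)
    have "dirac Q (\<lambda>x. Y x *v c) x = (Jmat ** vector_derivative Y (at x) + Q x ** Y x) *v c"
      unfolding dirac_def
        vector_derivative_at[OF bounded_linear.has_vector_derivative[OF bounded_linear_matrix_vector_left elim(1)]]
      by (simp add: matrix_vector_mul_assoc matrix_vector_mult_add_rdistrib)
    also have "\<dots> = z *s (Y x *v c)"
      unfolding elim(2) by (simp add: matrix_vector_mul_assoc[symmetric] mat_mult_vec)
    finally show ?case .
  qed
qed

lemma matrix_solution_add:
  assumes "matrix_solution Q z Y" "matrix_solution Q z U"
  shows "matrix_solution Q z (\<lambda>x. Y x + U x)"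
proof -
  have ac: "Y \<in> AC_loc_half" "U \<in> AC_loc_half" using assms by (auto simp: matrix_solution_def)
  have "AE x in leb_half. Jmat ** vector_derivative (\<lambda>x. Y x + U x) (at x) + Q x ** (Y x + U x) = mat z ** (Y x + U x)"
    using AC_loc_half_differentiable[OF ac(1)] AC_loc_half_differentiable[OF ac(2)]
      assms[unfolded matrix_solution_def, THEN conjunct2]
  proof eventually_elim
    case (elim x)
    show ?case unfolding vector_derivative_at[OF has_vector_derivative_add[OF elim(1,2)]]
      using elim(3,4) by (simp add: matrix_mult_add_right algebra_simps)
  qed
  with ac show ?thesis by (simp add: matrix_solution_def AC_loc_half_add)
qed

lemma matrix_solution_mult:
  assumes "matrix_solution Q z Y"
  shows "matrix_solution Q z (\<lambda>x. Y x ** M)"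
proof -
  note bl = bounded_bilinear.bounded_linear_left[OF bounded_bilinear_matrix_mult, of M]
  have ac: "Y \<in> AC_loc_half" using assms by (auto simp: matrix_solution_def)
  have "AE x in leb_half. Jmat ** vector_derivative (\<lambda>x. Y x ** M) (at x) + Q x ** (Y x ** M) = mat z ** (Y x ** M)"
    using AC_loc_half_differentiable[OF ac] assms[unfolded matrix_solution_def, THEN conjunct2]
  proof eventually_elim
    case (elim x)
    show ?case unfolding vector_derivative_at[OF bounded_linear.has_vector_derivative[OF bl elim(1)]]
      using elim(2) by (simp add: matrix_mul_assoc matrix_mult_add_left[symmetric])
  qed
  with AC_loc_half_linear[OF bl ac] show ?thesis by (simp add: matrix_solution_def)
qed

text \<open>Values left of the origin do not matter, although derivatives are two-sided: they only enter
  at the origin, a null set.\<close>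

lemma matrix_solution_cong:
  assumes Y: "matrix_solution Q z Y" and eq: "\<And>x. x \<ge> 0 \<Longrightarrow> U x = Y x"
  shows "matrix_solution Q z U"
proof -
  have Yac: "Y \<in> AC_loc_half"
    and AE: "AE x in leb_half. Jmat ** vector_derivative Y (at x) + Q x ** Y x = mat z ** Y x"
    using Y by (auto simp: matrix_solution_def)
  have "abs_continuous_on 0 b U" if "b \<ge> 0" for b
  proof -
    have b: "abs_continuous_on 0 b Y" using Yac that by (simp add: AC_loc_half_def)
    show ?thesis by (rule abs_continuous_on_dominated[OF b b, where K = 1]) (simp add: eq)
  qed
  then have "U \<in> AC_loc_half" by (simp add: AC_loc_half_def)
  moreover have "AE x in leb_half. x \<noteq> 0"
    unfolding AE_leb_half_iff by (rule AE_I'[of "{0}"]) (auto simp flip: negligible_iff_null_sets)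
  then have "AE x in leb_half. Jmat ** vector_derivative U (at x) + Q x ** U x = mat z ** U x"
    using AC_loc_half_differentiable[OF Yac] AE AE_space[of leb_half]
  proof eventually_elim
    case (elim x)
    then have x: "x > 0" by simp
    have "(U has_vector_derivative vector_derivative Y (at x)) (at x)"
      by (rule has_vector_derivative_transform_within_open[OF elim(2), of "{0<..}"]) (use x eq in auto)
    from vector_derivative_at[OF this] elim(3) x show ?case by (simp add: eq)
  qed
  ultimately show ?thesis by (simp add: matrix_solution_def)
qed

text \<open>The derivative of \<open>x \<mapsto> \<langle>J y(x), u(x)\<rangle>\<close>, written through the Dirac expressions of \<open>y\<close> and
  \<open>u\<close>: only the imaginary part of the potential survives.\<close>

definition lagrange_form ::
    "(real \<Rightarrow> complex^('p::finite + 'p)^('p + 'p)) \<Rightarrow> (real \<Rightarrow> complex^('p + 'p)) \<Rightarrow> (real \<Rightarrow> complex^('p + 'p)) \<Rightarrow> real \<Rightarrow> complex"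
  where "lagrange_form Q y u x = cdot (dirac Q y x) (u x) - cdot (y x) (dirac Q u x)
      - 2 * \<i> * cdot (Im_mat (Q x) *v y x) (u x)"

lemma AC_loc_half_cdot_Jmat:
  "y \<in> AC_loc_half \<Longrightarrow> u \<in> AC_loc_half \<Longrightarrow> (\<lambda>x. cdot (Jmat *v y x) (u x)) \<in> AC_loc_half"
  by (rule AC_loc_half_bilinear[OF bounded_bilinear_cdot AC_loc_half_linear[OF bounded_linear_matrix_vector]])

lemma has_vector_derivative_lagrange:
  assumes y: "y \<in> AC_loc_half" and u: "u \<in> AC_loc_half"
  shows "AE x in leb_half. ((\<lambda>x. cdot (Jmat *v y x) (u x)) has_vector_derivative lagrange_form Q y u x) (at x)"
  using AC_loc_half_differentiable[OF y] AC_loc_half_differentiable[OF u]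
proof eventually_elim
  case (elim x)
  let ?y' = "vector_derivative y (at x)" and ?u' = "vector_derivative u (at x)"
  have "((\<lambda>x. cdot (Jmat *v y x) (u x)) has_vector_derivative
      cdot (Jmat *v y x) ?u' + cdot (Jmat *v ?y') (u x)) (at x)"
    by (rule bounded_bilinear.has_vector_derivative[OF bounded_bilinear_cdot
          bounded_linear.has_vector_derivative[OF bounded_linear_matrix_vector elim(1)] elim(2)])
  moreover have "cdot (Jmat *v y x) ?u' + cdot (Jmat *v ?y') (u x) = lagrange_form Q y u x"
    by (simp add: lagrange_form_def dirac_def cdot_add_left cdot_add_right cdot_Jmat_skew cdot_Im_mat)
  ultimately show ?case by simp
qed

lemma lagrange_interval:
  assumes y: "y \<in> AC_loc_half" and u: "u \<in> AC_loc_half" and b: "b \<ge> 0"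
  shows "lagrange_form Q y u absolutely_integrable_on {0..b}"
    and "integral {0..b} (lagrange_form Q y u) = cdot (Jmat *v y b) (u b) - cdot (Jmat *v y 0) (u 0)"
  using AC_loc_half_integral[OF AC_loc_half_cdot_Jmat[OF y u] has_vector_derivative_lagrange[OF y u], of 0 b] b
  by auto

locale dirac_potential =
  fixes Q :: "real \<Rightarrow> complex^('p::finite + 'p)^('p + 'p)"
  assumes Q_loc: "Q \<in> L1_loc_half"
    and Q_bdd: "\<exists>C. \<forall>x\<ge>0. onorm (\<lambda>u. Im_mat (Q x) *v u) \<le> C"
begin

lemma initial_value_unique:
  assumes y: "vector_solution Q z y" and y0: "y 0 = 0" and "t \<ge> 0"
  shows "y t = 0"
proof -
  obtain K where K: "K > 0" "\<And>(A :: complex^('p + 'p)^('p + 'p)) x. norm (A *v x) \<le> K * norm A * norm x"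
    using norm_matrix_vector_le_norm by blast
  show ?thesis
  proof (rule AC_loc_half_gronwall[where y = y and a = "\<lambda>x. norm z + K * norm (Q x)"])
    show "y 0 = 0" by (rule y0)
    show ac: "y \<in> AC_loc_half" using y by (simp add: vector_solution_def)
    fix b :: real assume "b \<ge> 0"
    then have "Q absolutely_integrable_on {0..b}" using Q_loc by (simp add: L1_loc_half_def)
    then have "(\<lambda>x. norm (Q x)) integrable_on {0..b}" by (simp add: absolutely_integrable_on_def)
    then show "(\<lambda>x. norm z + K * norm (Q x)) integrable_on {0..b}"
      by (intro integrable_add integrable_on_mult_right) auto
  next
    have "AE x in leb_half. dirac Q y x = z *s y x" using y by (simp add: vector_solution_def)
    then show "AE x in leb_half. norm (vector_derivative y (at x)) \<le> (norm z + K * norm (Q x)) * norm (y x)"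
    proof eventually_elim
      case (elim x)
      have "norm (vector_derivative y (at x)) = norm (Jmat *v vector_derivative y (at x))"
        by (simp add: norm_Jmat)
      also have "Jmat *v vector_derivative y (at x) = z *s y x - Q x *v y x"
        using elim by (simp add: dirac_def eq_diff_eq)
      also have "norm \<dots> \<le> norm z * norm (y x) + K * norm (Q x) * norm (y x)"
        using K(2)[of "Q x" "y x"] norm_triangle_ineq4[of "z *s y x" "Q x *v y x"]
        by (simp add: norm_vector_scale)
      finally show ?case by (simp add: algebra_simps)
    qed
  next
    fix x show "norm z + K * norm (Q x) \<ge> 0" using K(1) by simp
  qed (rule \<open>t \<ge> 0\<close>)
qed

lemma Im_mat_bound: obtains C where "C \<ge> 0" "\<And>x v. x \<ge> 0 \<Longrightarrow> norm (Im_mat (Q x) *v v) \<le> C * norm v"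
proof -
  obtain C where C: "\<And>x. x \<ge> 0 \<Longrightarrow> onorm (\<lambda>u. Im_mat (Q x) *v u) \<le> C" using Q_bdd by blast
  have "norm (Im_mat (Q x) *v v) \<le> max C 0 * norm v" if "x \<ge> 0" for x v
    using norm_matrix_vector_le[of "Im_mat (Q x)" v] C[OF that]
    by (meson max.coboundedI1 mult_right_mono norm_ge_zero order_trans)
  then show thesis using that[of "max C 0"] by simp
qed

lemma Im_mat_L2_half:
  assumes y: "y \<in> L2_half" shows "(\<lambda>x. Im_mat (Q x) *v y x) \<in> L2_half"
proof -
  have "bounded_linear (Im_mat :: complex^('p + 'p)^('p + 'p) \<Rightarrow> _)"
    unfolding Im_mat_def
    by (rule bounded_linear_compose[OF bounded_bilinear.bounded_linear_right[OF bounded_bilinear_matrix_mult]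
          bounded_linear_sub[OF bounded_linear_ident bounded_linear_ctrans]])
  then have "(\<lambda>x. Im_mat (Q x)) \<in> borel_measurable leb_half"
    by (intro borel_measurable_continuous_on[OF _ borel_measurable_L1_loc_half[OF Q_loc]] linear_continuous_on)
  then have m: "(\<lambda>x. Im_mat (Q x) *v y x) \<in> borel_measurable leb_half"
    by (rule borel_measurable_bilinear[OF bounded_bilinear_matrix_vector _ L2_halfD(1)[OF y]])
  obtain C where C: "C \<ge> 0" "\<And>x v. x \<ge> 0 \<Longrightarrow> norm (Im_mat (Q x) *v v) \<le> C * norm v"
    using Im_mat_bound by blast
  show ?thesis
    by (rule L2_half_bounded_by[OF m y y, where K = "C / 2"]) (auto intro!: AE_I2 simp: C(2))
qed

text \<open>Here the boundedness of the imaginary part of \<open>Q\<close> enters: it makes the Lagrange form integrable,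
  as a sum of products of square integrable functions. The boundary form is such a product
  as well, so there is no contribution from infinity.\<close>

lemma lagrange_half_line:
  assumes y: "y \<in> dom_max Q" and u: "u \<in> dom_max Q"
  shows "has_bochner_integral leb_half (lagrange_form Q y u) (- cdot (Jmat *v y 0) (u 0))"
proof -
  have yu: "y \<in> L2_half" "y \<in> AC_loc_half" "dirac Q y \<in> L2_half"
    "u \<in> L2_half" "u \<in> AC_loc_half" "dirac Q u \<in> L2_half"
    using y u by (auto simp: dom_max_def)
  show ?thesis
  proof (rule has_bochner_integral_derivative_half_line[where F = "\<lambda>x. cdot (Jmat *v y x) (u x)"])
    show "integrable leb_half (\<lambda>x. cdot (Jmat *v y x) (u x))"
      by (intro integrable_cdot L2_half_linear[OF bounded_linear_matrix_vector] yu)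
    show "integrable leb_half (lagrange_form Q y u)"
      unfolding lagrange_form_def
      by (intro Bochner_Integration.integrable_diff integrable_mult_right integrable_cdot Im_mat_L2_half yu)
  qed (rule lagrange_interval(2)[OF yu(2,5)])
qed

lemma L2_solution_dom_max:
  assumes "vector_solution Q z y" "y \<in> L2_half" shows "y \<in> dom_max Q"
proof -
  have "AE x in leb_half. z *s y x = dirac Q y x"
    using assms(1) by (auto simp: vector_solution_def)
  from L2_half_cong_AE[OF L2_half_linear[OF bounded_linear_vector_scale assms(2)] this]
  have "dirac Q y \<in> L2_half" .
  with assms show ?thesis by (simp add: dom_max_def vector_solution_def)
qed

end

section \<open>Weyl solutions\<close>

locale dirac_system = dirac_potential Q
  for Q :: "real \<Rightarrow> complex^('p::finite + 'p)^('p + 'p)" +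
  fixes \<Phi> :: "complex^'p^'p" and \<phi> \<psi> :: "complex \<Rightarrow> real \<Rightarrow> complex^'p^('p + 'p)"
  assumes \<Phi>_herm: "\<Phi> = ctrans \<Phi>"
    and \<phi>_sol: "\<And>z. matrix_solution Q z (\<phi> z)"
    and \<phi>_init: "\<And>z. \<phi> z 0 = stack (- msin \<Phi>) (mcos \<Phi>)"
    and \<psi>_sol: "\<And>z. matrix_solution Q z (\<psi> z)"
    and \<psi>_init: "\<And>z. \<psi> z 0 = stack (mcos \<Phi>) (msin \<Phi>)"
begin

abbreviation "C \<equiv> mcos \<Phi>"
abbreviation "S \<equiv> msin \<Phi>"

lemma cdot_C: "cdot x (C *v y) = cdot (C *v x) y" and cdot_S: "cdot x (S *v y) = cdot (S *v x) y"
  using ctrans_mcos[OF \<Phi>_herm[symmetric]] ctrans_msin[OF \<Phi>_herm[symmetric]]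
  by (simp_all add: cdot_matrix_left)

lemma CS_commute: "C *v (S *v x) = S *v (C *v x)"
  by (simp add: matrix_vector_mul_assoc mcos_msin_commute)

lemma CS_squares: "C *v (C *v x) + S *v (S *v x) = x"
  by (simp add: matrix_vector_mul_assoc mcos_msin_squares flip: matrix_vector_mult_add_rdistrib)

text \<open>The pair of \<open>trace_value\<close> and \<open>dual_value\<close> is the image of an initial value under a matrix that
  is both unitary and symplectic. In these coordinates the boundary condition reads
  \<open>trace_value = 0\<close>, and the solutions \<open>\<psi>\<close> and \<open>\<phi>\<close> start in the first and the second coordinate
  plane.\<close>

definition trace_value :: "complex^('p + 'p) \<Rightarrow> complex^'p"
  where "trace_value a = C *v upper a + S *v lower a"

definition dual_value :: "complex^('p + 'p) \<Rightarrow> complex^'p"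
  where "dual_value a = C *v lower a - S *v upper a"

lemmas mv_simps = matrix_vector_right_distrib matrix_vector_mult_diff_distrib matrix_vector_uminus_right
lemmas cdot_simps = cdot_add_left cdot_add_right cdot_diff_left cdot_diff_right

lemma CS_squares_cdot: "cdot (C *v (C *v x)) y + cdot (S *v (S *v x)) y = cdot x y"
  by (simp only: cdot_add_left[symmetric] CS_squares)

lemma cdot_Jmat_values:
  "cdot (Jmat *v a) b = cdot (trace_value a) (dual_value b) - cdot (dual_value a) (trace_value b)"
proof -
  have "cdot (trace_value a) (dual_value b) - cdot (dual_value a) (trace_value b)
      = (cdot (C *v (C *v upper a)) (lower b) + cdot (S *v (S *v upper a)) (lower b))
      - (cdot (C *v (C *v lower a)) (upper b) + cdot (S *v (S *v lower a)) (upper b))"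
    by (simp add: trace_value_def dual_value_def cdot_simps cdot_C cdot_S mv_simps CS_commute)
  then show ?thesis by (simp add: CS_squares_cdot cdot_Jmat)
qed

lemma norm_values: "(norm a)\<^sup>2 = (norm (trace_value a))\<^sup>2 + (norm (dual_value a))\<^sup>2"
proof -
  have "cdot (trace_value a) (trace_value a) + cdot (dual_value a) (dual_value a)
      = (cdot (C *v (C *v upper a)) (upper a) + cdot (S *v (S *v upper a)) (upper a))
      + (cdot (C *v (C *v lower a)) (lower a) + cdot (S *v (S *v lower a)) (lower a))"
    by (simp add: trace_value_def dual_value_def cdot_simps cdot_C cdot_S mv_simps CS_commute)
  then have "cdot a a = cdot (trace_value a) (trace_value a) + cdot (dual_value a) (dual_value a)"
    by (simp add: CS_squares_cdot cdot_upper_lower[of a a])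
  then have "complex_of_real ((norm a)\<^sup>2) = of_real ((norm (trace_value a))\<^sup>2 + (norm (dual_value a))\<^sup>2)"
    unfolding cdot_self of_real_add .
  then show ?thesis by (simp only: of_real_eq_iff)
qed

lemma values_diff:
  "trace_value (a - b) = trace_value a - trace_value b" "dual_value (a - b) = dual_value a - dual_value b"
  by (simp_all add: trace_value_def dual_value_def upper_diff lower_diff mv_simps)

lemma values_scale: "trace_value (c *s a) = c *s trace_value a" "dual_value (c *s a) = c *s dual_value a"
proof -
  have "upper (c *s a) = c *s upper a" "lower (c *s a) = c *s lower a"
    by (simp_all add: upper_def lower_def vec_eq_iff)
  then show "trace_value (c *s a) = c *s trace_value a" "dual_value (c *s a) = c *s dual_value a"
    by (simp_all add: trace_value_def dual_value_def matrix_vector_scale vector_scale_add_right vector_scale_diff_right)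
qed

definition sol :: "complex \<Rightarrow> complex^'p \<Rightarrow> complex^'p \<Rightarrow> real \<Rightarrow> complex^('p + 'p)"
  where "sol z m e x = \<phi> z x *v m + \<psi> z x *v e"

lemma vector_solution_sol: "vector_solution Q z (sol z m e)"
  unfolding sol_def
  by (intro vector_solution_add matrix_solution_imp_vector_solution \<phi>_sol \<psi>_sol)

lemma AC_sol: "sol z m e \<in> AC_loc_half"
  using vector_solution_sol by (simp add: vector_solution_def)

lemma sol_values: "trace_value (sol z m e 0) = e" "dual_value (sol z m e 0) = m"
proof -
  have "sol z m e 0 = stack (C *v e - S *v m) (C *v m + S *v e)"
    by (simp add: sol_def \<phi>_init \<psi>_init stack_mult_vec stack_add matrix_vector_uminus_left add.commute)
  then show "trace_value (sol z m e 0) = e" "dual_value (sol z m e 0) = m"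
    using CS_squares[of e] CS_squares[of m]
    by (simp_all add: trace_value_def dual_value_def mv_simps CS_commute algebra_simps)
qed

lemma norm_sol_0: "(norm (sol z m e 0))\<^sup>2 = (norm e)\<^sup>2 + (norm m)\<^sup>2"
  by (simp add: norm_values[of "sol z m e 0"] sol_values)

lemma cdot_Jmat_sol_0: "cdot (Jmat *v sol z m e 0) (sol w m' e' 0) = cdot e m' - cdot m e'"
  by (simp add: cdot_Jmat_values sol_values)

lemma vector_solution_eq_sol:
  assumes y: "vector_solution Q z y" and "x \<ge> 0"
  shows "y x = sol z (dual_value (y 0)) (trace_value (y 0)) x"
proof -
  let ?s = "sol z (dual_value (y 0)) (trace_value (y 0))"
  have "(norm (y 0 - ?s 0))\<^sup>2 = 0"
    unfolding norm_values[of "y 0 - ?s 0"] values_diff sol_values by simp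
  then have "y 0 - ?s 0 = 0" by simp
  then have "y x - ?s x = 0"
    by (rule initial_value_unique[OF vector_solution_diff[OF y vector_solution_sol] _ \<open>x \<ge> 0\<close>])
  then show ?thesis by simp
qed

lemma sol_diff: "sol z m e x - sol z m' e' x = sol z (m - m') (e - e') x"
  by (simp add: sol_def mv_simps)

lemma sol_matrix: "(\<phi> z x ** M + \<psi> z x) *v e = sol z (M *v e) e x"
  by (simp add: sol_def matrix_vector_mult_add_rdistrib matrix_vector_mul_assoc)

text \<open>Existence and uniqueness of the Weyl solution, expressed through initial values. This property
  is shared by the points of the resolvent set and by the half-planes where the energy is
  definite.\<close>

definition weyl_regular :: "complex \<Rightarrow> bool"
  where "weyl_regular z \<longleftrightarrow> (\<forall>e. \<exists>m. sol z m e \<in> L2_half) \<and> (\<forall>m. sol z m 0 \<in> L2_half \<longrightarrow> m = 0)"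

text \<open>The columns of \<open>M\<close> are chosen one by one for the unit vectors.\<close>

lemma weyl_matrix_exists:
  assumes "weyl_regular z" shows "\<exists>M. (\<lambda>x. \<phi> z x ** M + \<psi> z x) \<in> L2_half"
proof -
  obtain f where f: "\<And>e. sol z (f e) e \<in> L2_half" using assms unfolding weyl_regular_def by metis
  define M :: "complex^'p^'p" where "M = (\<chi> i j. f (axis j 1) $ i)"
  have "M *v axis j 1 = f (axis j 1)" for j
    by (simp add: vec_eq_iff M_def matrix_vector_mult_def axis_def if_distrib[of "\<lambda>a. _ * a"] cong: if_cong)
  then have "(\<lambda>x. \<phi> z x ** M + \<psi> z x) \<in> L2_half"
    by (intro matrix_L2_half) (simp add: sol_matrix f)
  then show ?thesis by blast
qed

lemma weyl_matrix_unique: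
  assumes z: "weyl_regular z"
    and M: "(\<lambda>x. \<phi> z x ** M + \<psi> z x) \<in> L2_half" and N: "(\<lambda>x. \<phi> z x ** N + \<psi> z x) \<in> L2_half"
  shows "M = N"
proof -
  have "M *v e - N *v e = 0" for e
  proof -
    note L = L2_half_linear[OF bounded_linear_matrix_vector_left[of e]]
    have "(\<lambda>x. sol z (M *v e) e x - sol z (N *v e) e x) \<in> L2_half"
      using L2_half_diff[OF L[OF M] L[OF N]] by (simp add: sol_matrix)
    then have "sol z (M *v e - N *v e) 0 \<in> L2_half" unfolding sol_diff by simp
    then show ?thesis using z unfolding weyl_regular_def by blast
  qed
  then show ?thesis by (simp add: matrix_eq)
qed

text \<open>By uniqueness for initial value problems, a solution that meets the description of the Weyl
  solution is \<open>\<phi> N + \<psi>\<close>, where \<open>N\<close> is the dual value of its initial matrix; square integrability then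
  forces \<open>N = M\<close>.\<close>

lemma weyl_solution_eq:
  assumes z: "weyl_regular z" and M: "(\<lambda>x. \<phi> z x ** M + \<psi> z x) \<in> L2_half"
  shows "weyl_solution Q \<Phi> z = restrict (\<lambda>x. \<phi> z x ** M + \<psi> z x) {0..}"
  unfolding weyl_solution_def
proof (rule the_equality)
  let ?V = "\<lambda>x. \<phi> z x ** M + \<psi> z x" and ?v = "restrict (\<lambda>x. \<phi> z x ** M + \<psi> z x) {0..}"
  have "matrix_solution Q z ?V"
    by (intro matrix_solution_add matrix_solution_mult \<phi>_sol \<psi>_sol)
  then have 1: "matrix_solution Q z ?v" by (rule matrix_solution_cong) simp
  have 2: "?v \<in> L2_half" by (rule L2_half_cong[OF M]) simp
  have "(C ** upper (?v 0) + S ** lower (?v 0)) *v e = e" for e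
  proof -
    have "(C ** upper (?v 0) + S ** lower (?v 0)) *v e = trace_value (?V 0 *v e)"
      by (simp add: trace_value_def matrix_vector_mult_add_rdistrib matrix_vector_mul_assoc upper_mult_vec
          lower_mult_vec upper_add lower_add mv_simps matrix_mult_add_right)
    then show ?thesis by (simp add: sol_matrix sol_values)
  qed
  then have 3: "C ** upper (?v 0) + S ** lower (?v 0) = mat 1" by (simp add: matrix_eq)
  show "?v \<in> extensional {0..} \<and> matrix_solution Q z ?v \<and> ?v \<in> L2_half \<and>
      C ** upper (?v 0) + S ** lower (?v 0) = mat 1"
    using 1 2 3 by simp
  fix v assume v: "v \<in> extensional {0..} \<and> matrix_solution Q z v \<and> v \<in> L2_half \<and>
      C ** upper (v 0) + S ** lower (v 0) = mat 1"
  define N where "N = C ** lower (v 0) - S ** upper (v 0)"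
  have veq: "v x = \<phi> z x ** N + \<psi> z x" if "x \<ge> 0" for x
  proof -
    have "v x *v e = (\<phi> z x ** N + \<psi> z x) *v e" for e
    proof -
      have "v x *v e = sol z (dual_value (v 0 *v e)) (trace_value (v 0 *v e)) x"
        by (rule vector_solution_eq_sol[OF matrix_solution_imp_vector_solution that]) (use v in blast)
      moreover have "trace_value (v 0 *v e) = (C ** upper (v 0) + S ** lower (v 0)) *v e"
        by (simp add: trace_value_def matrix_vector_mult_add_rdistrib matrix_vector_mul_assoc upper_mult_vec lower_mult_vec)
      moreover have "dual_value (v 0 *v e) = N *v e"
        by (simp add: dual_value_def N_def matrix_vector_mult_diff_rdistrib matrix_vector_mul_assoc upper_mult_vec lower_mult_vec)
      ultimately show ?thesis using v by (simp add: sol_matrix)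
    qed
    then show ?thesis by (simp add: matrix_eq)
  qed
  have "(\<lambda>x. \<phi> z x ** N + \<psi> z x) \<in> L2_half"
    by (rule L2_half_cong[of v]) (use v veq in auto)
  then have "N = M" by (rule weyl_matrix_unique[OF z _ M])
  with veq show "v = ?v" using v by (intro extensionalityI[of v "{0..}"]) auto
qed

lemma weyl_function_eq:
  assumes z: "weyl_regular z" and M: "(\<lambda>x. \<phi> z x ** M + \<psi> z x) \<in> L2_half"
  shows "weyl_function Q \<Phi> z = M"
proof -
  have "weyl_function Q \<Phi> z *v e = M *v e" for e
  proof -
    have "weyl_function Q \<Phi> z *v e = dual_value ((\<phi> z 0 ** M + \<psi> z 0) *v e)"
      unfolding weyl_function_def weyl_solution_eq[OF z M]
      by (simp add: dual_value_def matrix_vector_mult_add_rdistrib matrix_vector_mul_assoc upper_mult_vec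
          lower_mult_vec upper_add lower_add mv_simps matrix_vector_uminus_left matrix_mult_add_right
          matrix_vector_mult_diff_rdistrib)
    then show ?thesis by (simp add: sol_matrix sol_values)
  qed
  then show ?thesis by (simp add: matrix_eq)
qed

lemma weyl_function_L2:
  assumes "weyl_regular z"
  shows "(\<lambda>x. \<phi> z x ** weyl_function Q \<Phi> z + \<psi> z x) \<in> L2_half"
  using weyl_matrix_exists[OF assms] weyl_function_eq[OF assms] by auto

lemma weyl_solution_nth:
  assumes "weyl_regular z" "x \<ge> 0"
  shows "weyl_solution Q \<Phi> z x *v e = sol z (weyl_function Q \<Phi> z *v e) e x"
  by (simp add: weyl_solution_eq[OF assms(1) weyl_function_L2[OF assms(1)]] assms(2) sol_matrix)

lemma weyl_sol_L2: "weyl_regular z \<Longrightarrow> sol z (weyl_function Q \<Phi> z *v e) e \<in> L2_half"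
  using L2_half_linear[OF bounded_linear_matrix_vector_left[of e] weyl_function_L2] by (simp add: sol_matrix)

lemma weyl_sol_dom_max: "weyl_regular z \<Longrightarrow> sol z (weyl_function Q \<Phi> z *v e) e \<in> dom_max Q"
  by (rule L2_solution_dom_max[OF vector_solution_sol weyl_sol_L2])

lemma sol_AE_zero:
  assumes "AE x in leb_half. sol z m e x = 0" shows "m = 0 \<and> e = 0"
proof -
  have "sol z m e 0 = 0"
    by (rule continuous_AE_zero_leb_half[OF AC_loc_half_continuous_on[OF AC_sol] assms]) simp
  then have "(norm e)\<^sup>2 + (norm m)\<^sup>2 = 0" using norm_sol_0[of z m e] by simp
  then show ?thesis by (simp add: sum_power2_eq_zero_iff)
qed

subsection \<open>Points of the resolvent set\<close>

lemma dom_A_iff: "y \<in> dom_A Q \<Phi> \<longleftrightarrow> y \<in> dom_max Q \<and> trace_value (y 0) = 0"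
  by (simp add: dom_A_def trace_value_def)

text \<open>To solve \<open>D(Q) y = z y\<close> with a prescribed boundary value, cut off the solution \<open>\<psi>\<close> near the
  origin and remove the resulting error, which is square integrable, with the resolvent.\<close>

lemma rho_A_weyl_regular:
  assumes z: "z \<in> rho_A Q \<Phi>" shows "weyl_regular z"
  unfolding weyl_regular_def
proof (intro conjI allI impI)
  note rho = z[unfolded rho_A_def resolvent_set_def mem_Collect_eq]
  show "m = 0" if L2: "sol z m 0 \<in> L2_half" for m
  proof -
    have "sol z m 0 \<in> dom_A Q \<Phi>"
      unfolding dom_A_iff using L2_solution_dom_max[OF vector_solution_sol L2] by (simp add: sol_values)
    moreover have "AE x in leb_half. dirac Q (sol z m 0) x - z *s sol z m 0 x = 0"
      using vector_solution_sol[of z m 0] by (simp add: vector_solution_def)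
    ultimately have "AE x in leb_half. sol z m 0 x = 0" using rho by blast
    then show ?thesis using sol_AE_zero by blast
  qed
  show "\<exists>m. sol z m e \<in> L2_half" for e
  proof -
    define w where "w = sol z 0 e"
    define cut :: "real \<Rightarrow> real" where "cut x = max 0 (1 - x)" for x
    define y0 where "y0 x = cut x *\<^sub>R w x" for x
    \<comment> \<open>The error, \<open>J\<close> times the derivative of the cut-off times \<open>w\<close>.\<close>
    define g where "g x = indicator {..<1} x *\<^sub>R (- (Jmat *v w x))" for x
    have w: "w \<in> AC_loc_half" unfolding w_def by (rule AC_sol)
    have w_cont: "continuous_on {0..} w" by (rule AC_loc_half_continuous_on[OF w])
    have "cut \<in> AC_loc_half"
      unfolding AC_loc_half_def mem_Collect_eq
      by (intro allI impI abs_continuous_on_lipschitz[where K = 1]) (auto simp: cut_def max_def)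
    then have y0: "y0 \<in> AC_loc_half"
      unfolding y0_def by (rule AC_loc_half_bilinear[OF bounded_bilinear_scaleR _ w])
    have "compact (w ` {0..1})"
      by (intro compact_continuous_image continuous_on_subset[OF w_cont]) auto
    then obtain B where B: "\<And>x. x \<in> {0..1} \<Longrightarrow> norm (w x) \<le> B"
      by (metis compact_imp_bounded bounded_iff imageI)
    have y0_L2: "y0 \<in> L2_half"
    proof (rule compact_support_L2_half)
      show "y0 \<in> borel_measurable leb_half"
        by (rule borel_measurable_leb_half_continuous[OF AC_loc_half_continuous_on[OF y0]])
      fix x :: real assume "0 \<le> x" "x \<le> 1"
      then have "cut x * norm (w x) \<le> 1 * B" using B[of x] by (intro mult_mono) (auto simp: cut_def)
      then show "norm (y0 x) \<le> B" using \<open>x \<le> 1\<close> by (simp add: y0_def cut_def)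
    qed (simp add: y0_def cut_def)
    have g_L2: "g \<in> L2_half"
    proof (rule compact_support_L2_half)
      have "(\<lambda>x. - (Jmat *v w x)) \<in> borel_measurable leb_half"
        by (intro borel_measurable_leb_half_continuous continuous_on_minus
            bounded_linear.continuous_on[OF bounded_linear_matrix_vector w_cont])
      moreover have "(indicator {..<1} :: real \<Rightarrow> real) \<in> borel_measurable leb_half"
        by (intro measurable_restrict_space1 borel_measurable_indicator) auto
      ultimately show "g \<in> borel_measurable leb_half" unfolding g_def by measurable
      fix x :: real assume "0 \<le> x" "x \<le> 1"
      then show "norm (g x) \<le> B"
        using B[of x] order_trans[OF norm_ge_zero B[of x]] by (auto simp: g_def norm_Jmat indicator_def)
    qed (simp add: g_def)
    have y0_eq: "AE x in leb_half. dirac Q y0 x = z *s y0 x + g x"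
    proof -
      have "AE x in leb_half. x \<noteq> 1"
        unfolding AE_leb_half_iff by (rule AE_I'[of "{1}"]) (auto simp flip: negligible_iff_null_sets)
      moreover have "AE x in leb_half. dirac Q w x = z *s w x"
        using vector_solution_sol[of z 0 e] by (simp add: vector_solution_def w_def)
      ultimately show ?thesis using AC_loc_half_differentiable[OF w]
      proof eventually_elim
        case (elim x)
        have dcut: "(cut has_field_derivative - indicator {..<1} x) (at x)"
        proof (cases "x < 1")
          case True
          have "((\<lambda>x. 1 - x) has_field_derivative - 1) (at x)" by (auto intro!: derivative_eq_intros)
          then have "(cut has_field_derivative - 1) (at x)"
            by (rule has_field_derivative_transform_within_open[of _ _ _ "{..<1}"]) (use True in \<open>auto simp: cut_def\<close>)
          then show ?thesis using True by simp
        next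
          case False
          have "((\<lambda>x. 0) has_field_derivative 0) (at x)" by simp
          then have "(cut has_field_derivative 0) (at x)"
            by (rule has_field_derivative_transform_within_open[of _ _ _ "{1<..}"]) (use False elim in \<open>auto simp: cut_def\<close>)
          then show ?thesis using False by simp
        qed
        have "vector_derivative y0 (at x) = cut x *\<^sub>R vector_derivative w (at x) + (- indicator {..<1} x) *\<^sub>R w x"
          unfolding y0_def by (rule vector_derivative_at[OF has_vector_derivative_scaleR[OF dcut elim(3)]])
        moreover have "Jmat *v (a *\<^sub>R p + (- b) *\<^sub>R q) + Q x *v (a *\<^sub>R q)
            = a *\<^sub>R (Jmat *v p + Q x *v q) + b *\<^sub>R (- (Jmat *v q))" for a b p q
          by (simp add: matrix_vector_mult_diff_distrib matrix_vector_scaleR scaleR_add_right)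
        ultimately have "dirac Q y0 x = cut x *\<^sub>R dirac Q w x + g x"
          unfolding dirac_def g_def y0_def by (simp only:)
        also have "cut x *\<^sub>R dirac Q w x = z *s y0 x"
          unfolding elim(2) y0_def by (simp add: vec_eq_iff)
        finally show ?case .
      qed
    qed
    obtain y where y: "y \<in> dom_A Q \<Phi>" "AE x in leb_half. dirac Q y x - z *s y x = g x"
      using rho g_L2 by blast
    define v where "v x = y0 x - y x" for x
    have y': "y \<in> AC_loc_half" "y \<in> L2_half" "trace_value (y 0) = 0"
      using y(1) by (auto simp: dom_A_iff dom_max_def)
    have v_L2: "v \<in> L2_half" unfolding v_def by (rule L2_half_diff[OF y0_L2 y'(2)])
    have v_AC: "v \<in> AC_loc_half" unfolding v_def by (rule AC_loc_half_diff[OF y0 y'(1)])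
    have "AE x in leb_half. dirac Q v x = z *s v x"
      using dirac_linear(2)[OF y0 y'(1), of Q] y0_eq y(2)
      unfolding v_def by eventually_elim (simp add: vector_scale_diff_right algebra_simps)
    with v_AC have v: "vector_solution Q z v" by (simp add: vector_solution_def)
    have "trace_value (v 0) = e"
      by (simp add: v_def values_diff y'(3) y0_def cut_def w_def sol_values)
    then have "v x = sol z (dual_value (v 0)) e x" if "x \<ge> 0" for x
      using vector_solution_eq_sol[OF v that] by (simp only:)
    then have "sol z (dual_value (v 0)) e \<in> L2_half" by (rule L2_half_cong[OF v_L2])
    then show ?thesis by blast
  qed
qed

section \<open>The energy identity in the half-planes\<close>

text \<open>The sign \<open>s\<close> treats the half-planes above \<open>beta_Q\<close> and below \<open>alpha_Q\<close> at the same time: it is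
  \<open>1\<close> in the first case and \<open>-1\<close> in the second.\<close>

definition definite :: "real \<Rightarrow> real \<Rightarrow> complex \<Rightarrow> bool"
  where "definite s c z \<longleftrightarrow> \<bar>s\<bar> = 1 \<and> c > 0 \<and>
    (AE x in leb_half. \<forall>v. c * (norm v)\<^sup>2 \<le> s * (Im z * (norm v)\<^sup>2 - Re (cdot (Im_mat (Q x) *v v) v)))"

lemma lagrange_form_sol:
  assumes "vector_solution Q z y" "vector_solution Q w u"
  shows "AE x in leb_half. lagrange_form Q y u x = cdot ((mat (z - cnj w) - mat (2 * \<i>) ** Im_mat (Q x)) *v y x) (u x)"
  using assms[unfolded vector_solution_def, THEN conjunct2]
proof eventually_elim
  case (elim x)
  show ?case unfolding lagrange_form_def elim
    by (simp only: matrix_vector_mult_diff_rdistrib mat_mult_vec matrix_vector_mul_assoc[symmetric]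
        cdot_diff_left cdot_scale_left cdot_scale_right left_diff_distrib)
qed

text \<open>Half of the imaginary part of the Lagrange form of \<open>y\<close> with itself is the energy density.\<close>

lemma energy_lower_bound:
  assumes z: "definite s c z" and y: "vector_solution Q z y"
  shows "AE x in leb_half. c * (norm (y x))\<^sup>2 \<le> s * (Im (lagrange_form Q y y x) / 2)"
proof -
  have "AE x in leb_half. dirac Q y x = z *s y x" using y by (simp add: vector_solution_def)
  moreover have "AE x in leb_half. \<forall>v. c * (norm v)\<^sup>2 \<le> s * (Im z * (norm v)\<^sup>2 - Re (cdot (Im_mat (Q x) *v v) v))"
    using z by (simp add: definite_def)
  ultimately show ?thesis
  proof eventually_elim
    case (elim x)
    have "lagrange_form Q y y x = (z - cnj z) * of_real ((norm (y x))\<^sup>2) - 2 * \<i> * cdot (Im_mat (Q x) *v y x) (y x)"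
      unfolding lagrange_form_def elim(1) cdot_scale_left cdot_scale_right cdot_self by (simp add: algebra_simps)
    then have "Im (lagrange_form Q y y x) / 2 = Im z * (norm (y x))\<^sup>2 - Re (cdot (Im_mat (Q x) *v y x) (y x))"
      by (simp add: Im_power2 power2_eq_square)
    then show ?case using elim(2)[rule_format, of "y x"] by (simp only:)
  qed
qed

lemma energy_interval:
  assumes z: "definite s c z" and y: "vector_solution Q z y" and b: "b \<ge> 0"
  shows "c * (LINT x|lebesgue_on {0..b}. (norm (y x))\<^sup>2)
    \<le> s * (Im (cdot (Jmat *v y b) (y b) - cdot (Jmat *v y 0) (y 0)) / 2)"
    and "integrable (lebesgue_on {0..b}) (\<lambda>x. (norm (y x))\<^sup>2)"
proof -
  have ac: "y \<in> AC_loc_half" using y by (simp add: vector_solution_def)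
  let ?k = "\<lambda>x. s * (Im (lagrange_form Q y y x) / 2)"
  have L: "integrable (lebesgue_on {0..b}) (lagrange_form Q y y)"
    using lagrange_interval(1)[OF ac ac b] by (simp add: integrable_lebesgue_on_interval)
  have k: "integrable (lebesgue_on {0..b}) ?k" using L by simp
  have "continuous_on {0..b} (\<lambda>x. (norm (y x))\<^sup>2)"
    using AC_loc_half_continuous_on[OF ac] by (intro continuous_intros) (auto intro: continuous_on_subset)
  then show n: "integrable (lebesgue_on {0..b}) (\<lambda>x. (norm (y x))\<^sup>2)"
    by (rule continuous_imp_integrable_real)
  have "c * (LINT x|lebesgue_on {0..b}. (norm (y x))\<^sup>2) = (LINT x|lebesgue_on {0..b}. c * (norm (y x))\<^sup>2)"
    by simp
  also have "\<dots> \<le> (LINT x|lebesgue_on {0..b}. ?k x)"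
    by (intro integral_mono_AE integrable_mult_right n k AE_lebesgue_on_interval energy_lower_bound[OF z y])
  also have "\<dots> = s * (Im (LINT x|lebesgue_on {0..b}. lagrange_form Q y y x) / 2)"
    using L by simp
  also have "(LINT x|lebesgue_on {0..b}. lagrange_form Q y y x) = integral {0..b} (lagrange_form Q y y)"
    by (rule lebesgue_integral_eq_integral[OF L]) auto
  also have "\<dots> = cdot (Jmat *v y b) (y b) - cdot (Jmat *v y 0) (y 0)"
    by (rule lagrange_interval(2)[OF ac ac b])
  finally show "c * (LINT x|lebesgue_on {0..b}. (norm (y x))\<^sup>2)
    \<le> s * (Im (cdot (Jmat *v y b) (y b) - cdot (Jmat *v y 0) (y 0)) / 2)" .
qed

lemma energy_half_line:
  assumes z: "definite s c z" and L2: "sol z m e \<in> L2_half"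
  shows "c * (LINT x|leb_half. (norm (sol z m e x))\<^sup>2) \<le> s * Im (cdot m e)"
proof -
  let ?y = "sol z m e"
  have dom: "?y \<in> dom_max Q" by (rule L2_solution_dom_max[OF vector_solution_sol L2])
  note L = lagrange_half_line[OF dom dom]
  have i: "integrable leb_half (lagrange_form Q ?y ?y)" using L by (simp add: has_bochner_integral_iff)
  have "c * (LINT x|leb_half. (norm (?y x))\<^sup>2) = (LINT x|leb_half. c * (norm (?y x))\<^sup>2)" by simp
  also have "\<dots> \<le> (LINT x|leb_half. s * (Im (lagrange_form Q ?y ?y x) / 2))"
  proof (rule integral_mono_AE)
    show "integrable leb_half (\<lambda>x. c * (norm (?y x))\<^sup>2)" using L2_halfD(2)[OF L2] by simp
    show "integrable leb_half (\<lambda>x. s * (Im (lagrange_form Q ?y ?y x) / 2))" using i by simp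
  qed (rule energy_lower_bound[OF z vector_solution_sol])
  also have "\<dots> = s * (Im (LINT x|leb_half. lagrange_form Q ?y ?y x) / 2)" using i by simp
  also have "(LINT x|leb_half. lagrange_form Q ?y ?y x) = - cdot (Jmat *v ?y 0) (?y 0)"
    using L by (simp add: has_bochner_integral_iff)
  also have "\<dots> = cdot m e - cnj (cdot m e)" by (simp add: cdot_Jmat_sol_0 cnj_cdot)
  finally show ?thesis by simp
qed

text \<open>Near the origin the solutions starting in the two coordinate planes have almost constant norm.
  So a solution whose coordinate \<open>m\<close> is large compared with \<open>e\<close> carries energy of the order of
  \<open>\<bar>m\<bar>\<^sup>2\<close> there.\<close>

lemma sol_near_origin:
  obtains h where "h > 0" "h \<le> 1"
    "\<And>x m e. 0 \<le> x \<Longrightarrow> x \<le> h \<Longrightarrow> norm m / 2 - 2 * norm e \<le> norm (sol z m e x)"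
proof -
  obtain K where K: "K > 0" "\<And>(A :: complex^'p^('p + 'p)) x. norm (A *v x) \<le> K * norm A * norm x"
    using norm_matrix_vector_le_norm by blast
  have near: "\<exists>h>0. \<forall>x\<in>{0..}. dist x 0 < h \<longrightarrow> dist (Y x) (Y 0) < 1 / (2 * K)"
    if "matrix_solution Q z Y" for Y :: "real \<Rightarrow> complex^'p^('p + 'p)"
  proof -
    have "continuous_on {0..} Y" using that by (auto simp: matrix_solution_def intro: AC_loc_half_continuous_on)
    moreover have "1 / (2 * K) > 0" using K by simp
    ultimately show ?thesis unfolding continuous_on_iff by (metis atLeast_iff order_refl)
  qed
  obtain h1 where h1: "h1 > 0" "\<And>x. x \<ge> 0 \<Longrightarrow> x < h1 \<Longrightarrow> norm (\<phi> z x - \<phi> z 0) \<le> 1 / (2 * K)"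
    using near[OF \<phi>_sol[of z]] by (auto simp: dist_norm less_imp_le)
  obtain h2 where h2: "h2 > 0" "\<And>x. x \<ge> 0 \<Longrightarrow> x < h2 \<Longrightarrow> norm (\<psi> z x - \<psi> z 0) \<le> 1 / (2 * K)"
    using near[OF \<psi>_sol[of z]] by (auto simp: dist_norm less_imp_le)
  define h where "h = min 1 (min h1 h2 / 2)"
  show thesis
  proof
    show "h > 0" "h \<le> 1" using h1(1) h2(1) by (auto simp: h_def)
    fix x and m e :: "complex^'p" assume x: "0 \<le> x" "x \<le> h"
    then have "x < h1" "x < h2" using h1(1) h2(1) by (auto simp: h_def)
    note d = h1(2)[OF x(1) this(1)] h2(2)[OF x(1) this(2)]
    have small: "norm ((A - B) *v v) \<le> norm v / 2" if "norm (A - B) \<le> 1 / (2 * K)"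
      for A B :: "complex^'p^('p + 'p)" and v
    proof -
      have "norm ((A - B) *v v) \<le> K * norm (A - B) * norm v" by (rule K(2))
      also have "\<dots> \<le> K * (1 / (2 * K)) * norm v"
        using that K(1) by (intro mult_right_mono mult_left_mono) auto
      finally show ?thesis using K(1) by simp
    qed
    have "(norm (\<phi> z 0 *v m))\<^sup>2 = (norm m)\<^sup>2" "(norm (\<psi> z 0 *v e))\<^sup>2 = (norm e)\<^sup>2"
      using norm_sol_0[of z m 0] norm_sol_0[of z 0 e] by (simp_all add: sol_def)
    then have n0: "norm (\<phi> z 0 *v m) = norm m" "norm (\<psi> z 0 *v e) = norm e"
      by (simp_all add: power2_eq_iff_nonneg)
    have "norm m \<le> norm (\<phi> z x *v m) + norm m / 2"
      using norm_triangle_ineq4[of "\<phi> z x *v m" "(\<phi> z x - \<phi> z 0) *v m"] small[OF d(1), of m] n0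
      by (simp add: matrix_vector_mult_diff_rdistrib)
    moreover have "norm (\<psi> z x *v e) \<le> norm e + norm e / 2"
      using norm_triangle_ineq[of "\<psi> z 0 *v e" "(\<psi> z x - \<psi> z 0) *v e"] small[OF d(2), of e] n0
      by (simp add: matrix_vector_mult_diff_rdistrib)
    moreover have "norm (\<phi> z x *v m) \<le> norm (sol z m e x) + norm (\<psi> z x *v e)"
      using norm_triangle_ineq4[of "sol z m e x" "\<psi> z x *v e"] by (simp add: sol_def)
    ultimately show "norm m / 2 - 2 * norm e \<le> norm (sol z m e x)"
      using norm_ge_zero[of e] by linarith
  qed
qed

text \<open>If the upper block vanishes at \<open>b\<close>, so does the boundary form there, and the energy on \<open>[0, b]\<close>
  is at most \<open>\<bar>m\<bar> \<bar>e\<bar>\<close> in modulus. Together with the lower bound near the origin this bounds \<open>m\<close>, uniformly in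
  \<open>b\<close>.\<close>

lemma truncated_bound:
  assumes z: "definite s c z"
  obtains R h where "R > 0" "h > 0"
    "\<And>b m e. b \<ge> h \<Longrightarrow> upper (sol z m e b) = 0 \<Longrightarrow>
      norm m \<le> R * norm e \<and> c * (LINT x|lebesgue_on {0..b}. (norm (sol z m e x))\<^sup>2) \<le> R * (norm e)\<^sup>2"
proof -
  obtain h where h: "h > 0" "h \<le> 1"
    "\<And>x m e. 0 \<le> x \<Longrightarrow> x \<le> h \<Longrightarrow> norm m / 2 - 2 * norm e \<le> norm (sol z m e x)"
    using sol_near_origin[of z] by blast
  have c: "c > 0" and s: "\<bar>s\<bar> = 1" using z by (auto simp: definite_def)
  \<comment> \<open>If \<open>\<bar>m\<bar> > 8 \<bar>e\<bar>\<close>, the solution is at least \<open>\<bar>m\<bar> / 4\<close> on \<open>[0, h]\<close>, and comparing energies gives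
    \<open>c h \<bar>m\<bar>\<^sup>2 / 16 \<le> \<bar>m\<bar> \<bar>e\<bar>\<close>.\<close>
  define R where "R = max 8 (16 / (c * h))"
  have R: "R \<ge> 8" "R \<ge> 16 / (c * h)" by (auto simp: R_def)
  have main: "norm m \<le> R * norm e \<and> c * (LINT x|lebesgue_on {0..b}. (norm (sol z m e x))\<^sup>2) \<le> R * (norm e)\<^sup>2"
    if b: "b \<ge> h" and up: "upper (sol z m e b) = 0" for b m e
  proof -
    have b0: "b \<ge> 0" using b h(1) by simp
    note E = energy_interval[OF z vector_solution_sol[of z m e] b0]
    let ?I = "LINT x|lebesgue_on {0..b}. (norm (sol z m e x))\<^sup>2"
    have "cdot (Jmat *v sol z m e b) (sol z m e b) = 0" by (simp add: cdot_Jmat up)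
    then have "c * ?I \<le> s * (Im (cdot m e - cnj (cdot m e)) / 2)"
      using E(1) by (simp add: cdot_Jmat_sol_0 cnj_cdot)
    also have "\<dots> \<le> \<bar>s * Im (cdot m e)\<bar>" by simp
    also have "\<dots> \<le> norm (cdot m e)" using s abs_Im_le_cmod[of "cdot m e"] by (simp add: abs_mult)
    also have "\<dots> \<le> norm m * norm e" by (rule norm_cdot_le)
    finally have le: "c * ?I \<le> norm m * norm e" .
    have mR: "norm m \<le> R * norm e"
    proof (rule ccontr)
      assume "\<not> ?thesis"
      then have big: "norm m > R * norm e" by simp
      moreover have "8 * norm e \<le> R * norm e" using R(1) by (intro mult_right_mono) auto
      ultimately have big8: "norm m > 8 * norm e" by simp
      then have m0: "norm m > 0" using norm_ge_zero[of e] by linarith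
      have "(norm m)\<^sup>2 / 16 * h = (LINT x|lebesgue_on {0..b}. indicator {0..h} x * ((norm m)\<^sup>2 / 16))"
        using h(1) b by (simp add: measure_restrict_space min_def)
      also have "\<dots> \<le> ?I"
      proof (rule integral_mono[OF _ E(2)])
        show "integrable (lebesgue_on {0..b}) (\<lambda>x. indicator {0..h} x * ((norm m)\<^sup>2 / 16))"
          by (intro integrable_mult_left integrable_real_indicator)
            (use h(1) b in \<open>auto simp: sets_restrict_space_iff emeasure_restrict_space min_def\<close>)
        fix x assume "x \<in> space (lebesgue_on {0..b})"
        show "indicator {0..h} x * ((norm m)\<^sup>2 / 16) \<le> (norm (sol z m e x))\<^sup>2"
        proof (cases "x \<in> {0..h}")
          case True
          then have "norm m / 4 \<le> norm (sol z m e x)" using h(3)[of x m e] big8 by auto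
          then have "(norm m / 4)\<^sup>2 \<le> (norm (sol z m e x))\<^sup>2" by (intro power_mono) auto
          then show ?thesis using True by (simp add: power_divide)
        qed simp
      qed
      finally have "c * ((norm m)\<^sup>2 / 16 * h) \<le> norm m * norm e"
        using le c by (meson mult_left_mono less_imp_le order_trans)
      then have "norm m * (norm m * (c * h)) \<le> norm m * (16 * norm e)"
        by (simp add: power2_eq_square algebra_simps)
      then have "norm m * (c * h) \<le> 16 * norm e" using m0 by simp
      then have "norm m \<le> 16 / (c * h) * norm e" using c h(1) by (simp add: field_simps)
      also have "\<dots> \<le> R * norm e" using R(2) by (intro mult_right_mono) auto
      finally show False using big by simp
    qed
    have "norm m * norm e \<le> R * norm e * norm e" using mR by (intro mult_right_mono) auto
    with le mR show ?thesis by (simp add: power2_eq_square mult.assoc)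
  qed
  show thesis by (rule that[of R h]) (use R(1) h(1) main in auto)
qed

text \<open>The Weyl solution is the limit of the solutions whose upper block vanishes at \<open>n\<close>, as \<open>n\<close> tends
  to infinity; the limit exists along a subsequence by the uniform bound, and is square integrable
  by Fatou's lemma.\<close>

lemma definite_weyl_regular:
  assumes z: "definite s c z" shows "weyl_regular z"
  unfolding weyl_regular_def
proof (intro conjI allI impI)
  have c: "c > 0" using z by (simp add: definite_def)
  show "m = 0" if L2: "sol z m 0 \<in> L2_half" for m
  proof -
    have "c * (LINT x|leb_half. (norm (sol z m 0 x))\<^sup>2) \<le> 0"
      using energy_half_line[OF z L2] by simp
    then have "(LINT x|leb_half. (norm (sol z m 0 x))\<^sup>2) \<le> 0"
      using c by (simp add: mult_le_0_iff)
    then show ?thesis using sol_AE_zero[OF AE_zero_of_integral_square[OF L2]] by blast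
  qed
  obtain R h where R: "R > 0" "h > 0"
    "\<And>b m e. b \<ge> h \<Longrightarrow> upper (sol z m e b) = 0 \<Longrightarrow>
      norm m \<le> R * norm e \<and> c * (LINT x|lebesgue_on {0..b}. (norm (sol z m e x))\<^sup>2) \<le> R * (norm e)\<^sup>2"
    using truncated_bound[OF z] by blast
  \<comment> \<open>The upper block of \<open>\<phi>\<close> at \<open>b\<close> is injective, by the bound for \<open>e = 0\<close>, and hence invertible.\<close>
  have trunc: "\<exists>m. upper (sol z m e b) = 0" if b: "b \<ge> h" for b e
  proof -
    let ?A = "upper (\<phi> z b)"
    have "m = 0" if "?A *v m = 0" for m
      using R(3)[OF b, of m 0] that by (simp add: sol_def upper_mult_vec upper_add)
    then obtain B where "B ** ?A = mat 1" using matrix_left_invertible_ker by blast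
    then have "?A ** B = mat 1" by (simp add: matrix_left_right_inverse)
    then have "?A *v (B *v v) = v" for v by (simp add: matrix_vector_mul_assoc)
    then have "upper (sol z (B *v (- (upper (\<psi> z b) *v e))) e b) = 0"
      by (simp add: sol_def upper_mult_vec upper_add)
    then show ?thesis by blast
  qed
  show "\<exists>m. sol z m e \<in> L2_half" for e
  proof -
    obtain n0 :: nat where n0: "h \<le> real n0" using real_arch_simple by blast
    have "\<forall>n. \<exists>m. upper (sol z m e (real (n0 + n))) = 0" using trunc n0 by simp
    then obtain f where f: "\<And>n. upper (sol z (f n) e (real (n0 + n))) = 0" by metis
    note fR = R(3)[OF _ f]
    have hn: "h \<le> real (n0 + n)" for n using n0 by simp
    have "\<forall>n. f n \<in> cball 0 (R * norm e)" using fR[OF hn] by simp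
    then obtain m r where r: "strict_mono r" "(f \<circ> r) \<longlonglongrightarrow> m"
      using compact_cball[of "0 :: complex^'p" "R * norm e"] unfolding compact_def by metis
    define B where "B = R * (norm e)\<^sup>2 / c"
    define u where "u n x = indicator {0..real (n0 + r n)} x * ennreal ((norm (sol z (f (r n)) e x))\<^sup>2)" for n x
    have meas: "(\<lambda>x. ennreal ((norm (sol z m e x))\<^sup>2)) \<in> borel_measurable leb_half" for m
      using borel_measurable_leb_half_continuous[OF AC_loc_half_continuous_on[OF AC_sol]] by measurable
    have um: "u n \<in> borel_measurable leb_half" for n
      unfolding u_def
      by (intro borel_measurable_times_ennreal meas measurable_restrict_space1 borel_measurable_indicator) auto
    have uB: "(\<integral>\<^sup>+x. u n x \<partial>leb_half) \<le> ennreal B" for n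
    proof -
      let ?b = "real (n0 + r n)" and ?s = "\<lambda>x. (norm (sol z (f (r n)) e x))\<^sup>2"
      have "(\<integral>\<^sup>+x. u n x \<partial>leb_half) = (\<integral>\<^sup>+x. ennreal (?s x) * indicator {0..?b} x \<partial>lebesgue)"
        unfolding u_def by (subst nn_integral_restrict_space) (auto intro!: nn_integral_cong simp: indicator_def)
      also have "\<dots> = (\<integral>\<^sup>+x. ennreal (?s x) \<partial>lebesgue_on {0..?b})"
        by (subst nn_integral_restrict_space) auto
      also have "\<dots> = ennreal (LINT x|lebesgue_on {0..?b}. ?s x)"
        by (rule nn_integral_eq_integral[OF energy_interval(2)[OF z vector_solution_sol]]) auto
      also have "\<dots> \<le> ennreal B"
        using fR[OF hn, of "r n"] c by (intro ennreal_leI) (simp add: B_def field_simps)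
      finally show ?thesis .
    qed
    have lim: "(\<lambda>n. u n x) \<longlonglongrightarrow> ennreal ((norm (sol z m e x))\<^sup>2)" if x: "x \<ge> 0" for x
    proof -
      have "(\<lambda>n. sol z ((f \<circ> r) n) e x) \<longlonglongrightarrow> sol z m e x"
        unfolding sol_def
        by (intro tendsto_add tendsto_const bounded_linear.tendsto[OF bounded_linear_matrix_vector r(2)])
      then have "(\<lambda>n. ennreal ((norm (sol z (f (r n)) e x))\<^sup>2)) \<longlonglongrightarrow> ennreal ((norm (sol z m e x))\<^sup>2)"
        by (intro tendsto_ennrealI tendsto_power tendsto_norm) (simp add: o_def)
      moreover obtain N :: nat where N: "x \<le> real N" using real_arch_simple by blast
      have "eventually (\<lambda>n. ennreal ((norm (sol z (f (r n)) e x))\<^sup>2) = u n x) sequentially"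
        using eventually_ge_at_top[of N]
      proof eventually_elim
        case (elim n)
        have "n \<le> r n" by (rule seq_suble[OF r(1)])
        then have "x \<le> real (n0 + r n)" using N elim by linarith
        then show ?case using x by (simp add: u_def)
      qed
      ultimately show ?thesis by (rule Lim_transform_eventually)
    qed
    have "(\<integral>\<^sup>+x. ennreal ((norm (sol z m e x))\<^sup>2) \<partial>leb_half) = (\<integral>\<^sup>+x. liminf (\<lambda>n. u n x) \<partial>leb_half)"
      using lim by (intro nn_integral_cong) (auto intro!: lim_imp_Liminf[symmetric])
    also have "\<dots> \<le> liminf (\<lambda>n. \<integral>\<^sup>+x. u n x \<partial>leb_half)" by (rule nn_integral_liminf[OF um])
    also have "\<dots> \<le> ennreal B"
      by (rule order_trans[OF Liminf_le_Limsup Limsup_bounded]) (auto simp: uB)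
    finally have fin: "(\<integral>\<^sup>+x. ennreal ((norm (sol z m e x))\<^sup>2) \<partial>leb_half) \<le> ennreal B" .
    have sm: "sol z m e \<in> borel_measurable leb_half"
      by (rule borel_measurable_leb_half_continuous[OF AC_loc_half_continuous_on[OF AC_sol]])
    have "integrable leb_half (\<lambda>x. (norm (sol z m e x))\<^sup>2)"
      by (rule integrableI_nonneg) (use sm fin in \<open>auto intro: order.strict_trans1\<close>)
    with sm show ?thesis by (auto simp: L2_half_def)
  qed
qed

text \<open>With the sign \<open>s\<close>, the quadratic form at \<open>e\<close> is at least \<open>c\<close> times the squared \<open>L\<^sup>2\<close> norm of the Weyl
  solution with trace value \<open>e\<close>, so it is positive unless \<open>e = 0\<close>; by compactness it has a positive
  lower bound on the unit sphere.\<close>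

lemma weyl_function_definite:
  assumes z: "definite s c z"
  shows "\<exists>\<delta>>0. \<forall>e. \<delta> * (norm e)\<^sup>2 \<le> s * Re (cdot (Im_mat (weyl_function Q \<Phi> z) *v e) e)"
proof -
  let ?N = "Im_mat (weyl_function Q \<Phi> z)"
  define q where "q e = s * Re (cdot (?N *v e) e)" for e
  have c: "c > 0" using z by (simp add: definite_def)
  have pos: "q e > 0" if "e \<noteq> 0" for e
  proof -
    let ?y = "sol z (weyl_function Q \<Phi> z *v e) e"
    have L2: "?y \<in> L2_half" by (rule weyl_sol_L2[OF definite_weyl_regular[OF z]])
    have "c * (LINT x|leb_half. (norm (?y x))\<^sup>2) \<le> q e"
      using energy_half_line[OF z L2] by (simp add: q_def cdot_Im_mat_self)
    moreover have "(LINT x|leb_half. (norm (?y x))\<^sup>2) > 0"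
    proof (rule ccontr)
      assume "\<not> ?thesis"
      then have "AE x in leb_half. ?y x = 0" by (intro AE_zero_of_integral_square[OF L2]) simp
      then show False using sol_AE_zero that by blast
    qed
    ultimately show ?thesis using c by (meson mult_pos_pos less_le_trans)
  qed
  have "continuous_on (sphere 0 1) q"
    unfolding q_def
    by (intro continuous_intros bounded_bilinear.continuous_on[OF bounded_bilinear_cdot]
        bounded_linear.continuous_on[OF bounded_linear_matrix_vector])
  moreover have "(sphere 0 1 :: (complex^'p) set) \<noteq> {}" by simp
  ultimately obtain e0 where e0: "e0 \<in> sphere 0 1" and min: "\<And>e. e \<in> sphere 0 1 \<Longrightarrow> q e0 \<le> q e"
    using continuous_attains_inf[OF compact_sphere] by metis
  have scale: "q (r *\<^sub>R v) = r\<^sup>2 * q v" for r v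
    by (simp add: q_def matrix_vector_scaleR cdot_scaleR_left cdot_scaleR_right power2_eq_square)
  have "q e0 * (norm e)\<^sup>2 \<le> q e" for e
  proof (cases "e = 0")
    case False
    have "q e0 \<le> q (inverse (norm e) *\<^sub>R e)" by (rule min) (use False in simp)
    then show ?thesis using False by (simp add: scale field_simps)
  qed (simp add: q_def)
  moreover have "q e0 > 0" by (rule pos) (use e0 in auto)
  ultimately show ?thesis unfolding q_def by blast
qed

text \<open>A number strictly between \<open>beta_Q\<close> and \<open>Im z\<close> bounds the largest eigenvalue almost everywhere; its
  distance from \<open>Im z\<close> is the constant.\<close>

lemma upper_half_definite:
  assumes "z \<in> upper_half (beta_Q Q)" shows "\<exists>c. definite 1 c z"
proof -
  have "beta_Q Q < ereal (Im z)" using assms by (simp add: upper_half_def)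
  then obtain r where r: "beta_Q Q < ereal r" "ereal r < ereal (Im z)" using ereal_dense2 by blast
  have "AE x in leb_half. ereal (max_eigenvalue (Im_mat (Q x))) < ereal r"
    using Limsup_lessD[OF r(1)[unfolded beta_Q_def]] .
  then have "AE x in leb_half. \<forall>v. (Im z - r) * (norm v)\<^sup>2 \<le> 1 * (Im z * (norm v)\<^sup>2 - Re (cdot (Im_mat (Q x) *v v) v))"
  proof eventually_elim
    case (elim x)
    show ?case
    proof
      fix v :: "complex^('p + 'p)"
      have "Re (cdot (Im_mat (Q x) *v v) v) \<le> max_eigenvalue (Im_mat (Q x)) * (norm v)\<^sup>2"
        by (rule cdot_le_max_eigenvalue[OF ctrans_Im_mat])
      also have "\<dots> \<le> r * (norm v)\<^sup>2" using elim by (intro mult_right_mono) auto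
      finally show "(Im z - r) * (norm v)\<^sup>2 \<le> 1 * (Im z * (norm v)\<^sup>2 - Re (cdot (Im_mat (Q x) *v v) v))"
        by (simp add: algebra_simps)
    qed
  qed
  then show ?thesis using r(2) by (intro exI[of _ "Im z - r"]) (simp add: definite_def)
qed

lemma lower_half_definite:
  assumes "z \<in> lower_half (alpha_Q Q)" shows "\<exists>c. definite (- 1) c z"
proof -
  have "ereal (Im z) < alpha_Q Q" using assms by (simp add: lower_half_def)
  then obtain r where r: "ereal (Im z) < ereal r" "ereal r < alpha_Q Q" using ereal_dense2 by blast
  have "AE x in leb_half. ereal r < ereal (min_eigenvalue (Im_mat (Q x)))"
    using less_LiminfD[OF r(2)[unfolded alpha_Q_def]] .
  then have "AE x in leb_half. \<forall>v. (r - Im z) * (norm v)\<^sup>2 \<le> - 1 * (Im z * (norm v)\<^sup>2 - Re (cdot (Im_mat (Q x) *v v) v))"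
  proof eventually_elim
    case (elim x)
    show ?case
    proof
      fix v :: "complex^('p + 'p)"
      have "r * (norm v)\<^sup>2 \<le> min_eigenvalue (Im_mat (Q x)) * (norm v)\<^sup>2" using elim by (intro mult_right_mono) auto
      also have "\<dots> \<le> Re (cdot (Im_mat (Q x) *v v) v)"
        by (rule min_eigenvalue_le_cdot[OF ctrans_Im_mat])
      finally show "(r - Im z) * (norm v)\<^sup>2 \<le> - 1 * (Im z * (norm v)\<^sup>2 - Re (cdot (Im_mat (Q x) *v v) v))"
        by (simp add: algebra_simps)
    qed
  qed
  then show ?thesis using r(1) by (intro exI[of _ "r - Im z"]) (simp add: definite_def)
qed

section \<open>The integral identities\<close>

text \<open>The entry \<open>(i, j)\<close> is the Lagrange identity for the \<open>j\<close>-th column of the Weyl solution at \<open>z\<close> and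
  the \<open>i\<close>-th column of the one at \<open>w\<close>.\<close>

lemma weyl_identity:
  assumes z: "weyl_regular z" and w: "weyl_regular w"
  shows "has_bochner_integral leb_half
    (\<lambda>x. ctrans (weyl_solution Q \<Phi> w x) ** (mat (z - cnj w) - mat (2 * \<i>) ** Im_mat (Q x)) ** weyl_solution Q \<Phi> z x)
    (weyl_function Q \<Phi> z - ctrans (weyl_function Q \<Phi> w))"
proof (rule matrix_has_bochner_integral)
  fix i j
  let ?M = "weyl_function Q \<Phi>" and ?V = "weyl_solution Q \<Phi>"
  let ?y = "sol z (?M z *v axis j 1) (axis j 1)" and ?u = "sol w (?M w *v axis i 1) (axis i 1)"
  have y: "?y \<in> dom_max Q" and u: "?u \<in> dom_max Q"
    by (intro weyl_sol_dom_max z w)+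
  have "cdot (axis j 1) (?M w *v axis i 1) = cnj (?M w $ j $ i)"
    unfolding cdot_matrix_axis[symmetric] by (simp only: cnj_cdot)
  then have "- cdot (Jmat *v ?y 0) (?u 0) = (?M z - ctrans (?M w)) $ i $ j"
    by (simp only: cdot_Jmat_sol_0 cdot_matrix_axis vector_minus_component ctrans_nth minus_diff_eq)
  then have L: "has_bochner_integral leb_half (lagrange_form Q ?y ?u) ((?M z - ctrans (?M w)) $ i $ j)"
    using lagrange_half_line[OF y u] by simp
  show "has_bochner_integral leb_half
      (\<lambda>x. (ctrans (?V w x) ** (mat (z - cnj w) - mat (2 * \<i>) ** Im_mat (Q x)) ** ?V z x) $ i $ j)
      ((?M z - ctrans (?M w)) $ i $ j)"
  proof (rule has_bochner_integral_leb_half_AE[OF L])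
    show "AE x in leb_half. lagrange_form Q ?y ?u x
        = (ctrans (?V w x) ** (mat (z - cnj w) - mat (2 * \<i>) ** Im_mat (Q x)) ** ?V z x) $ i $ j"
      using lagrange_form_sol[OF vector_solution_sol[of z "?M z *v axis j 1" "axis j 1"]
          vector_solution_sol[of w "?M w *v axis i 1" "axis i 1"]] AE_space[of leb_half]
    proof eventually_elim
      case (elim x)
      let ?K = "mat (z - cnj w) - mat (2 * \<i>) ** Im_mat (Q x)"
      have x: "x \<ge> 0" using elim(2) by simp
      have "(ctrans (?V w x) ** ?K ** ?V z x) $ i $ j
          = cdot (ctrans (?V w x) *v (?K *v (?V z x *v axis j 1))) (axis i 1)"
        unfolding cdot_matrix_axis[symmetric] by (simp only: matrix_vector_mul_assoc matrix_mul_assoc)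
      also have "\<dots> = cdot (?K *v (?V z x *v axis j 1)) (?V w x *v axis i 1)"
        by (simp only: cdot_matrix_left[of "ctrans (?V w x)"] ctrans_ctrans)
      also have "\<dots> = cdot (?K *v ?y x) (?u x)"
        by (simp only: weyl_solution_nth[OF z x] weyl_solution_nth[OF w x])
      finally show ?case using elim(1) by simp
    qed
  qed
qed

lemma weyl_identity_Im:
  assumes z: "weyl_regular z"
  shows "has_bochner_integral leb_half
    (\<lambda>x. ctrans (weyl_solution Q \<Phi> z x) ** (mat (complex_of_real (Im z)) - Im_mat (Q x)) ** weyl_solution Q \<Phi> z x)
    (Im_mat (weyl_function Q \<Phi> z))"
proof -
  let ?c = "1 / (2 * \<i>)"
  have K: "mat ?c ** (mat (z - cnj z) - mat (2 * \<i>) ** Im_mat (Q x)) = mat (complex_of_real (Im z)) - Im_mat (Q x)" for x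
  proof -
    have "mat b ** (mat d - mat e ** X) = mat (b * d) - mat (b * e) ** X" for b d e and X :: "complex^('p + 'p)^('p + 'p)"
      by (simp add: vec_eq_iff mat_mult_nth right_diff_distrib) (simp add: mat_def)
    moreover have "?c * (z - cnj z) = of_real (Im z)"
      by (simp add: complex_eq_iff)
    moreover have "?c * (2 * \<i>) = 1" by simp
    ultimately show ?thesis by (simp only: matrix_mul_lid)
  qed
  have eq: "mat ?c ** (ctrans V ** (mat (z - cnj z) - mat (2 * \<i>) ** Im_mat (Q x)) ** V)
      = ctrans V ** (mat (complex_of_real (Im z)) - Im_mat (Q x)) ** V" for x and V :: "complex^'p^('p + 'p)"
  proof -
    have "mat ?c ** ctrans V = ctrans V ** mat ?c"
      by (simp add: vec_eq_iff mat_mult_nth mult_mat_nth)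
    then have "mat ?c ** (ctrans V ** (mat (z - cnj z) - mat (2 * \<i>) ** Im_mat (Q x)) ** V)
      = ctrans V ** (mat ?c ** (mat (z - cnj z) - mat (2 * \<i>) ** Im_mat (Q x))) ** V"
      by (simp only: matrix_mul_assoc)
    then show ?thesis by (simp only: K)
  qed
  show ?thesis
    using has_bochner_integral_bounded_linear[OF
        bounded_bilinear.bounded_linear_right[OF bounded_bilinear_matrix_mult, of "mat ?c"] weyl_identity[OF z z]]
    by (simp only: eq Im_mat_def[of "weyl_function Q \<Phi> z", symmetric])
qed

end

section \<open>Holomorphy of the Weyl function\<close>

lemma has_field_derivative_quadratic:
  fixes f :: "complex \<Rightarrow> complex"
  assumes d: "d > 0" and K: "\<And>z. z \<in> A \<Longrightarrow> norm (z - a) < d \<Longrightarrow> norm (f z - f a - t * (z - a)) \<le> K * (norm (z - a))\<^sup>2"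
  shows "(f has_field_derivative t) (at a within A)"
  unfolding has_field_derivative_def has_derivative_within_alt
proof (intro conjI allI impI)
  show "bounded_linear ((*) t)" by (rule bounded_linear_mult_right)
  fix e :: real assume e: "e > 0"
  define d' where "d' = min d (e / (\<bar>K\<bar> + 1))"
  show "\<exists>d>0. \<forall>y\<in>A. norm (y - a) < d \<longrightarrow> norm (f y - f a - t * (y - a)) \<le> e * norm (y - a)"
  proof (intro exI conjI ballI impI)
    show "d' > 0" using d e by (simp add: d'_def)
    fix y assume y: "y \<in> A" "norm (y - a) < d'"
    then have "norm (y - a) < d" "norm (y - a) \<le> e / (\<bar>K\<bar> + 1)" by (auto simp: d'_def)
    then have "(\<bar>K\<bar> + 1) * norm (y - a) \<le> e" by (simp add: field_simps)
    moreover have "K * norm (y - a) \<le> (\<bar>K\<bar> + 1) * norm (y - a)" by (intro mult_right_mono) auto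
    ultimately have "K * norm (y - a) \<le> e" by simp
    then have "K * norm (y - a) * norm (y - a) \<le> e * norm (y - a)" by (intro mult_right_mono) auto
    then show "norm (f y - f a - t * (y - a)) \<le> e * norm (y - a)"
      using K[OF y(1) \<open>norm (y - a) < d\<close>] by (simp add: power2_eq_square mult.assoc)
  qed
qed

context dirac_system
begin

lemma dom_A_diff:
  assumes y: "y \<in> dom_A Q \<Phi>" and u: "u \<in> dom_A Q \<Phi>"
  shows "(\<lambda>x. y x - u x) \<in> dom_A Q \<Phi>"
proof -
  have *: "y \<in> L2_half" "u \<in> L2_half" "y \<in> AC_loc_half" "u \<in> AC_loc_half" "dirac Q y \<in> L2_half"
    "dirac Q u \<in> L2_half" "trace_value (y 0) = 0" "trace_value (u 0) = 0"
    using y u by (auto simp: dom_A_iff dom_max_def)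
  have "AE x in leb_half. dirac Q y x - dirac Q u x = dirac Q (\<lambda>x. y x - u x) x"
    using dirac_linear(2)[OF *(3,4), of Q] by eventually_elim simp
  from L2_half_cong_AE[OF L2_half_diff[OF *(5,6)] this]
  show ?thesis using * by (simp add: dom_A_iff dom_max_def L2_half_diff AC_loc_half_diff values_diff)
qed

lemma dom_A_scale:
  assumes y: "y \<in> dom_A Q \<Phi>" shows "(\<lambda>x. c *s y x) \<in> dom_A Q \<Phi>"
proof -
  have *: "y \<in> L2_half" "y \<in> AC_loc_half" "dirac Q y \<in> L2_half" "trace_value (y 0) = 0"
    using y by (auto simp: dom_A_iff dom_max_def)
  have "AE x in leb_half. c *s dirac Q y x = dirac Q (\<lambda>x. c *s y x) x"
    using dirac_linear(3)[OF *(2,2), where c = c and Q = Q] by eventually_elim simp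
  from L2_half_cong_AE[OF L2_half_linear[OF bounded_linear_vector_scale *(3)] this]
  show ?thesis using * L2_half_linear[OF bounded_linear_vector_scale *(1), of c]
    by (simp add: dom_A_iff dom_max_def AC_loc_half_scale values_scale)
qed

text \<open>The boundary form against a fixed element of the maximal domain is continuous in the graph norm,
  because by the Lagrange identity it is an integral over the half-line.\<close>

lemma boundary_form_bounded:
  assumes u: "u \<in> dom_max Q"
    and B: "\<And>y. y \<in> dom_A Q \<Phi> \<Longrightarrow> L2_norm y \<le> B * L2_norm (\<lambda>x. dirac Q y x - z *s y x)" and "B \<ge> 0"
  shows "\<exists>K\<ge>0. \<forall>y\<in>dom_A Q \<Phi>. norm (cdot (Jmat *v y 0) (u 0)) \<le> K * L2_norm (\<lambda>x. dirac Q y x - z *s y x)"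
proof -
  obtain c where c: "c \<ge> 0" "\<And>x v. x \<ge> 0 \<Longrightarrow> norm (Im_mat (Q x) *v v) \<le> c * norm v"
    using Im_mat_bound by blast
  have u': "u \<in> L2_half" "dirac Q u \<in> L2_half" using u by (auto simp: dom_max_def)
  define K where "K = (1 + norm z * B) * L2_norm u + B * L2_norm (dirac Q u) + 2 * (c * B * L2_norm u)"
  show ?thesis
  proof (intro exI[of _ K] conjI ballI)
    show "K \<ge> 0" unfolding K_def using c(1) \<open>B \<ge> 0\<close> by (simp add: L2_norm_nonneg)
    fix y assume y: "y \<in> dom_A Q \<Phi>"
    have y': "y \<in> L2_half" "dirac Q y \<in> L2_half" and ymax: "y \<in> dom_max Q"
      using y by (auto simp: dom_A_iff dom_max_def)
    define n where "n = L2_norm (\<lambda>x. dirac Q y x - z *s y x)"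
    have n: "n \<ge> 0" "L2_norm y \<le> B * n" using B[OF y] by (simp_all add: n_def L2_norm_nonneg)
    have zy: "(\<lambda>x. z *s y x) \<in> L2_half" by (rule L2_half_linear[OF bounded_linear_vector_scale y'(1)])
    have "L2_norm (dirac Q y) \<le> n + norm z * L2_norm y"
      using L2_norm_add_le[OF L2_half_diff[OF y'(2) zy] zy] by (simp add: n_def L2_norm_scale)
    also have "\<dots> \<le> n + norm z * (B * n)" using n by (intro add_left_mono mult_left_mono) auto
    finally have Dy: "L2_norm (dirac Q y) \<le> (1 + norm z * B) * n" by (simp add: algebra_simps)
    note q = Im_mat_L2_half[OF y'(1)]
    have "L2_norm (\<lambda>x. Im_mat (Q x) *v y x) \<le> c * L2_norm y"
      by (rule L2_norm_le[OF q y'(1) c(2) c(1)])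
    also have "\<dots> \<le> c * (B * n)" using n c(1) by (intro mult_left_mono)
    finally have Qy: "L2_norm (\<lambda>x. Im_mat (Q x) *v y x) \<le> c * B * n" by simp
    note i = integrable_cdot[OF y'(2) u'(1)] integrable_cdot[OF y'(1) u'(2)] integrable_cdot[OF q u'(1)]
    have "- cdot (Jmat *v y 0) (u 0) = (LINT x|leb_half. lagrange_form Q y u x)"
      using lagrange_half_line[OF ymax u] by (simp add: has_bochner_integral_iff)
    also have "\<dots> = (LINT x|leb_half. cdot (dirac Q y x) (u x)) - (LINT x|leb_half. cdot (y x) (dirac Q u x))
        - 2 * \<i> * (LINT x|leb_half. cdot (Im_mat (Q x) *v y x) (u x))"
      unfolding lagrange_form_def using i by simp
    finally have "norm (cdot (Jmat *v y 0) (u 0)) = norm \<dots>" by (metis norm_minus_cancel)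
    also have "\<dots> \<le> norm (LINT x|leb_half. cdot (dirac Q y x) (u x)) + norm (LINT x|leb_half. cdot (y x) (dirac Q u x))
        + 2 * norm (LINT x|leb_half. cdot (Im_mat (Q x) *v y x) (u x))"
      by (intro norm_triangle_le_diff add_mono norm_triangle_ineq4) (simp add: norm_mult)
    also have "\<dots> \<le> L2_norm (dirac Q y) * L2_norm u + L2_norm y * L2_norm (dirac Q u)
        + 2 * (L2_norm (\<lambda>x. Im_mat (Q x) *v y x) * L2_norm u)"
      by (intro add_mono mult_left_mono norm_integral_cdot_le y' u' q) auto
    also have "\<dots> \<le> (1 + norm z * B) * n * L2_norm u + B * n * L2_norm (dirac Q u) + 2 * (c * B * n * L2_norm u)"
      using Dy n Qy by (intro add_mono mult_left_mono mult_right_mono) (auto simp: L2_norm_nonneg)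
    also have "\<dots> = K * n" by (simp add: K_def algebra_simps)
    finally show "norm (cdot (Jmat *v y 0) (u 0)) \<le> K * L2_norm (\<lambda>x. dirac Q y x - z *s y x)"
      by (simp add: n_def)
  qed
qed

text \<open>Let \<open>y z\<close> be a column of the Weyl solution. The difference \<open>d = y z - y a\<close> satisfies the boundary
  condition and \<open>(D - a) d = (z - a) y z\<close>, so the resolvent bound gives \<open>d = O(z - a)\<close>. Then
  \<open>p = d - (z - a) r\<close>, where \<open>r\<close> is the resolvent at \<open>a\<close> applied to \<open>y a\<close>, satisfies \<open>(D - a) p = (z - a) d\<close>, which is of second order, and the boundary form
  of \<open>p\<close> against a Weyl solution at \<open>a\<close> is, up to sign, the error of the linear approximation to an
  entry of the Weyl function.\<close>

lemma weyl_function_derivative: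
  assumes a: "a \<in> rho_A Q \<Phi>"
  shows "\<exists>t. ((\<lambda>z. weyl_function Q \<Phi> z $ i $ j) has_field_derivative t) (at a within rho_A Q \<Phi>)"
proof -
  let ?M = "weyl_function Q \<Phi>"
  note rho = a[unfolded rho_A_def resolvent_set_def mem_Collect_eq]
  have reg: "weyl_regular z" if "z \<in> rho_A Q \<Phi>" for z by (rule rho_A_weyl_regular[OF that])
  define e where "e = (axis j 1 :: complex^'p)"
  define f where "f = (axis i 1 :: complex^'p)"
  define y where "y z = sol z (?M z *v e) e" for z
  define u where "u = sol a (?M a *v f) f"
  have y_L2: "y z \<in> L2_half" if "z \<in> rho_A Q \<Phi>" for z unfolding y_def by (rule weyl_sol_L2[OF reg[OF that]])
  have y_sol: "vector_solution Q z (y z)" for z unfolding y_def by (rule vector_solution_sol)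
  have u_dom: "u \<in> dom_max Q"
    unfolding u_def by (intro weyl_sol_dom_max reg a)
  obtain B0 where B0: "\<And>y. y \<in> dom_A Q \<Phi> \<Longrightarrow> L2_norm y \<le> B0 * L2_norm (\<lambda>x. dirac Q y x - a *s y x)"
    using rho by blast
  define B where "B = max B0 0"
  have "B \<ge> 0" by (simp add: B_def)
  have B: "L2_norm y \<le> B * L2_norm (\<lambda>x. dirac Q y x - a *s y x)" if "y \<in> dom_A Q \<Phi>" for y
    using B0[OF that] mult_right_mono[of B0 B "L2_norm (\<lambda>x. dirac Q y x - a *s y x)"]
    by (auto simp: B_def L2_norm_nonneg)
  obtain K where K: "K \<ge> 0"
    "\<And>y. y \<in> dom_A Q \<Phi> \<Longrightarrow> norm (cdot (Jmat *v y 0) (u 0)) \<le> K * L2_norm (\<lambda>x. dirac Q y x - a *s y x)"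
    using boundary_form_bounded[OF u_dom B \<open>B \<ge> 0\<close>] by blast
  have bform: "cdot (Jmat *v v 0) (u 0) = - cdot (dual_value (v 0)) f" if "v \<in> dom_A Q \<Phi>" for v
    using that by (simp add: dom_A_iff cdot_Jmat_values u_def sol_values)
  \<comment> \<open>This \<open>r\<close> is the derivative at \<open>a\<close> of \<open>y\<close> with respect to the spectral parameter.\<close>
  obtain r where r: "r \<in> dom_A Q \<Phi>" "AE x in leb_half. dirac Q r x - a *s r x = y a x"
    using rho y_L2[OF a] by blast
  define t where "t = cdot (dual_value (r 0)) f"
  define N where "N = L2_norm (y a)"
  have "((\<lambda>z. ?M z $ i $ j) has_field_derivative t) (at a within rho_A Q \<Phi>)"
  proof (rule has_field_derivative_quadratic)
    \<comment> \<open>At this distance \<open>B \<bar>z - a\<bar> \<le> 1/2\<close>, so that the norm of \<open>d\<close> in its own estimate can be absorbed.\<close>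
    show "1 / (2 * B + 1) > 0" using \<open>B \<ge> 0\<close> by simp
    fix z assume z: "z \<in> rho_A Q \<Phi>" and close: "norm (z - a) < 1 / (2 * B + 1)"
    define h where "h = z - a"
    have Bh: "B * norm h \<le> 1/2" 
    proof -
      have "(2 * B + 1) * norm h < 1" using close \<open>B \<ge> 0\<close> by (simp add: h_def field_simps)
      then have "2 * (B * norm h) + norm h < 1" by (simp add: algebra_simps)
      then show ?thesis using norm_ge_zero[of h] by linarith
    qed
    define d where "d x = y z x - y a x" for x
    define p where "p x = d x - h *s r x" for x
    have ac: "y z \<in> AC_loc_half" "y a \<in> AC_loc_half" "r \<in> AC_loc_half"
      using y_sol[of z] y_sol[of a] r(1) by (auto simp: vector_solution_def dom_A_iff dom_max_def)
    have d_L2: "d \<in> L2_half" unfolding d_def by (rule L2_half_diff[OF y_L2[OF z] y_L2[OF a]])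
    have d_ac: "d \<in> AC_loc_half" unfolding d_def by (rule AC_loc_half_diff[OF ac(1,2)])
    have d_eq: "AE x in leb_half. dirac Q d x = z *s y z x - a *s y a x"
      using dirac_linear(2)[OF ac(1,2), of Q] y_sol[of z, unfolded vector_solution_def, THEN conjunct2]
        y_sol[of a, unfolded vector_solution_def, THEN conjunct2]
      unfolding d_def by eventually_elim simp
    have "(\<lambda>x. z *s y z x - a *s y a x) \<in> L2_half"
      by (intro L2_half_diff L2_half_linear[OF bounded_linear_vector_scale] y_L2 z a)
    moreover have "AE x in leb_half. z *s y z x - a *s y a x = dirac Q d x"
      using d_eq by eventually_elim simp
    ultimately have "dirac Q d \<in> L2_half" by (rule L2_half_cong_AE)
    moreover have "trace_value (d 0) = 0" by (simp add: d_def y_def values_diff sol_values)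
    ultimately have d_dom: "d \<in> dom_A Q \<Phi>" using d_L2 d_ac by (simp add: dom_A_iff dom_max_def)
    have dz: "AE x in leb_half. dirac Q d x - a *s d x = h *s y z x"
      using d_eq
    proof eventually_elim
      case (elim x)
      show ?case unfolding elim unfolding d_def h_def
        by (simp add: vector_scale_diff_right vector_scale_diff_left)
    qed
    have hy: "(\<lambda>x. h *s y z x) \<in> L2_half" by (rule L2_half_linear[OF bounded_linear_vector_scale y_L2[OF z]])
    have "L2_norm (\<lambda>x. dirac Q d x - a *s d x) = norm h * L2_norm (y z)"
    proof -
      have "AE x in leb_half. h *s y z x = dirac Q d x - a *s d x" using dz by eventually_elim simp
      from L2_norm_cong_AE[OF L2_halfD(1)[OF hy] this] show ?thesis by (simp add: L2_norm_scale)
    qed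
    then have "L2_norm d \<le> B * (norm h * L2_norm (y z))" using B[OF d_dom] by simp
    also have "\<dots> \<le> B * (norm h * (L2_norm d + N))"
    proof -
      have "L2_norm (y z) \<le> L2_norm d + N"
        using L2_norm_add_le[OF d_L2 y_L2[OF a]] by (simp add: d_def N_def)
      then show ?thesis using \<open>B \<ge> 0\<close> by (intro mult_left_mono) auto
    qed
    also have "\<dots> = B * norm h * L2_norm d + B * norm h * N" by (simp add: algebra_simps)
    also have "\<dots> \<le> 1/2 * L2_norm d + B * norm h * N"
      using Bh by (intro add_right_mono mult_right_mono) (auto simp: L2_norm_nonneg)
    finally have d_small: "L2_norm d \<le> 2 * B * N * norm h" by (simp add: algebra_simps)
    have hr: "(\<lambda>x. h *s r x) \<in> dom_A Q \<Phi>" by (rule dom_A_scale[OF r(1)])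
    then have hr_ac: "(\<lambda>x. h *s r x) \<in> AC_loc_half" by (simp add: dom_A_iff dom_max_def)
    have p_dom: "p \<in> dom_A Q \<Phi>" unfolding p_def by (rule dom_A_diff[OF d_dom hr])
    have "AE x in leb_half. h *s d x = dirac Q p x - a *s p x"
      using dirac_linear(2)[OF d_ac hr_ac, of Q] dirac_linear(3)[OF ac(3,3), where c = h and Q = Q] dz r(2)
      unfolding p_def
    proof eventually_elim
      case (elim x)
      have "dirac Q (\<lambda>x. d x - h *s r x) x - a *s (d x - h *s r x)
          = (dirac Q d x - a *s d x) - h *s (dirac Q r x - a *s r x)"
        unfolding elim(1,2) by (simp add: vec_eq_iff algebra_simps)
      also have "\<dots> = h *s d x"
        unfolding elim(3,4) unfolding d_def by (simp add: vector_scale_diff_right)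
      finally show ?case by simp
    qed
    from L2_norm_cong_AE[OF L2_halfD(1)[OF L2_half_linear[OF bounded_linear_vector_scale d_L2]] this]
    have "L2_norm (\<lambda>x. dirac Q p x - a *s p x) = norm h * L2_norm d" by (simp add: L2_norm_scale)
    then have "norm (cdot (dual_value (p 0)) f) \<le> K * (norm h * L2_norm d)"
      using K(2)[OF p_dom] bform[OF p_dom] by simp
    also have "\<dots> \<le> K * (norm h * (2 * B * N * norm h))"
      using d_small K(1) by (intro mult_left_mono) auto
    finally have bound: "norm (cdot (dual_value (p 0)) f) \<le> K * 2 * B * N * (norm h)\<^sup>2"
      by (simp add: power2_eq_square mult_ac)
    have "dual_value (p 0) = ?M z *v e - ?M a *v e - h *s dual_value (r 0)"
      by (simp add: p_def d_def y_def values_diff values_scale sol_values)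
    then have "cdot (dual_value (p 0)) f = ?M z $ i $ j - ?M a $ i $ j - h * t"
      by (simp only: cdot_diff_left cdot_scale_left t_def e_def f_def cdot_matrix_axis)
    then show "norm (?M z $ i $ j - ?M a $ i $ j - t * (z - a)) \<le> K * 2 * B * N * (norm (z - a))\<^sup>2"
      using bound by (simp add: h_def mult.commute)
  qed
  then show ?thesis by blast
qed

lemma weyl_function_holomorphic: "(\<lambda>z. weyl_function Q \<Phi> z $ i $ j) holomorphic_on rho_A Q \<Phi>"
  unfolding holomorphic_on_def field_differentiable_def using weyl_function_derivative by blast

end

theorem proposition4p15:
  fixes Q :: "real \<Rightarrow> complex^('p::finite + 'p)^('p + 'p)"
    and \<Phi> :: "complex^'p^'p"
    and \<phi> \<psi> :: "complex \<Rightarrow> real \<Rightarrow> complex^'p^('p + 'p)"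
  assumes Q_loc: "Q \<in> L1_loc_half"
    and Q_bdd: "\<exists>C. \<forall>x\<ge>0. onorm (\<lambda>u. Im_mat (Q x) *v u) \<le> C"
    and \<Phi>_herm: "\<Phi> = ctrans \<Phi>"
    and \<phi>_sol: "\<And>z. matrix_solution Q z (\<phi> z)"
    and \<phi>_init: "\<And>z. \<phi> z 0 = stack (- msin \<Phi>) (mcos \<Phi>)"
    and \<psi>_sol: "\<And>z. matrix_solution Q z (\<psi> z)"
    and \<psi>_init: "\<And>z. \<psi> z 0 = stack (mcos \<Phi>) (msin \<Phi>)"
  shows
    "(\<forall>z\<in>rho_A Q \<Phi>. (\<lambda>x. \<phi> z x ** weyl_function Q \<Phi> z + \<psi> z x) \<in> L2_half)
    \<and> (\<forall>M :: complex \<Rightarrow> complex^'p^'p.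
         (\<forall>z\<in>rho_A Q \<Phi>. (\<lambda>x. \<phi> z x ** M z + \<psi> z x) \<in> L2_half)
         \<longrightarrow> (\<forall>z\<in>rho_A Q \<Phi>. M z = weyl_function Q \<Phi> z))
    \<and> (\<forall>i j. (\<lambda>z. weyl_function Q \<Phi> z $ i $ j) holomorphic_on rho_A Q \<Phi>)
    \<and> (\<forall>z\<in>rho_A Q \<Phi>. \<forall>w\<in>rho_A Q \<Phi>.
      has_bochner_integral leb_half
        (\<lambda>x. ctrans (weyl_solution Q \<Phi> w x)
              ** (mat (z - cnj w) - mat (2 * \<i>) ** Im_mat (Q x))
              ** weyl_solution Q \<Phi> z x)
        (weyl_function Q \<Phi> z - ctrans (weyl_function Q \<Phi> w)))
    \<and> (\<forall>z\<in>rho_A Q \<Phi>.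
      has_bochner_integral leb_half
        (\<lambda>x. ctrans (weyl_solution Q \<Phi> z x)
              ** (mat (complex_of_real (Im z)) - Im_mat (Q x))
              ** weyl_solution Q \<Phi> z x)
        (Im_mat (weyl_function Q \<Phi> z)))
    \<and> (\<forall>z\<in>upper_half (beta_Q Q).
      \<exists>\<delta>>0. loewner_le (mat (complex_of_real \<delta>)) (Im_mat (weyl_function Q \<Phi> z)))
    \<and> (\<forall>z\<in>lower_half (alpha_Q Q).
      \<exists>\<delta>'<0. loewner_le (Im_mat (weyl_function Q \<Phi> z)) (mat (complex_of_real \<delta>')))"
proof -
  interpret dirac_system Q \<Phi> \<phi> \<psi>
    by unfold_locales (fact Q_loc Q_bdd \<Phi>_herm \<phi>_sol \<phi>_init \<psi>_sol \<psi>_init)+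
  have herm_real: "cdot (Im_mat (weyl_function Q \<Phi> z) *v v) v \<in> \<real>" for z v
    by (rule cdot_hermitian_real[OF ctrans_Im_mat])
  have mat_cdot: "cdot (mat (complex_of_real r) *v v) v = of_real (r * (norm v)\<^sup>2)" for r and v :: "complex^'p"
    by (simp only: mat_mult_vec cdot_scale_left cdot_self of_real_mult)
  have up: "\<exists>\<delta>>0. loewner_le (mat (complex_of_real \<delta>)) (Im_mat (weyl_function Q \<Phi> z))"
    if z: "z \<in> upper_half (beta_Q Q)" for z
  proof -
    obtain c where "definite 1 c z" using upper_half_definite[OF z] by blast
    then obtain \<delta> where \<delta>: "\<delta> > 0" "\<And>v. \<delta> * (norm v)\<^sup>2 \<le> Re (cdot (Im_mat (weyl_function Q \<Phi> z) *v v) v)"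
      using weyl_function_definite[of 1 c z] by auto
    show ?thesis
    proof (intro exI conjI)
      show "loewner_le (mat (complex_of_real \<delta>)) (Im_mat (weyl_function Q \<Phi> z))"
        unfolding loewner_le_def matrix_vector_mult_diff_rdistrib cdot_diff_left mat_cdot
        using \<delta>(2) by (auto intro!: Reals_diff herm_real)
    qed (rule \<delta>(1))
  qed
  have low: "\<exists>\<delta>'<0. loewner_le (Im_mat (weyl_function Q \<Phi> z)) (mat (complex_of_real \<delta>'))"
    if z: "z \<in> lower_half (alpha_Q Q)" for z
  proof -
    obtain c where "definite (- 1) c z" using lower_half_definite[OF z] by blast
    then obtain \<delta> where \<delta>: "\<delta> > 0" "\<And>v. \<delta> * (norm v)\<^sup>2 \<le> - Re (cdot (Im_mat (weyl_function Q \<Phi> z) *v v) v)"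
      using weyl_function_definite[of "- 1" c z] by auto
    show ?thesis
    proof (intro exI conjI)
      have "0 \<le> - \<delta> * (norm v)\<^sup>2 - Re (cdot (Im_mat (weyl_function Q \<Phi> z) *v v) v)" for v
        using \<delta>(2)[of v] by simp
      then show "loewner_le (Im_mat (weyl_function Q \<Phi> z)) (mat (complex_of_real (- \<delta>)))"
        unfolding loewner_le_def matrix_vector_mult_diff_rdistrib cdot_diff_left mat_cdot
        by (auto intro!: Reals_diff herm_real)
      show "- \<delta> < 0" using \<delta>(1) by simp
    qed
  qed
  have reg: "weyl_regular z" if "z \<in> rho_A Q \<Phi>" for z by (rule rho_A_weyl_regular[OF that])
  show ?thesis
    by (intro conjI ballI allI impI weyl_function_L2 weyl_function_holomorphic weyl_identity weyl_identity_Im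
        up low reg weyl_function_eq[symmetric]) auto
qed

end
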